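(* Let $n\ge 0$ be an integer, let $P$ be a real polynomial of degree $n+1$, and let $I(h)=\int_{\gamma_h}P(x)\,dy=-\int_{\gamma_h}P'(x)y\,dx=\sum_{j=0}^n\alpha_jI_j(h)$ with $I_j(h)=\int_{\gamma_h}x^jy\,dx$, where $\alpha_j$ are arbitrary real parameters depending on the coefficients of $P$ and $\gamma_h$, for $h\in L:=(0,1/6)$, are the ovals of $\{x^2/2+x^3/3+y^2/2=h\}$. Then $$I(h)=\sum_{j=0}^n\alpha_jI_j(h)=\sum_{j=0,\;j\not\equiv 2\!\pmod 3}^{n}a_jI_j(h),$$ where the $a_j$ can be taken as free real parameters and depend on the coefficients of $P$. Moreover: (i) The functions $I_j(h)$, $j\not\equiv 2\pmod 3$, are linearly independent. In particular, there are values of the constants $a_j$ such that $I(h)$ has $N(n)$ simple zeroes in $L$, where $$N(n)=\operatorname{Card}\{j: 0\le j\le n \text{ and } j\not\equiv 2\!\!\pmod 3\}-1=n-\left[\frac{n+1}{3}\right]$$ and $[\,\cdot\,]$ denotes the integer part function. (ii) There exists $h_1>0$ such that for each $n\le 50$ the functions $I_j(h)$, $0\le j\le n$ and $j\not\equiv 2\pmod 3$ (ordered by increasing $j$), form an ECT system on $(0,h_1)$. In particular, for $n\le 50$ the maximum number of zeroes of $I(h)$ (not identically zero) in $(0,h_1)$, taking into account their multiplicities, is $N(n)$. (iii) The ordered families $(I_0(h),I_1(h))$ and $(I_3(h),I_1(h),I_0(h))$ form ECT systems on $L$. In particular, for $n=0,1,2,3$, the maximum number of zeroes of $I(h)$ (not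 identically zero) in $L$, taking into account their multiplicities, is $N(n)$.
   Context: For $h\in(0,1/6)$, $\gamma_h$ is the compact oval surrounding the origin of the level set $\{x^2/2+x^3/3+y^2/2=h\}$ (contained in $\{x+1>0\}$), oriented counterclockwise. An ordered set of functions $(u_0,\dots,u_N)$ on an open interval $J$ is an extended complete Chebyshev (ECT) system on $J$ if for every $k=0,1,\dots,N$ any nontrivial linear combination $a_0u_0+\cdots+a_ku_k$ has at most $k$ isolated zeroes in $J$ counting multiplicity. *)

theory Defs
  imports
    "HOL-Complex_Analysis.Complex_Analysis"
    "HOL-Computational_Algebra.Polynomial"
    "HOL-Library.Extended_Nat"
begin

text \<open>The plane is identified with the complex numbers, \<open>x = Re z\<close> and \<open>y = Im z\<close>, so that
  the paths and winding numbers of the library can be used. All line integrals below are real.\<close>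

definition Ham :: "complex \<Rightarrow> real" where
  "Ham z = (Re z)\<^sup>2 / 2 + (Re z) ^ 3 / 3 + (Im z)\<^sup>2 / 2"

definition L :: "real set" where
  "L = {0<..<1/6}"

text \<open>For \<open>h\<close> in \<open>L\<close> the level set has two components: the compact oval around the origin, which
  lies in \<open>x > -1\<close>, and an unbounded curve, which lies in \<open>x < -1\<close>.\<close>

definition oval :: "real \<Rightarrow> complex set" where
  "oval h = {z. Ham z = h \<and> Re z > -1}"

definition ccw_oval :: "real \<Rightarrow> (real \<Rightarrow> complex) \<Rightarrow> bool" where
  "ccw_oval h g \<longleftrightarrow> valid_path g \<and> simple_path g \<and> pathfinish g = pathstart g \<and>
     path_image g = oval h \<and> winding_number g 0 = 1"

definition integral_dx :: "(real \<Rightarrow> complex) \<Rightarrow> (complex \<Rightarrow> real) \<Rightarrow> real" where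
  "integral_dx g f =
     integral {0..1} (\<lambda>t. f (g t) * Re (vector_derivative g (at t within {0..1})))"

definition integral_dy :: "(real \<Rightarrow> complex) \<Rightarrow> (complex \<Rightarrow> real) \<Rightarrow> real" where
  "integral_dy g f =
     integral {0..1} (\<lambda>t. f (g t) * Im (vector_derivative g (at t within {0..1})))"

text \<open>In the following, \<open>\<gamma> h\<close> is a path running through the oval at level \<open>h\<close>.\<close>

definition I_mono :: "(real \<Rightarrow> real \<Rightarrow> complex) \<Rightarrow> nat \<Rightarrow> real \<Rightarrow> real" where
  "I_mono \<gamma> j h = integral_dx (\<gamma> h) (\<lambda>z. (Re z) ^ j * Im z)"

definition I_poly :: "(real \<Rightarrow> real \<Rightarrow> complex) \<Rightarrow> real poly \<Rightarrow> real \<Rightarrow> real" where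
  "I_poly \<gamma> P h = integral_dy (\<gamma> h) (\<lambda>z. poly P (Re z))"

definition idx :: "nat \<Rightarrow> nat set" where
  "idx n = {j. j \<le> n \<and> j mod 3 \<noteq> 2}"

definition N :: "nat \<Rightarrow> nat" where
  "N n = card (idx n) - 1"

definition smooth_at :: "(real \<Rightarrow> real) \<Rightarrow> real \<Rightarrow> bool" where
  "smooth_at f t \<longleftrightarrow> (\<forall>i. (deriv ^^ i) f differentiable (at t))"

definition simple_zero :: "(real \<Rightarrow> real) \<Rightarrow> real \<Rightarrow> bool" where
  "simple_zero f t \<longleftrightarrow> f t = 0 \<and> (\<exists>D. (f has_real_derivative D) (at t) \<and> D \<noteq> 0)"

text \<open>The multiplicity of \<open>t\<close> as a zero of a smooth function: the order of the first
  non-vanishing derivative, or \<open>\<infinity>\<close> if all derivatives vanish.\<close>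

definition zero_mult :: "(real \<Rightarrow> real) \<Rightarrow> real \<Rightarrow> enat" where
  "zero_mult f t = (SUP m \<in> {m. \<forall>i<m. (deriv ^^ i) f t = 0}. enat m)"

definition count_mult :: "(real \<Rightarrow> real) \<Rightarrow> real set \<Rightarrow> enat" where
  "count_mult f Z = (SUP F \<in> {F. finite F \<and> F \<subseteq> Z}. \<Sum>t\<in>F. zero_mult f t)"

definition zeros :: "(real \<Rightarrow> real) \<Rightarrow> real set \<Rightarrow> real set" where
  "zeros f J = {t \<in> J. f t = 0}"

definition isolated_zeros :: "(real \<Rightarrow> real) \<Rightarrow> real set \<Rightarrow> real set" where
  "isolated_zeros f J = {t \<in> J. f t = 0 \<and> (\<forall>\<^sub>F s in at t. f s \<noteq> 0)}"

text \<open>\<open>us\<close> is the ordered family \<open>u\<^sub>0, \<dots>, u\<^sub>N\<close>, and \<open>J\<close> an open interval. Smoothness is what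
  makes the multiplicities meaningful.\<close>

definition ECT_system :: "(real \<Rightarrow> real) list \<Rightarrow> real set \<Rightarrow> bool" where
  "ECT_system us J \<longleftrightarrow>
     (\<forall>u\<in>set us. \<forall>t\<in>J. smooth_at u t) \<and>
     (\<forall>k<length us. \<forall>a :: nat \<Rightarrow> real. (\<exists>i\<le>k. a i \<noteq> 0) \<longrightarrow>
        (let f = (\<lambda>t. \<Sum>i\<le>k. a i * (us ! i) t)
         in count_mult f (isolated_zeros f J) \<le> enat k))"

text \<open>\<open>m\<close> is the maximum number of zeros in \<open>J\<close>, with multiplicity, of the functions \<open>I\<close> that do
  not vanish identically. The upper bound covers all coefficient vectors \<open>\<alpha>\<close>, hence all
  polynomials of degree at most \<open>n + 1\<close>; the bound is attained in degree \<open>n + 1\<close>.\<close>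

definition max_zeros ::
  "(real \<Rightarrow> real \<Rightarrow> complex) \<Rightarrow> nat \<Rightarrow> real set \<Rightarrow> nat \<Rightarrow> bool" where
  "max_zeros \<gamma> n J m \<longleftrightarrow>
     (\<forall>P. degree P \<le> n + 1 \<and> (\<exists>h\<in>J. I_poly \<gamma> P h \<noteq> 0) \<longrightarrow>
        count_mult (I_poly \<gamma> P) (zeros (I_poly \<gamma> P) J) \<le> enat m) \<and>
     (\<exists>P. degree P = n + 1 \<and> (\<exists>h\<in>J. I_poly \<gamma> P h \<noteq> 0) \<and>
        count_mult (I_poly \<gamma> P) (zeros (I_poly \<gamma> P) J) = enat m)"


subsection \<open>Every oval has a counterclockwise parametrization\<close>

definition scoord :: "real \<Rightarrow> real" where
  "scoord x = x * sqrt (1 + 2 * x / 3)"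

lemma scoord_square: "x \<ge> -1 \<Longrightarrow> (scoord x)\<^sup>2 = x\<^sup>2 + 2 * x ^ 3 / 3"
  by (simp add: scoord_def power_mult_distrib) (simp add: field_simps power2_eq_square power3_eq_cube)

lemma scoord_deriv:
  assumes "x > -3/2"
  shows "(scoord has_real_derivative (1 + x) / sqrt (1 + 2 * x / 3)) (at x)"
proof -
  have p: "1 + 2 * x / 3 > 0" using assms by simp
  define q where "q = sqrt (1 + 2 * x / 3)"
  have q: "q > 0" "q * q = 1 + 2 * x / 3" using p by (auto simp: q_def)
  have "q + x * (2 / 3 * (inverse q / 2)) = (1 + x) / q"
  proof -
    have "(q + x * (2 / 3 * (inverse q / 2))) * q = 1 + x"
      using q by (simp add: field_simps)
    then show ?thesis using q(1) by (simp add: field_simps)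
  qed
  then have e: "(1 + x) / sqrt (1 + 2 * x / 3) = sqrt (1 + 2 * x / 3) +
      x * (2 / 3 * (inverse (sqrt (1 + 2 * x / 3)) / 2))"
    unfolding q_def by simp
  show ?thesis unfolding e scoord_def[abs_def]
    by (rule derivative_eq_intros refl p | use p in simp)+
qed

lemma scoord_strict_mono:
  assumes "-1 \<le> x" "x < y"
  shows "scoord x < scoord y"
proof (rule DERIV_pos_imp_increasing_open[OF assms(2)])
  fix z assume "x < z" "z < y"
  then show "\<exists>d. (scoord has_real_derivative d) (at z) \<and> d > 0"
    using scoord_deriv[of z] assms by (intro exI[of _ "(1 + z) / sqrt (1 + 2 * z / 3)"]) auto
next
  show "continuous_on {x..y} scoord"
    unfolding scoord_def[abs_def] by (intro continuous_intros) auto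
qed

lemma scoord_inj: "-1 \<le> x \<Longrightarrow> -1 \<le> y \<Longrightarrow> scoord x = scoord y \<longleftrightarrow> x = y"
  using scoord_strict_mono[of x y] scoord_strict_mono[of y x] by (cases x y rule: linorder_cases) auto

lemma scoord_ends: "scoord (-1) = - sqrt (1/3)" "scoord 1 > sqrt (1/3)"
  by (auto simp: scoord_def)

lemma scoord_ex: "\<bar>s\<bar> < sqrt (1/3) \<Longrightarrow> \<exists>x. -1 < x \<and> scoord x = s"
proof -
  assume s: "\<bar>s\<bar> < sqrt (1/3)"
  have "\<exists>x\<ge>-1. x \<le> 1 \<and> scoord x = s"
  proof (rule IVT')
    show "continuous_on {-1..1} scoord"
      unfolding scoord_def[abs_def] by (intro continuous_intros) auto
  qed (use s scoord_ends in auto)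
  then obtain x where x: "x \<ge> -1" "scoord x = s" by auto
  moreover have "x \<noteq> -1" using x s scoord_ends(1) by (intro notI) auto
  ultimately show ?thesis by (intro exI[of _ x]) auto
qed

definition xcoord :: "real \<Rightarrow> real" where
  "xcoord s = (SOME x. -1 < x \<and> scoord x = s)"

lemma xcoord: "\<bar>s\<bar> < sqrt (1/3) \<Longrightarrow> -1 < xcoord s \<and> scoord (xcoord s) = s"
  unfolding xcoord_def by (rule someI_ex) (rule scoord_ex)

lemma xcoord_scoord: "-1 < x \<Longrightarrow> \<bar>scoord x\<bar> < sqrt (1/3) \<Longrightarrow> xcoord (scoord x) = x"
  using xcoord[of "scoord x"] scoord_inj[of "xcoord (scoord x)" x] by auto

lemma xcoord_cont:
  assumes "\<bar>s\<bar> < sqrt (1/3)" shows "isCont xcoord s"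
proof -
  define x where "x = xcoord s"
  have x: "-1 < x" "scoord x = s" using xcoord[OF assms] by (auto simp: x_def)
  have c: "isCont scoord z" if "z > -1" for z
    using scoord_deriv[of z] that by (auto intro: DERIV_isCont)
  have "continuous_on {-1<..} scoord"
    by (rule continuous_at_imp_continuous_on) (use c in auto)
  then have "open ({-1<..} \<inter> scoord -` {- sqrt (1/3) <..< sqrt (1/3)})"
    by (rule continuous_open_preimage) auto
  then have "open (scoord -` {- sqrt (1/3) <..< sqrt (1/3)} \<inter> {-1<..})"
    by (simp add: Int_commute)
  moreover have "x \<in> scoord -` {- sqrt (1/3) <..< sqrt (1/3)} \<inter> {-1<..}"
    using x assms by auto
  ultimately obtain d where d: "d > 0"
    "cball x d \<subseteq> scoord -` {- sqrt (1/3) <..< sqrt (1/3)} \<inter> {-1<..}"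
    unfolding open_contains_cball by blast
  have m: "-1 < z \<and> \<bar>scoord z\<bar> < sqrt (1/3)" if "\<bar>z - x\<bar> \<le> d" for z
    using subsetD[OF d(2), of z] that by (auto simp: dist_real_def abs_minus_commute)
  have "isCont xcoord (scoord x)"
    by (rule isCont_inverse_function[OF d(1)]) (use m xcoord_scoord c in auto)
  then show ?thesis using x by simp
qed

lemma xcoord_deriv:
  assumes "\<bar>s\<bar> < sqrt (1/3)"
  shows "(xcoord has_real_derivative inverse ((1 + xcoord s) / sqrt (1 + 2 * xcoord s / 3))) (at s)"
proof (rule DERIV_inverse_function)
  show "(scoord has_real_derivative (1 + xcoord s) / sqrt (1 + 2 * xcoord s / 3)) (at (xcoord s))"
    using xcoord[OF assms] by (intro scoord_deriv) auto
  show "(1 + xcoord s) / sqrt (1 + 2 * xcoord s / 3) \<noteq> 0" using xcoord[OF assms] by auto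
  show "- sqrt (1/3) < s" "s < sqrt (1/3)" using assms by auto
  show "scoord (xcoord y) = y" if "- sqrt (1/3) < y" "y < sqrt (1/3)" for y
    using xcoord[of y] that by auto
  show "isCont xcoord s" by (rule xcoord_cont) fact
qed

lemma scoord_sgn: "x > -1 \<Longrightarrow> sgn (scoord x) = sgn x"
  by (simp add: scoord_def sgn_mult)

theorem ccw_oval_exists:
  assumes "h \<in> L"
  shows "\<exists>g. ccw_oval h g"
proof -
  define r where "r = sqrt (2 * h)"
  have r: "r > 0" "r\<^sup>2 = 2 * h" "r < sqrt (1/3)" using assms by (auto simp: r_def L_def)
  define c where "c = circlepath 0 r"
  define psi where "psi = (\<lambda>w. Complex (xcoord (Re w)) (Im w))"
  define phi where "phi = (\<lambda>z. Complex (scoord (Re z)) (Im z))"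
  define g where "g = psi \<circ> c"
  have c_eq: "c t = Complex (r * cos (2 * pi * t)) (r * sin (2 * pi * t))" for t
    by (simp add: c_def circlepath complex_eq_iff Re_exp Im_exp)
  have bd: "\<bar>Re w\<bar> < sqrt (1/3)" if "w \<in> sphere 0 r" for w
    using that r(3) abs_Re_le_cmod[of w] by auto
  have ct: "c t \<in> sphere 0 r" for t
    using r(1) by (simp add: c_def circlepath norm_mult norm_exp_eq_Re)
  have bt: "\<bar>r * cos (2 * pi * t)\<bar> < sqrt (1/3)" for t
    using bd[OF ct[of t]] by (simp add: c_eq)
  have phipsi: "phi (psi w) = w" if "w \<in> sphere 0 r" for w
    using xcoord[OF bd[OF that]] by (simp add: phi_def psi_def)
  have g_eq: "g t = of_real (xcoord (r * cos (2 * pi * t))) + \<i> * of_real (r * sin (2 * pi * t))" for t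
    by (simp add: g_def psi_def c_eq complex_eq_iff)
  have ham: "Ham z = h \<longleftrightarrow> phi z \<in> sphere 0 r" if "Re z > -1" for z
  proof -
    have "(cmod (phi z))\<^sup>2 = 2 * Ham z"
      using that by (simp add: cmod_power2 phi_def scoord_square Ham_def)
    moreover have "cmod (phi z) = r \<longleftrightarrow> (cmod (phi z))\<^sup>2 = r\<^sup>2"
      using r(1) by (auto simp: power2_eq_iff_nonneg)
    ultimately show ?thesis using r(2) by auto
  qed
  have vp: "valid_path g"
  proof -
    define D where "D = (\<lambda>t. of_real (inverse ((1 + xcoord (r * cos (2 * pi * t))) /
        sqrt (1 + 2 * xcoord (r * cos (2 * pi * t)) / 3)) * (- 2 * pi * r * sin (2 * pi * t)))
        + \<i> * of_real (2 * pi * r * cos (2 * pi * t)) :: complex)"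
    have "(g has_vector_derivative D t) (at t)" for t
    proof -
      have "((\<lambda>t. r * cos (2 * pi * t)) has_real_derivative - 2 * pi * r * sin (2 * pi * t)) (at t)"
        by (auto intro!: derivative_eq_intros)
      note 1 = DERIV_chain2[OF xcoord_deriv[OF bt] this]
      have 2: "((\<lambda>t. r * sin (2 * pi * t)) has_real_derivative 2 * pi * r * cos (2 * pi * t)) (at t)"
        by (auto intro!: derivative_eq_intros)
      have "((\<lambda>t. of_real (xcoord (r * cos (2 * pi * t))) + \<i> * of_real (r * sin (2 * pi * t)))
         has_vector_derivative D t) (at t)"
        unfolding D_def
        by (intro has_vector_derivative_add has_vector_derivative_mult_right
            has_vector_derivative_of_real 1 2)
      moreover have "g = (\<lambda>t. of_real (xcoord (r * cos (2 * pi * t))) + \<i> * of_real (r * sin (2 * pi * t)))"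
        by (rule ext) (rule g_eq)
      ultimately show ?thesis by simp
    qed
    moreover have "continuous_on {0..1} D"
    proof -
      have "isCont (\<lambda>t. xcoord (r * cos (2 * pi * t))) t" for t
      proof (rule isCont_o2[where g = xcoord])
        show "isCont (\<lambda>t. r * cos (2 * pi * t)) t" by (intro continuous_intros)
        show "isCont xcoord (r * cos (2 * pi * t))" by (rule xcoord_cont) (rule bt)
      qed
      then have x: "continuous_on {0..1} (\<lambda>t. xcoord (r * cos (2 * pi * t)))"
        by (intro continuous_at_imp_continuous_on) auto
      have p: "(1 + xcoord (r * cos (2 * pi * t))) / sqrt (1 + 2 * xcoord (r * cos (2 * pi * t)) / 3) \<noteq> 0"
        "sqrt (1 + 2 * xcoord (r * cos (2 * pi * t)) / 3) \<noteq> 0" for t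
        using xcoord[OF bt[of t]] by auto
      define X where "X = (\<lambda>t. xcoord (r * cos (2 * pi * t)))"
      have 1: "continuous_on {0..1} (\<lambda>t. 1 + X t)"
        unfolding X_def by (rule continuous_on_add[OF continuous_on_const x])
      have 2: "continuous_on {0..1} (\<lambda>t. sqrt (1 + 2 * X t / 3))"
        using x unfolding X_def[symmetric] by (auto intro!: continuous_intros)
      have "continuous_on {0..1} (\<lambda>t. inverse ((1 + X t) / sqrt (1 + 2 * X t / 3)))"
        using p unfolding X_def[symmetric]
        by (intro continuous_on_inverse continuous_on_divide 1 2) (auto simp: X_def)
      moreover have "continuous_on {0..1} (\<lambda>t. sin (2 * pi * t))"
        by (intro continuous_intros)
      moreover have "continuous_on {0..1} (\<lambda>t. cos (2 * pi * t))"
        by (intro continuous_intros)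
      ultimately show ?thesis unfolding D_def X_def
        by (intro continuous_on_add continuous_on_mult continuous_on_const continuous_on_of_real)
    qed
    ultimately show ?thesis
      unfolding valid_path_def
      by (intro C1_differentiable_imp_piecewise) (auto simp: C1_differentiable_on_def)
  qed
  have "path g" using vp by (rule valid_path_imp_path)
  have sp: "simple_path g"
  proof -
    have "simple_path c" using r(1) by (simp add: c_def simple_path_circlepath)
    moreover have cg: "c s = c t" if "g s = g t" for s t
    proof -
      have "phi (g s) = phi (g t)" using that by (rule arg_cong)
      then show ?thesis using phipsi[OF ct[of s]] phipsi[OF ct[of t]] unfolding g_def o_def by metis
    qed
    ultimately have "loop_free g"
      unfolding simple_path_def loop_free_def by (meson cg)
    then show ?thesis using \<open>path g\<close> unfolding simple_path_def by simp
  qed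
  have loop: "pathfinish g = pathstart g"
    by (simp add: pathfinish_def pathstart_def g_eq)
  have im: "path_image g = oval h"
  proof (intro equalityI subsetI)
    fix z assume "z \<in> path_image g"
    then obtain t where t: "z = psi (c t)" by (auto simp: path_image_def g_def)
    have "Re z > -1" using xcoord[OF bd[OF ct[of t]]] by (simp add: t psi_def)
    moreover have "phi z \<in> sphere 0 r" using phipsi[OF ct[of t]] ct[of t] by (simp add: t)
    ultimately show "z \<in> oval h" using ham by (simp add: oval_def)
  next
    fix z assume "z \<in> oval h"
    then have z: "Re z > -1" "phi z \<in> sphere 0 r" using ham by (auto simp: oval_def)
    have "path_image c = sphere 0 r" using r(1) by (simp add: c_def)
    then have "phi z \<in> c ` {0..1}" using z(2) unfolding path_image_def by blast
    then obtain t where t: "t \<in> {0..1}" "phi z = c t" by blast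
    have "psi (phi z) = z"
      using xcoord_scoord[OF z(1)] bd[OF z(2)] by (simp add: psi_def phi_def)
    then show "z \<in> path_image g" using t by (auto simp: path_image_def g_def intro!: image_eqI[of _ _ t])
  qed
  have wn: "winding_number g 0 = 1"
  proof -
    have "homotopic_loops (- {0}) c g"
    proof (rule homotopic_loops_linear)
      show "path c" "path g" "pathfinish c = pathstart c" "pathfinish g = pathstart g"
        using \<open>path g\<close> loop by (auto simp: c_def)
      show "closed_segment (c t) (g t) \<subseteq> - {0}" for t
      proof -
        have "u = 0 \<longrightarrow> False" if useg: "u \<in> closed_segment (c t) (g t)" for u
        proof
          assume u0: "u = 0"
          obtain l where l: "0 \<le> l" "l \<le> 1" "u = (1 - l) *\<^sub>R c t + l *\<^sub>R g t"
            using useg by (auto simp: in_segment)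
          define s where "s = Re (c t)"
          have s: "\<bar>s\<bar> < sqrt (1/3)" using bd[OF ct] by (simp add: s_def)
          have Reg: "Re (g t) = xcoord s" "Im (g t) = Im (c t)"
            by (simp_all add: g_def psi_def s_def)
          have "Im u = Im (c t)" unfolding l(3) by (simp add: Reg(2)) (simp add: algebra_simps)
          then have "Im (c t) = 0" using u0 by simp
          then have "s \<noteq> 0" using ct[of t] r(1) by (auto simp: s_def cmod_def)
          have sg: "sgn (xcoord s) = sgn s"
            using scoord_sgn[of "xcoord s"] xcoord[OF s] by simp
          have R: "(1 - l) * s + l * xcoord s = 0"
            using l(3) u0 Reg by (simp add: s_def complex_eq_iff)
          show False
          proof (cases "s > 0")
            case True
            then have x: "xcoord s > 0" using sg by (simp add: sgn_if split: if_splits)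
            have "0 \<le> (1 - l) * s" "0 \<le> l * xcoord s" using l x True by auto
            then have "(1 - l) * s = 0" "l * xcoord s = 0" using R by linarith+
            then show False using x True by auto
          next
            case False
            then have s': "s < 0" using \<open>s \<noteq> 0\<close> by simp
            then have x: "xcoord s < 0" using sg by (simp add: sgn_if split: if_splits)
            have "(1 - l) * s \<le> 0" "l * xcoord s \<le> 0"
              using l x s' by (auto simp: mult_nonneg_nonpos)
            then have "(1 - l) * s = 0" "l * xcoord s = 0" using R by linarith+
            then show False using x s' by auto
          qed
        qed
        then show ?thesis by auto
      qed
    qed
    then have "winding_number c 0 = winding_number g 0"
      by (rule winding_number_homotopic_loops)
    then show ?thesis using winding_number_circlepath_centre[OF r(1), of 0] by (simp add: c_def)
  qed
  show ?thesis using vp sp loop im wn unfolding ccw_oval_def by blast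
qed

end

theory Submission
  imports Defs
begin

text \<open>In the coordinate \<open>s = scoord x\<close> the oval is the circle \<open>s = r cos \<theta>\<close>, \<open>y = r sin \<theta>\<close> with
  \<open>r\<^sup>2 = 2h\<close>, and \<open>x + 1/2 = cos (\<pi>/3 - 2/3 arcsin (\<surd>3 s))\<close>. Hence, if \<open>P(x)\<close> is expanded in the
  functions \<open>cos (m \<phi>)\<close>, where \<open>x + 1/2 = cos \<phi>\<close>, the integral of \<open>P dy\<close> becomes a combination with
  weights \<open>sin (m \<pi>/3)\<close> of power series in \<open>h\<close>, whose coefficients come from
  \<open>sin (a arcsin z)\<close> with \<open>a = 2m/3\<close>; the weight vanishes exactly when \<open>3\<close> divides \<open>m\<close>.

  The \<open>l\<close>-th coefficient is a polynomial of degree \<open>l\<close> in \<open>a\<^sup>2\<close>, so by Newton interpolation the first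
  \<open>N + 1\<close> coefficients determine a combination of \<open>N + 1\<close> such series. One of its first \<open>N + 1\<close>
  derivatives is therefore bounded away from \<open>0\<close> near \<open>h = 0\<close>, uniformly in the combination, and Rolle's
  theorem bounds the zeros.

  On the whole interval, the coefficients of \<open>I\<^sub>0\<close>, \<open>I\<^sub>1\<close>, \<open>I\<^sub>3\<close> are a common positive weight times
  polynomials of degree \<open>2\<close> in the index, so Descartes' rule of signs applies to the series; the pair
  \<open>(I\<^sub>0, I\<^sub>1)\<close> is treated by the sign of its Wronskian.\<close>

subsection \<open>Smooth functions and Rolle-type bounds on zeros\<close>


text \<open>With \<open>x = cos \<phi> - 1/2\<close> one gets
  \<open>3 * x^2 + 2 * x^3 = (1 + cos (3 * \<phi>)) / 2\<close>: up to affine maps the potential is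
  the Chebyshev polynomial of degree 3. This is where \<open>\<phi>\<close> and the trisected
  arcsine come from. If 3 divides \<open>m\<close>, then \<open>cos (m * \<phi>)\<close> is a
  polynomial in the square of \<open>s\<close>, hence even under the half turn of the circle, while
  \<open>dy\<close> is odd. With \<open>m = j + 1\<close> this explains the lost class of indices
  \<open>j\<close>. The delicate point near \<open>h = 0\<close> is to reach \<open>N\<close> and
  not \<open>N + 1\<close>. None of the \<open>N + 1\<close> series has a constant term, so the
  coefficients that determine a combination are those of \<open>h^1\<close> to
  \<open>h^(N+1)\<close>, and the derivative that stays away from \<open>0\<close> may have order
  \<open>N + 1\<close>. All series extend to negative \<open>h\<close> and vanish at
  \<open>h = 0\<close>; counting this common zero on a symmetric interval recovers the missing
  unit.\<close>

definition smooth_on :: "real set \<Rightarrow> (real \<Rightarrow> real) \<Rightarrow> bool" where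
  "smooth_on S f \<longleftrightarrow> (\<forall>t\<in>S. smooth_at f t)"

lemma higher_deriv_cong_on:
  fixes f g :: "real \<Rightarrow> real"
  assumes "open S" "\<And>x. x \<in> S \<Longrightarrow> f x = g x" "t \<in> S"
  shows "(deriv ^^ i) f t = (deriv ^^ i) g t"
proof (rule higher_deriv_cong_ev)
  show "\<forall>\<^sub>F x in nhds t. f x = g x"
    using assms eventually_nhds by blast
qed simp

lemma differentiable_cong_on:
  fixes f g :: "real \<Rightarrow> real"
  assumes "open S" "\<And>x. x \<in> S \<Longrightarrow> f x = g x" "t \<in> S" "f differentiable at t"
  shows "g differentiable at t"
proof -
  obtain D where "(f has_real_derivative D) (at t)"
    using assms(4) by (auto simp: real_differentiable_def)
  then have "(g has_real_derivative D) (at t)"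
    using assms by (auto intro: has_field_derivative_transform_within_open)
  then show ?thesis by (auto simp: real_differentiable_def)
qed

lemma smooth_on_cong:
  assumes "open S" "\<And>x. x \<in> S \<Longrightarrow> f x = g x" "smooth_on S f"
  shows "smooth_on S g"
  unfolding smooth_on_def smooth_at_def
proof (intro ballI allI)
  fix t i assume t: "t \<in> S"
  show "(deriv ^^ i) g differentiable at t"
    by (rule differentiable_cong_on[OF assms(1) higher_deriv_cong_on[OF assms(1,2)] t])
       (use assms(3) t in \<open>auto simp: smooth_on_def smooth_at_def\<close>)
qed

lemma higher_deriv_Suc: "(deriv ^^ Suc i) f = (deriv ^^ i) (deriv f)"
  by (simp only: funpow_Suc_right o_apply)

lemma smooth_on_deriv: "smooth_on S f \<Longrightarrow> smooth_on S (deriv f)"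
  unfolding smooth_on_def smooth_at_def higher_deriv_Suc[symmetric] by blast

lemma smooth_on_DERIV: "smooth_on S f \<Longrightarrow> t \<in> S \<Longrightarrow> (f has_real_derivative deriv f t) (at t)"
  unfolding smooth_on_def smooth_at_def DERIV_deriv_iff_real_differentiable
  by (drule bspec, assumption, drule spec[of _ 0]) simp

lemma smooth_on_subset: "smooth_on S f \<Longrightarrow> T \<subseteq> S \<Longrightarrow> smooth_on T f"
  by (auto simp: smooth_on_def)

lemma smooth_onI_deriv:
  assumes "open S" "\<And>t. t \<in> S \<Longrightarrow> (f has_real_derivative g t) (at t)" "smooth_on S g"
  shows "smooth_on S f"
  unfolding smooth_on_def smooth_at_def
proof (intro ballI allI)
  fix t i assume t: "t \<in> S"
  have sd: "smooth_on S (deriv f)"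
    by (rule smooth_on_cong[OF assms(1) _ assms(3)]) (simp add: DERIV_imp_deriv[OF assms(2)])
  show "(deriv ^^ i) f differentiable at t"
  proof (cases i)
    case 0 then show ?thesis using assms(2)[OF t] by (auto simp: real_differentiable_def)
  next
    case (Suc k) then show ?thesis using sd t
      unfolding Suc higher_deriv_Suc smooth_at_def smooth_on_def by blast
  qed
qed

lemma higher_deriv_add:
  assumes S: "open S" and "smooth_on S f" "smooth_on S g" "t \<in> S"
  shows "(deriv ^^ i) (\<lambda>x. f x + g x) t = (deriv ^^ i) f t + (deriv ^^ i) g t"
  using assms(2-4)
proof (induction i arbitrary: f g t)
  case (Suc i)
  have "(deriv ^^ Suc i) (\<lambda>x. f x + g x) t = (deriv ^^ i) (deriv (\<lambda>x. f x + g x)) t"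
    by (simp add: higher_deriv_Suc del: funpow.simps(2))
  also have "\<dots> = (deriv ^^ i) (\<lambda>x. deriv f x + deriv g x) t"
    by (rule higher_deriv_cong_on[OF S _ Suc.prems(3)])
       (intro DERIV_imp_deriv DERIV_add smooth_on_DERIV[OF Suc.prems(1)] smooth_on_DERIV[OF Suc.prems(2)])
  also have "\<dots> = (deriv ^^ i) (deriv f) t + (deriv ^^ i) (deriv g) t"
    by (intro Suc.IH smooth_on_deriv Suc.prems)
  finally show ?case by (simp add: higher_deriv_Suc del: funpow.simps(2))
qed auto

lemma smooth_on_add:
  assumes S: "open S" and "smooth_on S f" "smooth_on S g"
  shows "smooth_on S (\<lambda>x. f x + g x)"
  unfolding smooth_on_def smooth_at_def
proof (intro ballI allI)
  fix t i assume t: "t \<in> S"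
  show "(deriv ^^ i) (\<lambda>x. f x + g x) differentiable at t"
    by (rule differentiable_cong_on[OF S higher_deriv_add[OF assms, symmetric] t])
       (use assms t in \<open>auto simp: smooth_on_def smooth_at_def\<close>)
qed

lemma smooth_on_mult:
  assumes S: "open S" and "smooth_on S f" "smooth_on S g"
  shows "smooth_on S (\<lambda>x. f x * g x)"
  unfolding smooth_on_def smooth_at_def
proof (intro ballI allI)
  fix t i assume "t \<in> S"
  then show "(deriv ^^ i) (\<lambda>x. f x * g x) differentiable at t"
    using assms(2,3)
  proof (induction i arbitrary: f g t rule: less_induct)
    case (less i)
    note D = smooth_on_DERIV[OF less.prems(2)] smooth_on_DERIV[OF less.prems(3)]
    show ?case
    proof (cases i)
      case 0
      have "((\<lambda>x. f x * g x) has_real_derivative deriv f t * g t + deriv g t * f t) (at t)"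
        by (intro DERIV_mult D less.prems)
      then show ?thesis using 0 by (auto simp: real_differentiable_def)
    next
      case (Suc k)
      define u v where "u = (\<lambda>x. deriv f x * g x)" and "v = (\<lambda>x. deriv g x * f x)"
      have e: "deriv (\<lambda>x. f x * g x) x = u x + v x" if "x \<in> S" for x
        unfolding u_def v_def using that by (intro DERIV_imp_deriv DERIV_mult D)
      have pm: "(deriv ^^ j) u differentiable at x" "(deriv ^^ j) v differentiable at x"
        if "x \<in> S" "j \<le> k" for x j
        unfolding u_def v_def using Suc that less.prems
        by (auto intro!: less.IH smooth_on_deriv)
      \<comment> \<open>\<open>higher_deriv_add\<close> asks for smoothness of all orders, but the
        induction provides it for the products \<open>u\<close> and \<open>v\<close> only up to
        order \<open>k\<close>. Additivity is therefore redone up to that order.\<close>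
      have eq: "(deriv ^^ j) (\<lambda>x. u x + v x) x = (deriv ^^ j) u x + (deriv ^^ j) v x"
        if "x \<in> S" "j \<le> k" for x j
        using that
      proof (induction j arbitrary: x)
        case (Suc j)
        have "deriv ((deriv ^^ j) (\<lambda>x. u x + v x)) x
            = deriv (\<lambda>x. (deriv ^^ j) u x + (deriv ^^ j) v x) x"
          using Suc.IH Suc.prems
          by (intro higher_deriv_cong_on[OF S, of _ _ x 1, simplified]) auto
        also have "\<dots> = deriv ((deriv ^^ j) u) x + deriv ((deriv ^^ j) v) x"
          using pm[of x j] Suc.prems
          by (intro DERIV_imp_deriv DERIV_add) (auto simp: DERIV_deriv_iff_real_differentiable)
        finally show ?case by simp
      qed auto
      have "(deriv ^^ i) (\<lambda>x. f x * g x) x = (deriv ^^ k) u x + (deriv ^^ k) v x" if "x \<in> S" for x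
        using higher_deriv_cong_on[OF S e that, where i = k] eq[OF that order_refl] Suc
        by (simp add: higher_deriv_Suc del: funpow.simps(2))
      moreover have "(\<lambda>x. (deriv ^^ k) u x + (deriv ^^ k) v x) differentiable at t"
        using pm[OF less.prems(1) order_refl] by (intro derivative_intros)
      ultimately show ?thesis
        by (intro differentiable_cong_on[OF S _ less.prems(1), of _ "(deriv ^^ i) (\<lambda>x. f x * g x)"]) auto
    qed
  qed
qed

lemma smooth_on_const [simp]: "smooth_on S (\<lambda>_. c)"
proof -
  have "(deriv ^^ i) (\<lambda>_. c) = (\<lambda>_. if i = 0 then c else 0)" for i
    by (induction i) auto
  then show ?thesis by (auto simp: smooth_on_def smooth_at_def)
qed

lemma smooth_on_ident: "open S \<Longrightarrow> smooth_on S (\<lambda>x. x)"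
  by (rule smooth_onI_deriv[where g = "\<lambda>_. 1"]) auto

section \<open>Zeros with lower bounds for their multiplicity, and Rolle's theorem\<close>

definition vanishes :: "nat \<Rightarrow> (real \<Rightarrow> real) \<Rightarrow> real \<Rightarrow> bool" where
  "vanishes m f t \<longleftrightarrow> (\<forall>i<m. (deriv ^^ i) f t = 0)"

lemma vanishes_0 [simp]: "vanishes 0 f t"
  by (simp add: vanishes_def)

lemma vanishes_Suc: "vanishes (Suc m) f t \<longleftrightarrow> f t = 0 \<and> vanishes m (deriv f) t"
proof -
  have "vanishes (Suc m) f t \<longleftrightarrow> (deriv ^^ 0) f t = 0 \<and> (\<forall>i<m. (deriv ^^ Suc i) f t = 0)"
    unfolding vanishes_def by (rule All_less_Suc2)
  then show ?thesis
    unfolding vanishes_def higher_deriv_Suc by (simp only: funpow_0)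
qed

lemma vanishes_mono: "vanishes m f t \<Longrightarrow> k \<le> m \<Longrightarrow> vanishes k f t"
  by (auto simp: vanishes_def)

lemma vanishes_cong:
  assumes "open S" "\<And>x. x \<in> S \<Longrightarrow> f x = g x" "t \<in> S"
  shows "vanishes m f t \<longleftrightarrow> vanishes m g t"
  unfolding vanishes_def using higher_deriv_cong_on[OF assms] by simp

lemma vanishes_add:
  assumes "open S" "smooth_on S f" "smooth_on S g" "t \<in> S" "vanishes m f t" "vanishes m g t"
  shows "vanishes m (\<lambda>x. f x + g x) t"
  using assms by (simp add: vanishes_def higher_deriv_add)

lemma vanishes_mult:
  assumes S: "open S" and "smooth_on S p" "smooth_on S f" "t \<in> S" "vanishes m f t"
  shows "vanishes m (\<lambda>x. p x * f x) t"
  using assms(2-5)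
proof (induction m arbitrary: p f)
  case (Suc m)
  note D = smooth_on_DERIV[OF Suc.prems(1)] smooth_on_DERIV[OF Suc.prems(2)]
  have v: "f t = 0" "vanishes m (deriv f) t" using Suc.prems(4) by (auto simp: vanishes_Suc)
  have vm: "vanishes m f t" using Suc.prems(4) by (rule vanishes_mono) simp
  have sm: "smooth_on S (deriv p)" "smooth_on S (deriv f)"
    by (rule smooth_on_deriv Suc.prems)+
  have e: "deriv (\<lambda>x. p x * f x) x = deriv p x * f x + deriv f x * p x" if "x \<in> S" for x
    by (rule DERIV_imp_deriv[OF DERIV_mult[OF D(1)[OF that] D(2)[OF that]]])
  have "vanishes m (\<lambda>x. deriv f x * p x) t"
    unfolding mult.commute[of "deriv f _"]
    by (rule Suc.IH[OF Suc.prems(1) sm(2) Suc.prems(3) v(2)])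
  then have "vanishes m (\<lambda>x. deriv p x * f x + deriv f x * p x) t"
    by (intro vanishes_add[OF S] smooth_on_mult[OF S] Suc.IH[OF sm(1) Suc.prems(2,3) vm] sm Suc.prems)
  then have "vanishes m (deriv (\<lambda>x. p x * f x)) t"
    using vanishes_cong[OF S e Suc.prems(3), where m = m] by simp
  then show ?case using v(1) by (simp add: vanishes_Suc)
qed simp

text \<open>\<open>\<mu> t\<close> is only a lower bound for the multiplicity. Quantifying over all
  finite sets and all such bounds keeps the count in \<open>nat\<close>; infinitely many zeros, or a
  zero of infinite order, simply make every bound \<open>k\<close> fail.\<close>

definition zeros_le :: "(real \<Rightarrow> real) \<Rightarrow> real set \<Rightarrow> nat \<Rightarrow> bool" where
  "zeros_le f J k \<longleftrightarrow>
     (\<forall>F \<mu>. finite F \<and> F \<subseteq> J \<and> (\<forall>t\<in>F. \<mu> t > 0 \<and> vanishes (\<mu> t) f t) \<longrightarrow> sum \<mu> F \<le> k)"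

lemma zeros_leD:
  assumes "zeros_le f J k" "finite F" "F \<subseteq> J" "\<And>t. t \<in> F \<Longrightarrow> vanishes (\<mu> t) f t"
  shows "sum \<mu> F \<le> k"
proof -
  have "sum \<mu> F = sum \<mu> {t\<in>F. \<mu> t > 0}"
    using assms(2) by (intro sum.mono_neutral_right) auto
  also have "\<dots> \<le> k"
    by (rule assms(1)[unfolded zeros_le_def, rule_format]) (use assms(2-4) in auto)
  finally show ?thesis .
qed

lemma zeros_le_cong:
  assumes "open S" "J \<subseteq> S" "\<And>x. x \<in> S \<Longrightarrow> f x = g x" "zeros_le f J k"
  shows "zeros_le g J k"
  unfolding zeros_le_def
proof (intro allI impI)
  fix F \<mu> assume F: "finite F \<and> F \<subseteq> J \<and> (\<forall>t\<in>F. \<mu> t > 0 \<and> vanishes (\<mu> t) g t)"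
  have "vanishes (\<mu> t) f t" if "t \<in> F" for t
    using vanishes_cong[OF assms(1,3), where t = t and m = "\<mu> t"] F that assms(2) by auto
  then show "sum \<mu> F \<le> k" using zeros_leD[OF assms(4)] F by auto
qed

lemma zeros_le_mono: "zeros_le f J k \<Longrightarrow> k \<le> l \<Longrightarrow> J' \<subseteq> J \<Longrightarrow> zeros_le f J' l"
  unfolding zeros_le_def by (blast intro: le_trans)

lemma zeros_le_0I:
  assumes "\<And>t. t \<in> J \<Longrightarrow> f t \<noteq> 0"
  shows "zeros_le f J 0"
  unfolding zeros_le_def
proof (intro allI impI)
  fix F \<mu> assume F: "finite F \<and> F \<subseteq> J \<and> (\<forall>t\<in>F. \<mu> t > 0 \<and> vanishes (\<mu> t) f t)"
  have "F = {}"
  proof (rule ccontr)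
    assume "F \<noteq> {}"
    then obtain t where t: "t \<in> F" by auto
    then have "f t = 0" using F vanishes_Suc[of "\<mu> t - 1" f t] by auto
    then show False using assms F t by auto
  qed
  then show "sum \<mu> F \<le> 0" by simp
qed

lemma zeros_le_card:
  assumes "zeros_le f J k" "finite F" "F \<subseteq> J" "\<And>t. t \<in> F \<Longrightarrow> f t = 0"
  shows "card F \<le> k"
  using zeros_leD[OF assms(1-3), of "\<lambda>_. 1"] assms(4) by (simp add: vanishes_Suc[of 0, simplified])

text \<open>Here \<open>g\<close> plays the role of the derivative of \<open>f\<close>.\<close>

lemma zeros_le_Rolle:
  assumes g: "zeros_le g J k"
    and J: "\<And>s t. s \<in> J \<Longrightarrow> t \<in> J \<Longrightarrow> {s..t} \<subseteq> J"
    and v: "\<And>m t. t \<in> J \<Longrightarrow> vanishes (Suc m) f t \<Longrightarrow> vanishes m g t"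
    and r: "\<And>s t. s \<in> J \<Longrightarrow> t \<in> J \<Longrightarrow> s < t \<Longrightarrow> f s = 0 \<Longrightarrow> f t = 0 \<Longrightarrow>
      \<exists>x. s < x \<and> x < t \<and> g x = 0"
  shows "zeros_le f J (Suc k)"
  unfolding zeros_le_def
proof (intro allI impI)
  fix F \<mu> assume F: "finite F \<and> F \<subseteq> J \<and> (\<forall>t\<in>F. \<mu> t > 0 \<and> vanishes (\<mu> t) f t)"
  have f0: "f t = 0" if "t \<in> F" for t
    using F that vanishes_Suc[of "\<mu> t - 1" f t] by auto
  \<comment> \<open>\<open>S\<close> collects one zero of \<open>g\<close> from each gap between
    neighbouring points of \<open>F\<close>, so it is disjoint from \<open>F\<close>. The last
    conjunct keeps \<open>S\<close> below the maximum of \<open>F\<close>; hence the point found in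
    the next gap is new.\<close>
  have "\<exists>S. finite S \<and> S \<inter> F = {} \<and> Suc (card S) \<ge> card F \<and> S \<subseteq> J \<and> (\<forall>x\<in>S. g x = 0)
           \<and> (\<forall>x\<in>S. \<exists>t\<in>F. x < t)"
    if "finite F" "F \<subseteq> J" "\<forall>t\<in>F. f t = 0" for F
    using that
  proof (induction F rule: finite_linorder_max_induct)
    case empty
    show ?case by (intro exI[of _ "{}"]) auto
  next
    case (insert b A)
    then obtain S where S: "finite S" "S \<inter> A = {}" "Suc (card S) \<ge> card A" "S \<subseteq> J"
      "\<forall>x\<in>S. g x = 0" "\<forall>x\<in>S. \<exists>t\<in>A. x < t" by auto
    show ?case
    proof (cases "A = {}")
      case True then show ?thesis by (intro exI[of _ "{}"]) auto
    next
      case False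
      define a where "a = Max A"
      have a: "a \<in> A" "\<And>t. t \<in> A \<Longrightarrow> t \<le> a" using False insert.hyps by (auto simp: a_def)
      then obtain x where x: "a < x" "x < b" "g x = 0"
        using r[of a b] insert by auto
      have "x \<in> J" using J[of a b] a x insert.prems by (auto simp: subset_iff)
      have "x \<notin> S" using S(6) a(2) x(1) by force
      have "x \<notin> A" using a x by force
      have 1: "card (insert b A) = Suc (card A)" using insert.hyps by (subst card_insert_disjoint) auto
      have 2: "card (insert x S) = Suc (card S)" using S \<open>x \<notin> S\<close> by simp
      have 3: "b \<notin> S" using S(6) insert.hyps(2) by force
      show ?thesis
        by (intro exI[of _ "insert x S"])
          (use S x \<open>x \<in> J\<close> \<open>x \<notin> A\<close> 1 2 3 in auto)
    qed
  qed
  from this[of F] obtain S where S: "finite S" "S \<inter> F = {}" "Suc (card S) \<ge> card F" "S \<subseteq> J"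
      "\<forall>x\<in>S. g x = 0" using F f0 by auto
  \<comment> \<open>Each point of \<open>F\<close> loses one unit of multiplicity and the gaps
    return at least \<open>card F - 1\<close> units, so the total drops by at most one.\<close>
  define \<nu> where "\<nu> = (\<lambda>t. if t \<in> S then 1 else \<mu> t - 1)"
  have "sum \<nu> (F \<union> S) \<le> k"
  proof (rule zeros_leD[OF g])
    fix t assume t: "t \<in> F \<union> S"
    show "vanishes (\<nu> t) g t"
    proof (cases "t \<in> S")
      case True then show ?thesis using S by (simp add: \<nu>_def vanishes_Suc[of 0, simplified])
    next
      case False then show ?thesis using t F v[of t "\<mu> t - 1"] by (auto simp: \<nu>_def)
    qed
  qed (use F S in auto)
  moreover have "sum \<nu> (F \<union> S) = sum \<nu> F + sum \<nu> S"
    using F S by (intro sum.union_disjoint) auto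
  moreover have "sum \<nu> S = card S" by (simp add: \<nu>_def)
  moreover have "sum \<mu> F = sum \<nu> F + card F"
  proof -
    have "sum \<mu> F = (\<Sum>t\<in>F. \<nu> t + 1)"
      using F S by (intro sum.cong) (auto simp: \<nu>_def)
    then show ?thesis by (simp only: sum.distrib) simp
  qed
  ultimately show "sum \<mu> F \<le> Suc k" using S(3) by linarith
qed

lemma Rolle_DERIV:
  fixes f D :: "real \<Rightarrow> real"
  assumes "s < t" "f s = f t" "\<And>x. s \<le> x \<Longrightarrow> x \<le> t \<Longrightarrow> (f has_real_derivative D x) (at x)"
  shows "\<exists>z. s < z \<and> z < t \<and> D z = 0"
proof -
  have "continuous_on {s..t} f"
    by (rule DERIV_continuous_on, rule has_field_derivative_at_within, rule assms(3)) auto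
  moreover have "(f has_derivative (*) (D x)) (at x)" if "s < x" "x < t" for x
    using assms(3)[of x] that by (simp add: has_field_derivative_def)
  ultimately have "\<exists>z. s < z \<and> z < t \<and> (*) (D z) = (\<lambda>v. 0)"
    by (rule Rolle_deriv[OF assms(1,2)])
  then obtain z where z: "s < z" "z < t" "(*) (D z) = (\<lambda>v. 0)" by blast
  have "D z * 1 = 0" using fun_cong[OF z(3), of 1] .
  then show ?thesis using z(1,2) by (intro exI[of _ z]) simp
qed

lemma zeros_le_Rolle_deriv:
  assumes "smooth_on J f" "zeros_le (deriv f) J k"
    and J: "\<And>s t. s \<in> J \<Longrightarrow> t \<in> J \<Longrightarrow> {s..t} \<subseteq> J"
  shows "zeros_le f J (Suc k)"
proof (rule zeros_le_Rolle[OF assms(2) J])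
  fix s t assume st: "s \<in> J" "t \<in> J" "s < t" "f s = 0" "f t = 0"
  have d: "(f has_real_derivative deriv f x) (at x)" if "s \<le> x" "x \<le> t" for x
    using smooth_on_DERIV[OF assms(1)] J[OF st(1,2)] that by auto
  have "\<exists>z. s < z \<and> z < t \<and> deriv f z = 0"
    by (rule Rolle_DERIV[of s t f]) (use st d in auto)
  then show "\<exists>x>s. x < t \<and> deriv f x = 0" by blast
qed (simp_all add: vanishes_Suc)

lemma zeros_le_higher_deriv:
  assumes "smooth_on J f" "\<And>t. t \<in> J \<Longrightarrow> (deriv ^^ i) f t \<noteq> 0"
    and J: "\<And>s t. s \<in> J \<Longrightarrow> t \<in> J \<Longrightarrow> {s..t} \<subseteq> J"
  shows "zeros_le f J i"
  using assms(1,2)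
proof (induction i arbitrary: f)
  case 0 then show ?case by (auto intro: zeros_le_0I)
next
  case (Suc i)
  have "zeros_le (deriv f) J i"
    by (rule Suc.IH) (use Suc.prems in \<open>auto simp: higher_deriv_Suc smooth_on_deriv simp del: funpow.simps(2)\<close>)
  then show ?case using Suc.prems(1) J by (intro zeros_le_Rolle_deriv)
qed

text \<open>Rolle's theorem for \<open>x powr (-\<rho>) * f x\<close>, whose derivative is
  \<open>x powr (-\<rho>-1)\<close> times the expression in the assumption. Both powers are positive
  on the interval and change no zeros.\<close>

lemma zeros_le_Euler:
  fixes \<rho> :: real
  assumes "smooth_on {0<..<R} f" "zeros_le (\<lambda>x. x * deriv f x - \<rho> * f x) {0<..<R} k"
  shows "zeros_le f {0<..<R} (Suc k)"
proof (rule zeros_le_Rolle[OF assms(2)])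
  fix s t assume st: "s \<in> {0<..<R}" "t \<in> {0<..<R}" "s < t" "f s = 0" "f t = 0"
  have d: "((\<lambda>x. x powr (-\<rho>) * f x) has_real_derivative x powr (-\<rho>-1) * (x * deriv f x - \<rho> * f x)) (at x)"
    if "s \<le> x" "x \<le> t" for x
  proof -
    have x: "x > 0" "(f has_real_derivative deriv f x) (at x)"
      using smooth_on_DERIV[OF assms(1), of x] st that by auto
    have p: "x powr (-\<rho>) = x powr (-\<rho>-1) * x"
      using x(1) by (simp add: powr_diff)
    have "((\<lambda>x. x powr (-\<rho>) * f x) has_real_derivative
        ((-\<rho>) * x powr (-\<rho> - 1)) * f x + deriv f x * x powr (-\<rho>)) (at x)"
      by (intro DERIV_mult x(2) has_real_derivative_powr x(1))
    then show ?thesis unfolding p by (simp add: algebra_simps)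
  qed
  define D where "D = (\<lambda>x. x powr (-\<rho>-1) * (x * deriv f x - \<rho> * f x))"
  obtain z where z: "s < z" "z < t" "D z = 0"
    using Rolle_DERIV[of s t "\<lambda>x. x powr (-\<rho>) * f x" D] st d by (auto simp: D_def)
  then have "z * deriv f z - \<rho> * f z = 0" using z st by (auto simp: D_def)
  then show "\<exists>x>s. x < t \<and> x * deriv f x - \<rho> * f x = 0" using z by blast
next
  fix m t assume t: "t \<in> {0<..<R}" and v: "vanishes (Suc m) f t"
  have "vanishes m (\<lambda>x. x * deriv f x + (-\<rho>) * f x) t"
  proof (intro vanishes_add[of "{0<..<R}"] vanishes_mult[of "{0<..<R}"] smooth_on_mult)
    show "vanishes m (deriv f) t" using v by (simp add: vanishes_Suc)
    show "vanishes m f t" using v by (rule vanishes_mono) simp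
  qed (use assms t in \<open>auto simp: smooth_on_ident smooth_on_deriv\<close>)
  then show "vanishes m (\<lambda>x. x * deriv f x - \<rho> * f x) t" by simp
qed auto

text \<open>Rolle's theorem for the quotient \<open>f / u\<close>: up to the factor
  \<open>1 / u^2\<close> its derivative is the Wronskian of \<open>u\<close> and
  \<open>f\<close>.\<close>

lemma zeros_le_Wronskian:
  assumes f: "smooth_on {0<..<R} f" and u: "smooth_on {0<..<R} u"
    and nz: "\<And>x. x \<in> {0<..<R} \<Longrightarrow> u x \<noteq> 0"
    and W: "zeros_le (\<lambda>x. u x * deriv f x - deriv u x * f x) {0<..<R} k"
  shows "zeros_le f {0<..<R} (Suc k)"
proof (rule zeros_le_Rolle[OF W])
  fix s t assume st: "s \<in> {0<..<R}" "t \<in> {0<..<R}" "s < t" "f s = 0" "f t = 0"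
  have d: "((\<lambda>x. f x / u x) has_real_derivative (u x * deriv f x - deriv u x * f x) / (u x * u x)) (at x)"
    if "s \<le> x" "x \<le> t" for x
    using DERIV_divide[OF smooth_on_DERIV[OF f, of x] smooth_on_DERIV[OF u, of x] nz[of x]] st that
    by (simp add: mult.commute)
  define D where "D = (\<lambda>x. (u x * deriv f x - deriv u x * f x) / (u x * u x))"
  obtain z where z: "s < z" "z < t" "D z = 0"
    using Rolle_DERIV[of s t "\<lambda>x. f x / u x" D] st d by (auto simp: D_def)
  then have "u z * deriv f z - deriv u z * f z = 0" using z st nz[of z] by (auto simp: D_def)
  then show "\<exists>x>s. x < t \<and> u x * deriv f x - deriv u x * f x = 0" using z by blast
next
  fix m t assume t: "t \<in> {0<..<R}" and v: "vanishes (Suc m) f t"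
  have "vanishes m (\<lambda>x. u x * deriv f x + (- 1 * deriv u x) * f x) t"
  proof (intro vanishes_add[of "{0<..<R}"] vanishes_mult[of "{0<..<R}"] smooth_on_mult)
    show "vanishes m (deriv f) t" using v by (simp add: vanishes_Suc)
    show "vanishes m f t" using v by (rule vanishes_mono) simp
  qed (use assms t in \<open>auto simp: smooth_on_deriv\<close>)
  then show "vanishes m (\<lambda>x. u x * deriv f x - deriv u x * f x) t" by simp
qed auto

subsection \<open>Power series\<close>


definition pser :: "(nat \<Rightarrow> real) \<Rightarrow> real \<Rightarrow> real" where
  "pser c x = (\<Sum>n. c n * x ^ n)"

definition pconv :: "real \<Rightarrow> (nat \<Rightarrow> real) \<Rightarrow> bool" where
  "pconv R c \<longleftrightarrow> (\<forall>x. \<bar>x\<bar> < R \<longrightarrow> summable (\<lambda>n. c n * x ^ n))"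

lemma pconvD: "pconv R c \<Longrightarrow> \<bar>x\<bar> < R \<Longrightarrow> summable (\<lambda>n. c n * x ^ n)"
  by (simp add: pconv_def)

lemma pser_sums: "pconv R c \<Longrightarrow> \<bar>x\<bar> < R \<Longrightarrow> (\<lambda>n. c n * x ^ n) sums pser c x"
  unfolding pser_def by (intro summable_sums pconvD)

lemma pser_eqI: "(\<lambda>n. c n * x ^ n) sums s \<Longrightarrow> pser c x = s"
  by (simp add: pser_def sums_iff)

lemma pconv_diffs: "pconv R c \<Longrightarrow> pconv R (diffs c)"
  unfolding pconv_def by (intro allI impI termdiff_converges[of _ R c]) (simp_all add: real_norm_def)

lemma pser_DERIV:
  assumes "pconv R c" "\<bar>x\<bar> < R"
  shows "(pser c has_real_derivative pser (diffs c) x) (at x)"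
  unfolding pser_def[abs_def]
  by (rule termdiffs_strong'[of R]) (use assms in \<open>simp_all add: pconv_def\<close>)

lemma pser_higher_deriv:
  assumes "pconv R c" "\<bar>x\<bar> < R"
  shows "(deriv ^^ i) (pser c) x = pser ((diffs ^^ i) c) x"
  using assms
proof (induction i arbitrary: c x)
  case (Suc i)
  have "(deriv ^^ i) (deriv (pser c)) x = (deriv ^^ i) (pser (diffs c)) x"
  proof (rule higher_deriv_cong_on[of "{-R<..<R}"])
    fix y assume "y \<in> {-R<..<R}"
    then show "deriv (pser c) y = pser (diffs c) y"
      using Suc.prems(1) by (intro DERIV_imp_deriv pser_DERIV[of R]) auto
  qed (use Suc.prems in auto)
  also have "\<dots> = pser ((diffs ^^ i) (diffs c)) x"
    by (intro Suc.IH pconv_diffs Suc.prems)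
  finally show ?case by (simp only: funpow_Suc_right o_apply)
qed auto

lemma pconv_diffs_pow: "pconv R c \<Longrightarrow> pconv R ((diffs ^^ i) c)"
  by (induction i) (auto intro: pconv_diffs)

lemma smooth_on_pser:
  assumes "pconv R c"
  shows "smooth_on {-R<..<R} (pser c)"
  unfolding smooth_on_def smooth_at_def
proof (intro ballI allI)
  fix t i assume t: "t \<in> {-R<..<R}"
  then have "\<bar>t\<bar> < R" by auto
  from pser_DERIV[OF pconv_diffs_pow[OF assms] this]
  have d: "pser ((diffs ^^ i) c) differentiable at t"
    unfolding real_differentiable_def by blast
  have e: "pser ((diffs ^^ i) c) x = (deriv ^^ i) (pser c) x" if "x \<in> {-R<..<R}" for x
    by (rule pser_higher_deriv[OF assms, symmetric]) (use that in auto)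
  show "(deriv ^^ i) (pser c) differentiable at t"
    by (rule differentiable_cong_on[OF open_greaterThanLessThan e t d])
qed

lemma diffs_pow_0: "(diffs ^^ i) c 0 = fact i * c i" for c :: "nat \<Rightarrow> real"
proof -
  have "fact n * (diffs ^^ i) c n = fact (n + i) * c (n + i)" for n
  proof (induction i arbitrary: n)
    case (Suc i)
    have "fact n * (diffs ^^ Suc i) c n = fact (Suc n) * (diffs ^^ i) c (Suc n)"
      by (simp only: funpow.simps o_apply diffs_def[of "(diffs ^^ i) c"] fact_Suc mult_ac)
    also have "\<dots> = fact (n + Suc i) * c (n + Suc i)"
      unfolding Suc.IH by simp
    finally show ?case .
  qed simp
  from this[of 0] show ?thesis by (simp only: fact_0 mult_1 add_0)
qed

lemma pser_0: "pser c 0 = c 0"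
  unfolding pser_def by (rule powser_zero)

lemma pser_add:
  assumes "pconv R c" "pconv R d" "\<bar>x\<bar> < R"
  shows "pser (\<lambda>n. c n + d n) x = pser c x + pser d x"
  by (rule pser_eqI) (use sums_add[OF pser_sums[OF assms(1,3)] pser_sums[OF assms(2,3)]] in
    \<open>simp add: distrib_right\<close>)

lemma pconv_add: "pconv R c \<Longrightarrow> pconv R d \<Longrightarrow> pconv R (\<lambda>n. c n + d n)"
  unfolding pconv_def by (simp add: distrib_right summable_add)

lemma pser_cmult:
  assumes "pconv R c" "\<bar>x\<bar> < R"
  shows "pser (\<lambda>n. a * c n) x = a * pser c x"
  by (rule pser_eqI) (use sums_mult[OF pser_sums[OF assms], of a] in \<open>simp add: mult.assoc\<close>)

lemma pconv_cmult: "pconv R c \<Longrightarrow> pconv R (\<lambda>n. a * c n)"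
  unfolding pconv_def by (simp add: mult.assoc summable_mult)

lemma pconv_0: "pconv R (\<lambda>n. 0)"
  by (simp add: pconv_def)

lemma pser_sum:
  assumes "finite M" "\<And>m. m \<in> M \<Longrightarrow> pconv R (q m)"
  shows "pconv R (\<lambda>n. \<Sum>m\<in>M. b m * q m n)"
    and "\<bar>x\<bar> < R \<Longrightarrow> pser (\<lambda>n. \<Sum>m\<in>M. b m * q m n) x = (\<Sum>m\<in>M. b m * pser (q m) x)"
  using assms
proof (induction M rule: finite_induct)
  case empty
  { case 1 then show ?case by (simp add: pconv_0) }
  { case 2 then show ?case by (simp add: pser_def) }
next
  case (insert m M)
  have p: "pconv R (\<lambda>n. b m * q m n)" "pconv R (\<lambda>n. \<Sum>m\<in>M. b m * q m n)"
    if "\<And>k. k \<in> insert m M \<Longrightarrow> pconv R (q k)"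
    using that insert.IH(1) by (auto intro: pconv_cmult)
  { case 1 then show ?case using insert.hyps p by (simp add: pconv_add) }
  { case 2
    have "pser (\<lambda>n. b m * q m n) x = b m * pser (q m) x" using 2 by (intro pser_cmult[of R]) auto
    then show ?case
      using insert.hyps insert.IH(2) 2 pser_add[OF p(1) p(2) 2(1)] by simp }
qed

lemma pser_index_mult:
  assumes "pconv R c"
  shows "pconv R (\<lambda>n. real n * c n)"
    and "\<bar>x\<bar> < R \<Longrightarrow> pser (\<lambda>n. real n * c n) x = x * pser (diffs c) x"
proof -
  have *: "(\<lambda>n. real n * c n * x ^ n) sums (x * pser (diffs c) x)" if "\<bar>x\<bar> < R" for x
  proof -
    have "(\<lambda>n. x * (diffs c n * x ^ n)) sums (x * pser (diffs c) x)"
      by (intro sums_mult pser_sums[OF pconv_diffs[OF assms] that])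
    then have "(\<lambda>n. real (Suc n) * c (Suc n) * x ^ Suc n) sums (x * pser (diffs c) x)"
      by (simp add: diffs_def mult_ac)
    then show ?thesis by (subst (asm) sums_Suc_iff) simp
  qed
  show "pconv R (\<lambda>n. real n * c n)" unfolding pconv_def using * sums_summable by blast
  show "\<bar>x\<bar> < R \<Longrightarrow> pser (\<lambda>n. real n * c n) x = x * pser (diffs c) x"
    by (intro pser_eqI *)
qed

lemma pconv_poly:
  assumes "pconv R c"
  shows "pconv R (\<lambda>n. c n * poly p (real n))"
proof (induction p)
  case (pCons a p)
  have "pconv R (\<lambda>n. a * c n + real n * (c n * poly p (real n)))"
    by (intro pconv_add pconv_cmult assms pser_index_mult pCons)
  then show ?case by (simp add: algebra_simps)
qed (simp add: pconv_0)

lemma pser_Euler: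
  assumes "pconv R c" "\<bar>x\<bar> < R"
  shows "pser (\<lambda>n. c n * (real n - \<rho>)) x = x * deriv (pser c) x - \<rho> * pser c x"
proof -
  have "pser (\<lambda>n. real n * c n + (- \<rho>) * c n) x = x * pser (diffs c) x + (- \<rho>) * pser c x"
    using assms by (simp only: pser_add[OF pser_index_mult(1) pconv_cmult] pser_index_mult(2)
        pser_cmult)
  moreover have "deriv (pser c) x = pser (diffs c) x"
    using assms by (intro DERIV_imp_deriv pser_DERIV)
  ultimately show ?thesis by (simp add: algebra_simps)
qed

lemma pser_pos:
  assumes "pconv R c" "0 < x" "x < R" "\<And>n. c n \<ge> 0" "c m > 0"
  shows "pser c x > 0"
  unfolding pser_def
  by (rule suminf_pos2[where i = m]) (use assms in \<open>auto intro!: pconvD\<close>)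

text \<open>Descartes' rule of signs: a real root \<open>\<rho>\<close> of \<open>p\<close> is removed by the
  operator \<open>x * f' - \<rho> * f\<close>, which turns the factor \<open>n - \<rho>\<close> into a square.\<close>

lemma zeros_le_pser_poly:
  assumes "p \<noteq> 0" "\<And>n. w n \<ge> 0" "infinite {n. w n > 0}" "pconv R w"
  shows "zeros_le (pser (\<lambda>n. w n * poly p (real n))) {0<..<R} (degree p)"
  using assms
proof (induction "degree p" arbitrary: p w)
  case (0 p w)
  then obtain a where p: "p = [:a:]" "a \<noteq> 0" by (metis degree_eq_zeroE pCons_0_0)
  obtain m where m: "w m > 0" using 0(4) by (metis (mono_tags, lifting) Collect_empty_eq finite.emptyI)
  have "pser (\<lambda>n. w n * poly p (real n)) x = a * pser w x" if "\<bar>x\<bar> < R" for x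
    using pser_cmult[OF 0(5) that, of a] by (simp add: p mult.commute)
  then have "pser (\<lambda>n. w n * poly p (real n)) x \<noteq> 0" if "x \<in> {0<..<R}" for x
    using that pser_pos[OF 0(5), of x m] 0(3) m p by auto
  then have "zeros_le (pser (\<lambda>n. w n * poly p (real n))) {0<..<R} 0" by (rule zeros_le_0I)
  then show ?case using p by simp
next
  case (Suc d p w)
  show ?case
  proof (cases "\<exists>\<rho>. poly p \<rho> = 0")
    case True
    then obtain \<rho> p1 where p: "p = [:-\<rho>, 1:] * p1" by (metis dvdE poly_eq_0_iff_dvd)
    have p1: "p1 \<noteq> 0" using Suc.prems(1) p by auto
    then have "degree p = degree [:-\<rho>, 1:] + degree p1" unfolding p by (intro degree_mult_eq) auto
    then have dp1: "d = degree p1" using Suc.hyps(2) by simp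
    define w' where "w' = (\<lambda>n. w n * (real n - \<rho>)\<^sup>2)"
    have "zeros_le (pser (\<lambda>n. w' n * poly p1 (real n))) {0<..<R} (degree p1)"
    proof (rule Suc.hyps(1)[OF dp1 p1])
      show "w' n \<ge> 0" for n using Suc.prems by (simp add: w'_def)
      \<comment> \<open>Positivity of the weight is lost only at an index equal to
        \<open>\<rho>\<close>, so "infinitely many positive weights" is a condition that survives
        the removal of each root.\<close>
      have "{n. w n > 0} \<subseteq> {n. w' n > 0} \<union> {n. real n = \<rho>}"
        by (auto simp: w'_def)
      moreover have "finite {n. real n = \<rho>}"
        by (rule finite_subset[of _ "{nat \<lfloor>\<rho>\<rfloor>}"]) auto
      ultimately show "infinite {n. w' n > 0}"
        using Suc.prems(3) by (meson finite_Un finite_subset)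
      show "pconv R w'" using pconv_poly[OF Suc.prems(4), of "[:-\<rho>, 1:] ^ 2"]
        by (simp add: w'_def)
    qed
    moreover have c: "pconv R (\<lambda>n. w n * poly p (real n))" by (rule pconv_poly) fact
    moreover have "(\<lambda>n. w' n * poly p1 (real n)) = (\<lambda>n. w n * poly p (real n) * (real n - \<rho>))"
      by (simp add: w'_def p power2_eq_square fun_eq_iff algebra_simps)
    ultimately have z: "zeros_le (pser (\<lambda>n. w n * poly p (real n) * (real n - \<rho>))) {0<..<R} d"
      using dp1 by simp
    have "zeros_le (\<lambda>x. x * deriv (pser (\<lambda>n. w n * poly p (real n))) x -
        \<rho> * pser (\<lambda>n. w n * poly p (real n)) x) {0<..<R} d"
      by (rule zeros_le_cong[OF _ order_refl _ z]) (use pser_Euler[OF c] in auto)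
    then have "zeros_le (pser (\<lambda>n. w n * poly p (real n))) {0<..<R} (Suc d)"
      by (intro zeros_le_Euler smooth_on_subset[OF smooth_on_pser[OF c]]) auto
    then show ?thesis using Suc.hyps(2) by simp
  next
    case False
    \<comment> \<open>Without real roots \<open>p\<close> keeps the sign it has at \<open>0\<close>,
      so all nonzero terms of the series have the same sign and the sum has no zero at all.\<close>
    define s where "s = sgn (poly p 0)"
    have s: "s \<noteq> 0" using False by (simp add: s_def sgn_zero_iff)
    have pos: "s * poly p (real n) > 0" for n
    proof (rule ccontr)
      assume *: "\<not> s * poly p (real n) > 0"
      have 0: "poly p 0 \<noteq> 0" "poly p (real n) \<noteq> 0" using False by auto
      have "n \<noteq> 0"
      proof
        assume "n = 0"
        then show False using * 0 by (auto simp: s_def sgn_if split: if_splits)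
      qed
      have "poly p 0 * poly p (real n) < 0"
        using * 0 by (auto simp: s_def sgn_if mult_less_0_iff split: if_splits)
      then show False using poly_IVT[of 0 "real n" p] \<open>n \<noteq> 0\<close> False by auto
    qed
    have c: "pconv R (\<lambda>n. w n * poly p (real n))" by (rule pconv_poly) fact
    obtain m where m: "w m > 0"
      using Suc.prems(3) by (metis (mono_tags, lifting) Collect_empty_eq finite.emptyI)
    have "pser (\<lambda>n. w n * poly p (real n)) x \<noteq> 0" if "x \<in> {0<..<R}" for x
    proof -
      have "pser (\<lambda>n. s * (w n * poly p (real n))) x > 0"
        using that Suc.prems(2) m pos
        by (intro pser_pos[where R = R and m = m] pconv_cmult c)
           (auto simp: mult.left_commute[of s] less_imp_le intro!: mult_nonneg_nonneg mult_pos_pos)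
      then show ?thesis using pser_cmult[OF c, of x s] that by auto
    qed
    then have "zeros_le (pser (\<lambda>n. w n * poly p (real n))) {0<..<R} 0" by (rule zeros_le_0I)
    then show ?thesis by (rule zeros_le_mono) auto
  qed
qed

text \<open>The first \<open>card M\<close> coefficients determine the combination, so one of the first
  \<open>card M\<close> derivatives is bounded away from \<open>0\<close>, uniformly in the combination.\<close>

lemma zeros_le_near_0:
  fixes q :: "'a \<Rightarrow> nat \<Rightarrow> real"
  assumes fin: "finite M" and R: "R > 0" and q: "\<And>m. m \<in> M \<Longrightarrow> pconv R (q m)"
    and q0: "\<And>m. m \<in> M \<Longrightarrow> q m 0 = 0"
    and dual: "\<And>m. m \<in> M \<Longrightarrow>
      \<exists>w. \<forall>m'\<in>M. (\<Sum>l\<in>{1..card M}. w l * q m' l) = (if m' = m then 1 else 0)"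
  obtains \<delta> where "0 < \<delta>" "\<delta> \<le> R"
    "\<And>b. \<exists>m\<in>M. b m \<noteq> 0 \<Longrightarrow> zeros_le (\<lambda>x. \<Sum>m\<in>M. b m * pser (q m) x) {0<..<\<delta>} (card M - 1)"
proof -
  define K where "K = card M"
  obtain w where w: "\<And>m m'. m \<in> M \<Longrightarrow> m' \<in> M \<Longrightarrow>
      (\<Sum>l\<in>{1..K}. w m l * q m' l) = (if m' = m then 1 else 0)"
    using dual unfolding K_def by metis
  define C where "C = (\<Sum>m\<in>M. \<Sum>l\<in>{1..K}. \<bar>w m l\<bar>)"
  have C: "C \<ge> 0" by (auto simp: C_def intro!: sum_nonneg)
  \<comment> \<open>Chosen so that \<open>C * \<epsilon> < 1\<close>, which follows from
    \<open>C \<le> C * K\<close>; a nontrivial combination forces \<open>K \<ge> 1\<close>.\<close>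
  define \<epsilon> where "\<epsilon> = 1 / (C * K + 1)"
  have \<epsilon>: "\<epsilon> > 0" using C by (simp add: \<epsilon>_def add_nonneg_pos)
  have "\<forall>m\<in>M. \<forall>i\<in>{1..K}. \<forall>\<^sub>F x in nhds 0.
      \<bar>pser ((diffs ^^ i) (q m)) x - pser ((diffs ^^ i) (q m)) 0\<bar> < \<epsilon>"
  proof (intro ballI)
    fix m i assume "m \<in> M"
    then have "isCont (pser ((diffs ^^ i) (q m))) 0"
      using pser_DERIV[OF pconv_diffs_pow[OF q], of m 0 i] R DERIV_isCont by auto
    then have "(pser ((diffs ^^ i) (q m)) \<longlongrightarrow> pser ((diffs ^^ i) (q m)) 0) (nhds 0)"
      by (simp add: continuous_within tendsto_nhds_iff)
    then show "\<forall>\<^sub>F x in nhds 0. \<bar>pser ((diffs ^^ i) (q m)) x - pser ((diffs ^^ i) (q m)) 0\<bar> < \<epsilon>"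
      by (drule_tac tendstoD[OF _ \<epsilon>]) (simp add: dist_real_def)
  qed
  then have "\<forall>\<^sub>F x in nhds 0. \<forall>m\<in>M. \<forall>i\<in>{1..K}.
      \<bar>pser ((diffs ^^ i) (q m)) x - pser ((diffs ^^ i) (q m)) 0\<bar> < \<epsilon>"
    using fin by (simp add: eventually_ball_finite)
  then obtain d where d: "d > 0" "\<And>x m i. \<bar>x\<bar> < d \<Longrightarrow> m \<in> M \<Longrightarrow> i \<in> {1..K} \<Longrightarrow>
      \<bar>pser ((diffs ^^ i) (q m)) x - pser ((diffs ^^ i) (q m)) 0\<bar> < \<epsilon>"
    unfolding eventually_nhds_metric by (auto simp: dist_real_def)
  define \<delta> where "\<delta> = min d R"
  have "zeros_le (\<lambda>x. \<Sum>m\<in>M. b m * pser (q m) x) {0<..<\<delta>} (card M - 1)"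
    if b: "\<exists>m\<in>M. b m \<noteq> 0" for b
  proof -
    define c where "c = (\<lambda>n. \<Sum>m\<in>M. b m * q m n)"
    have cR: "pconv R c" unfolding c_def by (rule pser_sum(1)[OF fin q])
    have ce: "pser c x = (\<Sum>m\<in>M. b m * pser (q m) x)" if "\<bar>x\<bar> < R" for x
      unfolding c_def by (rule pser_sum(2)[OF fin q that])
    have bw: "b m = (\<Sum>l\<in>{1..K}. w m l * c l)" if "m \<in> M" for m
    proof -
      have "(\<Sum>l\<in>{1..K}. w m l * c l) = (\<Sum>m'\<in>M. \<Sum>l\<in>{1..K}. b m' * (w m l * q m' l))"
        unfolding c_def sum_distrib_left by (subst sum.swap) (simp add: mult_ac)
      also have "\<dots> = (\<Sum>m'\<in>M. b m' * (if m' = m then 1 else 0))"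
        by (intro sum.cong refl) (simp only: sum_distrib_left[symmetric] w[OF that])
      also have "\<dots> = (\<Sum>m'\<in>M. if m' = m then b m' else 0)" by (intro sum.cong) auto
      also have "\<dots> = b m" using fin that by (simp add: sum.delta)
      finally show ?thesis by simp
    qed
    have K: "K > 0" using b fin by (auto simp: K_def card_gt_0_iff)
    \<comment> \<open>\<open>D\<close> is attained at some \<open>i\<close>. The derivative of order
      \<open>i\<close> at \<open>0\<close> is \<open>fact i * c i\<close>, of absolute value at
      least \<open>D\<close>, and moving to \<open>x\<close> changes it by at most
      \<open>C * D * \<epsilon> < D\<close>. The order \<open>i\<close> depends on the combination,
      the radius \<open>\<delta>\<close> does not.\<close>
    define D where "D = Max ((\<lambda>l. \<bar>c l\<bar>) ` {1..K})"
    have "D \<in> (\<lambda>l. \<bar>c l\<bar>) ` {1..K}" unfolding D_def using K by (intro Max_in) auto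
    then obtain i where i: "i \<in> {1..K}" "D = \<bar>c i\<bar>" by auto
    have cD: "\<bar>c l\<bar> \<le> D" if "l \<in> {1..K}" for l unfolding D_def using that by (intro Max_ge) auto
    have bD: "(\<Sum>m\<in>M. \<bar>b m\<bar>) \<le> C * D"
    proof -
      have "(\<Sum>m\<in>M. \<bar>b m\<bar>) \<le> (\<Sum>m\<in>M. \<Sum>l\<in>{1..K}. \<bar>w m l\<bar> * D)"
      proof (rule sum_mono)
        fix m assume m: "m \<in> M"
        have "\<bar>b m\<bar> \<le> (\<Sum>l\<in>{1..K}. \<bar>w m l * c l\<bar>)" unfolding bw[OF m] by (rule sum_abs)
        also have "\<dots> \<le> (\<Sum>l\<in>{1..K}. \<bar>w m l\<bar> * D)"
          unfolding abs_mult by (intro sum_mono mult_left_mono cD) auto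
        finally show "\<bar>b m\<bar> \<le> (\<Sum>l\<in>{1..K}. \<bar>w m l\<bar> * D)" .
      qed
      then show ?thesis by (simp add: C_def sum_distrib_right)
    qed
    \<comment> \<open>By \<open>bw\<close> the coefficients \<open>b\<close> are recovered from
      \<open>c 1\<close>, ..., \<open>c K\<close>; if these all vanished, so would
      \<open>b\<close>.\<close>
    have Dpos: "D > 0"
    proof (rule ccontr)
      assume "\<not> D > 0"
      then have "C * D \<le> 0" using C by (simp add: mult_nonneg_nonpos)
      then have "(\<Sum>m\<in>M. \<bar>b m\<bar>) = 0" using bD by (intro antisym) (auto intro!: sum_nonneg)
      then show False using b fin by (auto simp: sum_nonneg_eq_0_iff)
    qed
    have nz: "(deriv ^^ i) (pser c) x \<noteq> 0" if "x \<in> {-\<delta><..<\<delta>}" for x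
    proof -
      have x: "\<bar>x\<bar> < d" "\<bar>x\<bar> < R" using that by (auto simp: \<delta>_def)
      have dc: "(diffs ^^ i) c = (\<lambda>n. \<Sum>m\<in>M. b m * (diffs ^^ i) (q m) n)"
      proof (induction i)
        case (Suc i)
        then show ?case by (simp add: diffs_def sum_distrib_left mult_ac)
      qed (simp add: c_def)
      have e: "pser ((diffs ^^ i) c) y = (\<Sum>m\<in>M. b m * pser ((diffs ^^ i) (q m)) y)" if "\<bar>y\<bar> < R" for y
        unfolding dc by (rule pser_sum(2)[OF fin pconv_diffs_pow[OF q] that])
      have "\<bar>pser ((diffs ^^ i) c) x - pser ((diffs ^^ i) c) 0\<bar>
          = \<bar>\<Sum>m\<in>M. b m * (pser ((diffs ^^ i) (q m)) x - pser ((diffs ^^ i) (q m)) 0)\<bar>"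
        using x R by (simp add: e sum_subtractf right_diff_distrib)
      also have "\<dots> \<le> (\<Sum>m\<in>M. \<bar>b m\<bar> * \<epsilon>)"
        unfolding abs_mult[symmetric]
        by (rule order.trans[OF sum_abs], unfold abs_mult, intro sum_mono mult_left_mono)
           (use d(2)[OF x(1) _ i(1)] in \<open>auto intro: less_imp_le\<close>)
      also have "\<dots> \<le> (C * D) * \<epsilon>"
        unfolding sum_distrib_right[symmetric] using bD \<epsilon> by (intro mult_right_mono) auto
      also have "\<dots> < D"
      proof -
        have "C * \<epsilon> < 1"
        proof -
          have "C * 1 \<le> C * real K" using C K by (intro mult_left_mono) auto
          then show ?thesis using C by (simp add: \<epsilon>_def divide_simps)
        qed
        then show ?thesis using Dpos by (simp add: mult.commute mult.left_commute)
      qed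
      also have "D \<le> \<bar>pser ((diffs ^^ i) c) 0\<bar>"
      proof -
        have "1 * \<bar>c i\<bar> \<le> fact i * \<bar>c i\<bar>" by (intro mult_right_mono fact_ge_1) auto
        then show ?thesis by (simp add: pser_0 diffs_pow_0 abs_mult i(2))
      qed
      finally show ?thesis by (auto simp: pser_higher_deriv[OF cR x(2)])
    qed
    have sm: "smooth_on {-\<delta><..<\<delta>} (pser c)"
      by (rule smooth_on_subset[OF smooth_on_pser[OF cR]]) (auto simp: \<delta>_def)
    have zl: "zeros_le (pser c) {-\<delta><..<\<delta>} i"
      by (rule zeros_le_higher_deriv[OF sm nz]) auto
    \<comment> \<open>The point \<open>0\<close> is itself one of the at most
      \<open>i \<le> card M\<close> zeros in the symmetric interval, which leaves at most
      \<open>card M - 1\<close> of them on the positive side.\<close>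
    have z: "zeros_le (pser c) {0<..<\<delta>} (card M - 1)"
      unfolding zeros_le_def
    proof (intro allI impI)
      fix F \<mu> assume F: "finite F \<and> F \<subseteq> {0<..<\<delta>} \<and> (\<forall>t\<in>F. \<mu> t > 0 \<and> vanishes (\<mu> t) (pser c) t)"
      have 0: "0 \<notin> F" using F by auto
      define \<nu> where "\<nu> = (\<lambda>t. if t = 0 then 1 else \<mu> t)"
      have c0: "pser c 0 = 0" using q0 by (simp add: pser_0 c_def)
      have "sum \<nu> (insert 0 F) \<le> i"
      proof (rule zeros_leD[OF zl])
        have "0 < \<delta>" using d(1) R by (simp add: \<delta>_def)
        then have "0 \<in> {-\<delta><..<\<delta>}" "{0<..<\<delta>} \<subseteq> {-\<delta><..<\<delta>}" by auto
        then show "insert 0 F \<subseteq> {-\<delta><..<\<delta>}" using F by blast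
        fix t assume t: "t \<in> insert 0 F"
        show "vanishes (\<nu> t) (pser c) t"
        proof (cases "t = 0")
          case True then show ?thesis using c0 by (simp add: \<nu>_def vanishes_def)
        next
          case False then show ?thesis using F t by (simp add: \<nu>_def)
        qed
      qed (use F in auto)
      moreover have "sum \<nu> (insert 0 F) = 1 + sum \<mu> F"
        using F 0 by (subst sum.insert) (auto simp: \<nu>_def intro!: sum.cong)
      ultimately show "sum \<mu> F \<le> card M - 1" using i(1) by (simp add: K_def)
    qed
    show ?thesis
      by (rule zeros_le_cong[OF _ order_refl _ z]) (use ce in \<open>auto simp: \<delta>_def\<close>)
  qed
  then show thesis using that[of \<delta>] d(1) R by (auto simp: \<delta>_def)
qed

subsection \<open>Counting zeros, Newton interpolation and the series of sin (a arcsin z)\<close>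


lemma count_mult_le:
  assumes "zeros_le f J k" "Z \<subseteq> J"
  shows "count_mult f Z \<le> enat k"
  unfolding count_mult_def
proof (rule SUP_least)
  fix F assume "F \<in> {F. finite F \<and> F \<subseteq> Z}"
  then have F: "finite F" "F \<subseteq> J" using assms(2) by auto
  define \<mu> where "\<mu> = (\<lambda>t. Max {m. vanishes m f t})"
  have b: "m \<le> k" if "t \<in> F" "vanishes m f t" for t m
    using zeros_leD[OF assms(1), of "{t}" "\<lambda>_. m"] that F by auto
  have fin: "finite {m. vanishes m f t}" if "t \<in> F" for t
    by (rule finite_subset[of _ "{..k}"]) (use b that in auto)
  have v: "vanishes (\<mu> t) f t" if "t \<in> F" for t
    using Max_in[OF fin[OF that]] vanishes_0 unfolding \<mu>_def by blast
  have "(\<Sum>t\<in>F. zero_mult f t) \<le> (\<Sum>t\<in>F. enat (\<mu> t))"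
  proof (rule sum_mono)
    fix t assume t: "t \<in> F"
    show "zero_mult f t \<le> enat (\<mu> t)"
      unfolding zero_mult_def
    proof (rule SUP_least)
      fix m assume "m \<in> {m. \<forall>i<m. (deriv ^^ i) f t = 0}"
      then have "m \<le> \<mu> t" unfolding \<mu>_def by (intro Max_ge fin t) (simp add: vanishes_def)
      then show "enat m \<le> enat (\<mu> t)" by simp
    qed
  qed
  also have "\<dots> = enat (sum \<mu> F)"
    unfolding of_nat_eq_enat[symmetric] by simp
  also have "\<dots> \<le> enat k" using zeros_leD[OF assms(1) F v] by simp
  finally show "(\<Sum>t\<in>F. zero_mult f t) \<le> enat k" .
qed

lemma count_mult_ge:
  assumes "finite F" "F \<subseteq> Z" "\<And>t. t \<in> F \<Longrightarrow> f t = 0"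
  shows "enat (card F) \<le> count_mult f Z"
proof -
  have "(\<Sum>t\<in>F. enat 1) \<le> (\<Sum>t\<in>F. zero_mult f t)"
  proof (rule sum_mono)
    fix t assume t: "t \<in> F"
    show "enat 1 \<le> zero_mult f t"
      unfolding zero_mult_def by (rule SUP_upper) (use assms(3)[OF t] in auto)
  qed
  moreover have "(\<Sum>t\<in>F. enat 1) = enat (card F)"
    unfolding of_nat_eq_enat[symmetric] by simp
  ultimately show ?thesis
    unfolding count_mult_def using assms(1,2) by (intro SUP_upper2[of F]) auto
qed

text \<open>Gaussian elimination, one equation per point \<open>t\<close>: an unknown
  \<open>k\<close> with \<open>u k t \<noteq> 0\<close> is solved for, and subtracting multiples of
  \<open>u k\<close> turns the others into functions \<open>v\<close> that vanish at
  \<open>t\<close>.\<close>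

lemma exists_vanishing_combination:
  fixes u :: "'a \<Rightarrow> 'b \<Rightarrow> real"
  assumes "finite T" "finite M" "card T < card M"
  shows "\<exists>a. (\<exists>j\<in>M. a j \<noteq> 0) \<and> (\<forall>t\<in>T. (\<Sum>j\<in>M. a j * u j t) = 0)"
  using assms
proof (induction T arbitrary: M u rule: finite_induct)
  case empty
  then have "M \<noteq> {}" by auto
  then show ?case by (intro exI[of _ "\<lambda>_. 1"]) auto
next
  case (insert t T)
  show ?case
  proof (cases "\<forall>j\<in>M. u j t = 0")
    case True
    have "card T < card M" using insert by simp
    from insert.IH[OF insert.prems(1) this, of u] show ?thesis using True by auto
  next
    case False
    then obtain k where k: "k \<in> M" "u k t \<noteq> 0" by auto
    define v where "v = (\<lambda>j s. u j s - u j t / u k t * u k s)"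
    have "card T < card (M - {k})" using insert k by simp
    from insert.IH[OF _ this, of v] insert.prems(1)
    obtain a where a: "\<exists>j\<in>M - {k}. a j \<noteq> 0" "\<forall>s\<in>T. (\<Sum>j\<in>M - {k}. a j * v j s) = 0" by auto
    define b where "b = (\<lambda>j. if j = k then - (\<Sum>j\<in>M - {k}. a j * u j t) / u k t else a j)"
    have b: "(\<Sum>j\<in>M. b j * u j s) = (\<Sum>j\<in>M - {k}. a j * v j s)" for s
    proof -
      have "(\<Sum>j\<in>M. b j * u j s) = b k * u k s + (\<Sum>j\<in>M - {k}. b j * u j s)"
        by (rule sum.remove) (use insert.prems k in auto)
      also have "(\<Sum>j\<in>M - {k}. b j * u j s) = (\<Sum>j\<in>M - {k}. a j * u j s)"
        by (intro sum.cong) (auto simp: b_def)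
      also have "b k * u k s = - (\<Sum>j\<in>M - {k}. a j * (u j t / u k t * u k s))"
        by (simp add: b_def sum_divide_distrib sum_distrib_right mult.assoc)
      finally show ?thesis by (simp add: v_def right_diff_distrib sum_subtractf)
    qed
    have "v j t = 0" for j using k by (simp add: v_def)
    then have "\<forall>s\<in>insert t T. (\<Sum>j\<in>M. b j * u j s) = 0" using a(2) b by auto
    moreover have "\<exists>j\<in>M. b j \<noteq> 0" using a(1) by (auto simp: b_def)
    ultimately show ?thesis by blast
  qed
qed

text \<open>Up to sign, the Newton basis polynomials with nodes at the squares of the odd numbers.
  These nodes are forced: the recurrence for the odd Taylor coefficients of
  \<open>sin (a * arcsin z)\<close> contributes one factor \<open>(2 * i + 1)^2 - a^2\<close> per
  step, so \<open>t\<close> stands for \<open>a^2\<close>.\<close>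

definition newton :: "nat \<Rightarrow> real \<Rightarrow> real" where
  "newton l t = (\<Prod>i<l. (2 * real i + 1)\<^sup>2 - t)"

text \<open>Multiplication by one more linear factor stays in the span because \<open>(t - c) *
  newton l t = ((2 * l + 1)^2 - c) * newton l t - newton (Suc l) t\<close>; the weights
  \<open>w'\<close> collect these two contributions.\<close>

lemma newton_span_prod:
  assumes "finite A"
  shows "\<exists>w. \<forall>t. (\<Prod>c\<in>A. t - c) = (\<Sum>l<Suc (card A). w l * newton l t)"
  using assms
proof (induction A rule: finite_induct)
  case empty
  show ?case by (intro exI[of _ "\<lambda>_. 1"]) (simp add: newton_def)
next
  case (insert c A)
  then obtain w where w: "\<And>t. (\<Prod>c\<in>A. t - c) = (\<Sum>l<Suc (card A). w l * newton l t)" by auto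
  define K where "K = Suc (card A)"
  define w' where "w' = (\<lambda>l. (if l < K then w l * ((2 * real l + 1)\<^sup>2 - c) else 0) -
      (if l = 0 then 0 else w (l - 1)))"
  have "(t - c) * (\<Sum>l<K. w l * newton l t) = (\<Sum>l<Suc K. w' l * newton l t)" for t
  proof -
    have "(\<Sum>l<Suc K. w' l * newton l t)
        = (\<Sum>l<Suc K. (if l < K then w l * ((2 * real l + 1)\<^sup>2 - c) else 0) * newton l t)
        - (\<Sum>l<Suc K. (if l = 0 then 0 else w (l - 1)) * newton l t)"
      unfolding w'_def left_diff_distrib by (rule sum_subtractf)
    also have "(\<Sum>l<Suc K. (if l < K then w l * ((2 * real l + 1)\<^sup>2 - c) else 0) * newton l t)
        = (\<Sum>l<K. w l * ((2 * real l + 1)\<^sup>2 - c) * newton l t)"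
      by (simp add: sum.lessThan_Suc)
    also have "(\<Sum>l<Suc K. (if l = 0 then 0 else w (l - 1)) * newton l t)
        = (\<Sum>l<K. w l * newton (Suc l) t)"
      by (simp only: sum.lessThan_Suc_shift) simp
    finally show ?thesis
      by (simp add: sum_distrib_left sum_subtractf[symmetric] newton_def algebra_simps)
  qed
  then show ?case using insert by (auto simp: w K_def intro!: exI[of _ w'])
qed

text \<open>The Lagrange polynomial that is \<open>1\<close> at \<open>\<tau> m\<close> and
  \<open>0\<close> at the other nodes has degree \<open>card M - 1\<close>; its coordinates in the
  Newton basis are the weights.\<close>

lemma newton_dual:
  assumes "finite M" "inj_on \<tau> M" "m \<in> M"
  shows "\<exists>w. \<forall>m'\<in>M. (\<Sum>l<card M. w l * newton l (\<tau> m')) = (if m' = m then 1 else 0)"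
proof -
  define A where "A = \<tau> ` (M - {m})"
  have A: "finite A" "Suc (card A) = card M"
  proof -
    have "card A = card (M - {m})"
      unfolding A_def by (rule card_image) (use assms in \<open>auto intro: inj_on_subset\<close>)
    then show "Suc (card A) = card M" using assms by (metis card_Suc_Diff1)
  qed (use assms in \<open>auto simp: A_def\<close>)
  obtain w where w: "\<And>t. (\<Prod>c\<in>A. t - c) = (\<Sum>l<card M. w l * newton l t)"
    using newton_span_prod[OF A(1)] A(2) by auto
  define p where "p = (\<Prod>c\<in>A. \<tau> m - c)"
  have p: "p \<noteq> 0" unfolding p_def A_def using assms by (auto simp: inj_on_def)
  have "(\<Sum>l<card M. w l / p * newton l (\<tau> m')) = (if m' = m then 1 else 0)" if "m' \<in> M" for m'
  proof -
    have "(\<Sum>l<card M. w l / p * newton l (\<tau> m')) = (\<Prod>c\<in>A. \<tau> m' - c) / p"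
      by (simp add: w sum_divide_distrib)
    also have "\<dots> = (if m' = m then 1 else 0)"
    proof (cases "m' = m")
      case False
      then have "\<tau> m' \<in> A" using that by (auto simp: A_def)
      then have "(\<Prod>c\<in>A. \<tau> m' - c) = 0" using A(1) by (intro prod_zero) auto
      then show ?thesis using False by simp
    qed (use p in \<open>simp add: p_def\<close>)
    finally show ?thesis .
  qed
  then show ?thesis by (intro exI[of _ "\<lambda>l. w l / p"]) auto
qed

text \<open>Taylor coefficients at \<open>0\<close> of \<open>f z = sin (a * arcsin z)\<close>, read
  off from \<open>(1 - z^2) f'' = z f' - a^2 f\<close> with \<open>f 0 = 0\<close> and
  \<open>f' 0 = a\<close>.\<close>

fun sin_asin_coeff :: "real \<Rightarrow> nat \<Rightarrow> real" where
  "sin_asin_coeff a 0 = 0"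
| "sin_asin_coeff a (Suc 0) = a"
| "sin_asin_coeff a (Suc (Suc n)) = ((real n)\<^sup>2 - a\<^sup>2) / ((real n + 1) * (real n + 2)) * sin_asin_coeff a n"

lemma sin_asin_coeff_odd: "sin_asin_coeff a (2 * l + 1) = a * newton l (a\<^sup>2) / fact (2 * l + 1)"
proof (induction l)
  case 0 then show ?case by (simp add: newton_def)
next
  case (Suc l)
  have e: "2 * Suc l + 1 = Suc (Suc (2 * l + 1))" by simp
  have "(fact (2 * Suc l + 1) :: real) = (real (2*l+1) + 1) * (real (2*l+1) + 2) * fact (2 * l + 1)"
    unfolding e fact_Suc of_nat_mult by (simp add: mult_ac)
  then show ?case unfolding e sin_asin_coeff.simps Suc.IH[unfolded e] newton_def
    by (simp add: mult_ac add_ac)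
qed

text \<open>Once the index reaches \<open>\<bar>a\<bar>\<close>, the factor in the recurrence has
  absolute value at most \<open>1\<close>; only the finitely many earlier coefficients enter the
  bound.\<close>

lemma sin_asin_coeff_bounded: "\<exists>B. \<forall>n. \<bar>sin_asin_coeff a n\<bar> \<le> B"
proof -
  define n0 where "n0 = nat \<lceil>\<bar>a\<bar>\<rceil>"
  define B where "B = (\<Sum>k<n0+2. \<bar>sin_asin_coeff a k\<bar>)"
  have "\<bar>sin_asin_coeff a n\<bar> \<le> B" for n
  proof (induction n rule: less_induct)
    case (less n)
    show ?case
    proof (cases "n < n0 + 2")
      case True
      then show ?thesis unfolding B_def by (intro member_le_sum[of n "{..<n0+2}" "\<lambda>k. \<bar>sin_asin_coeff a k\<bar>"]) auto
    next
      case False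
      then obtain m where m: "n = Suc (Suc m)" "m \<ge> n0"
        by (metis add_2_eq_Suc' le_Suc_ex add_Suc_right not_less add.commute le_add1)
      have am: "\<bar>a\<bar> \<le> real m" using m(2) by (simp add: n0_def)
      then have "a\<^sup>2 \<le> (real m)\<^sup>2" by (metis abs_ge_zero power2_abs power_mono)
      then have "\<bar>((real m)\<^sup>2 - a\<^sup>2) / ((real m + 1) * (real m + 2))\<bar> \<le> 1"
        by (simp add: divide_simps power2_eq_square) (simp add: algebra_simps add_nonneg_nonneg)
      then have "\<bar>((real m)\<^sup>2 - a\<^sup>2) / ((real m + 1) * (real m + 2))\<bar> * \<bar>sin_asin_coeff a m\<bar> \<le> 1 * B"
        by (rule mult_mono) (use less.IH[of m] m in auto)
      then show ?thesis unfolding m(1) sin_asin_coeff.simps abs_mult by simp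
    qed
  qed
  then show ?thesis by blast
qed

lemma pconv_bounded:
  assumes "\<And>n. \<bar>c n\<bar> \<le> B * r ^ n" "r > 0"
  shows "pconv (1 / r) c"
  unfolding pconv_def
proof (intro allI impI)
  fix x assume x: "\<bar>x\<bar> < 1 / r"
  have "summable (\<lambda>n. B * (r * \<bar>x\<bar>) ^ n)"
    using x assms(2) by (intro summable_mult summable_geometric) (simp add: abs_mult field_simps)
  then show "summable (\<lambda>n. c n * x ^ n)"
  proof (rule summable_comparison_test'[where N = 0])
    fix n
    have "\<bar>c n\<bar> * \<bar>x\<bar> ^ n \<le> (B * r ^ n) * \<bar>x\<bar> ^ n" by (intro mult_right_mono assms) auto
    then show "norm (c n * x ^ n) \<le> B * (r * \<bar>x\<bar>) ^ n"
      by (simp add: abs_mult power_abs power_mult_distrib mult_ac)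
  qed
qed

lemma pconv_sin_asin_coeff: "pconv 1 (sin_asin_coeff a)"
proof -
  obtain B where "\<forall>n. \<bar>sin_asin_coeff a n\<bar> \<le> B" using sin_asin_coeff_bounded by blast
  then show ?thesis using pconv_bounded[of "sin_asin_coeff a" B 1] by simp
qed

lemma sin_asin_coeff_ode:
  assumes z: "\<bar>z\<bar> < 1"
  shows "(1 - z\<^sup>2) * pser (diffs (diffs (sin_asin_coeff a))) z = z * pser (diffs (sin_asin_coeff a)) z - a\<^sup>2 * pser (sin_asin_coeff a) z"
proof -
  define f f1 f2 where "f = pser (sin_asin_coeff a) z" and "f1 = pser (diffs (sin_asin_coeff a)) z"
    and "f2 = pser (diffs (diffs (sin_asin_coeff a))) z"
  note c = pconv_sin_asin_coeff[of a] pconv_diffs[OF pconv_sin_asin_coeff[of a]] pconv_diffs[OF pconv_diffs[OF pconv_sin_asin_coeff[of a]]]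
  have s0: "(\<lambda>n. sin_asin_coeff a n * z ^ n) sums f" unfolding f_def by (rule pser_sums[OF c(1) z])
  have s1: "(\<lambda>n. real n * sin_asin_coeff a n * z ^ n) sums (z * f1)"
    using pser_sums[OF pser_index_mult(1)[OF c(1)] z] pser_index_mult(2)[OF c(1) z]
    by (simp add: f1_def)
  have s2: "(\<lambda>n. diffs (diffs (sin_asin_coeff a)) n * z ^ n) sums f2" unfolding f2_def by (rule pser_sums[OF c(3) z])
  have "(\<lambda>n. real n * diffs (sin_asin_coeff a) n * z ^ n) sums (z * f2)"
    using pser_sums[OF pser_index_mult(1)[OF c(2)] z] pser_index_mult(2)[OF c(2) z]
    by (simp add: f2_def)
  from sums_mult[OF this, of z]
  have "(\<lambda>n. real (Suc n) * real (Suc n - 1) * sin_asin_coeff a (Suc n) * z ^ Suc n) sums (z\<^sup>2 * f2)"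
    by (simp add: diffs_def mult_ac power2_eq_square)
  then have s3: "(\<lambda>n. real n * real (n - 1) * sin_asin_coeff a n * z ^ n) sums (z\<^sup>2 * f2)"
    by (subst (asm) sums_Suc_iff) simp
  have "diffs (diffs (sin_asin_coeff a)) n =
      real n * real (n - 1) * sin_asin_coeff a n + real n * sin_asin_coeff a n - a\<^sup>2 * sin_asin_coeff a n" for n
  proof -
    have "diffs (diffs (sin_asin_coeff a)) n = (real n + 1) * (real n + 2) * sin_asin_coeff a (Suc (Suc n))"
      by (simp add: diffs_def mult_ac add_ac)
    also have "\<dots> = ((real n)\<^sup>2 - a\<^sup>2) * sin_asin_coeff a n" by (simp add: divide_simps) 
    also have "(real n)\<^sup>2 = real n * real (n - 1) + real n"
      by (cases n) (auto simp: power2_eq_square algebra_simps)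
    finally show ?thesis by (simp add: algebra_simps)
  qed
  then have "(\<lambda>n. diffs (diffs (sin_asin_coeff a)) n * z ^ n)
      = (\<lambda>n. real n * real (n - 1) * sin_asin_coeff a n * z ^ n + real n * sin_asin_coeff a n * z ^ n
          - a\<^sup>2 * (sin_asin_coeff a n * z ^ n))"
    by (simp add: distrib_right left_diff_distrib mult.assoc)
  then have "(\<lambda>n. diffs (diffs (sin_asin_coeff a)) n * z ^ n) sums (z\<^sup>2 * f2 + z * f1 - a\<^sup>2 * f)"
    using sums_diff[OF sums_add[OF s3 s1] sums_mult[OF s0, of "a\<^sup>2"]] by simp
  then have "f2 = z\<^sup>2 * f2 + z * f1 - a\<^sup>2 * f" by (rule sums_unique2[OF s2])
  then show ?thesis unfolding f_def[symmetric] f1_def[symmetric] f2_def[symmetric]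
    by (simp add: algebra_simps)
qed

text \<open>Both sides solve \<open>Y'' = - a\<^sup>2 Y\<close> in the variable \<open>arcsin z\<close> with the same initial values;
  \<open>E\<close> is the energy of the difference.\<close>

lemma pser_sin_asin_coeff:
  assumes a: "a \<noteq> 0" and z: "\<bar>z\<bar> < 1"
  shows "pser (sin_asin_coeff a) z = sin (a * arcsin z)"
proof -
  define f f1 f2 where "f = pser (sin_asin_coeff a)" and "f1 = pser (diffs (sin_asin_coeff a))"
    and "f2 = pser (diffs (diffs (sin_asin_coeff a)))"
  have d: "(f has_real_derivative f1 x) (at x)" "(f1 has_real_derivative f2 x) (at x)" if "\<bar>x\<bar> < 1" for x
    unfolding f_def f1_def f2_def
    by (rule pser_DERIV[OF pconv_sin_asin_coeff that], rule pser_DERIV[OF pconv_diffs[OF pconv_sin_asin_coeff] that])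
  define E where "E = (\<lambda>v. (f1 (sin v) * cos v - a * cos (a * v))\<^sup>2 + a\<^sup>2 * (f (sin v) - sin (a * v))\<^sup>2)"
  have sb: "\<bar>sin v\<bar> < 1" if "v \<in> {-(pi/2)<..<pi/2}" for v :: real
  proof -
    have "cos v > 0" using that by (intro cos_gt_zero_pi) auto
    then have "(sin v)\<^sup>2 < 1" using sin_cos_squared_add[of v] zero_less_power[of "cos v" 2] by linarith
    then show ?thesis by (simp add: abs_square_less_1)
  qed
  have E': "(E has_real_derivative 0) (at v)" if v: "v \<in> {-(pi/2)<..<pi/2}" for v
  proof -
    note D1 = DERIV_chain2[OF d(1)[OF sb[OF v]] DERIV_sin]
    note D2 = DERIV_chain2[OF d(2)[OF sb[OF v]] DERIV_sin]
    have ode: "f2 (sin v) * (cos v)\<^sup>2 = sin v * f1 (sin v) - a\<^sup>2 * f (sin v)"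
      using sin_asin_coeff_ode[OF sb[OF v], of a] unfolding f_def f1_def f2_def
      by (simp add: cos_squared_eq mult.commute)
    define X Y where "X = f1 (sin v) * cos v - a * cos (a * v)" and "Y = f (sin v) - sin (a * v)"
    have 1: "((\<lambda>v. f1 (sin v) * cos v - a * cos (a * v)) has_real_derivative - a\<^sup>2 * Y) (at v)"
    proof -
      have "((\<lambda>v. f1 (sin v) * cos v - a * cos (a * v)) has_real_derivative
          (f2 (sin v) * cos v) * cos v + (- sin v) * f1 (sin v) - a * (- sin (a * v) * a)) (at v)"
        by (intro DERIV_diff DERIV_mult D2 DERIV_cos DERIV_cmult DERIV_chain2[OF DERIV_cos] DERIV_cmult_Id)
      moreover have "(f2 (sin v) * cos v) * cos v + (- sin v) * f1 (sin v) - a * (- sin (a * v) * a)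
          = - a\<^sup>2 * Y"
        using ode by (simp add: Y_def power2_eq_square algebra_simps)
      ultimately show ?thesis by simp
    qed
    have 2: "((\<lambda>v. f (sin v) - sin (a * v)) has_real_derivative X) (at v)"
    proof -
      have "((\<lambda>v. f (sin v) - sin (a * v)) has_real_derivative f1 (sin v) * cos v - cos (a * v) * a) (at v)"
        by (intro DERIV_diff D1 DERIV_chain2[OF DERIV_sin] DERIV_cmult_Id)
      then show ?thesis by (simp add: X_def mult.commute)
    qed
    \<comment> \<open>\<open>X' = - a^2 * Y\<close> and \<open>Y' = X\<close>, so the two terms
      cancel and the energy \<open>X^2 + a^2 * Y^2\<close> is constant.\<close>
    have "(E has_real_derivative
        of_nat 2 * (- a\<^sup>2 * Y * X ^ (2 - Suc 0)) + a\<^sup>2 * (of_nat 2 * (X * Y ^ (2 - Suc 0)))) (at v)"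
      unfolding E_def using DERIV_power[OF 1, of 2] DERIV_power[OF 2, of 2]
      by (intro DERIV_add DERIV_cmult) (simp_all add: X_def Y_def)
    then show ?thesis by (simp add: algebra_simps)
  qed
  define v where "v = arcsin z"
  have v: "v \<in> {-(pi/2)<..<pi/2}" "sin v = z"
    using arcsin_lt_bounded[of z] z by (auto simp: v_def)
  have "E v = E 0"
    by (rule DERIV_isconst3[of "-(pi/2)" "pi/2"]) (use v E' in auto)
  also have "E 0 = 0" by (simp add: E_def f_def f1_def pser_0 diffs_def)
  finally have "(f1 (sin v) * cos v - a * cos (a * v))\<^sup>2 + a\<^sup>2 * (f (sin v) - sin (a * v))\<^sup>2 = 0"
    by (simp add: E_def)
  then have "a\<^sup>2 * (f (sin v) - sin (a * v))\<^sup>2 = 0"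
    by (smt (verit) zero_le_power2 mult_nonneg_nonneg)
  then show ?thesis using a v by (simp add: f_def v_def)
qed

subsection \<open>Line integrals over the oval as trigonometric integrals\<close>


text \<open>Closed form of the inverse of \<open>scoord\<close> on the range swept out by the
  ovals.\<close>

definition x_trig :: "real \<Rightarrow> real" where
  "x_trig s = cos (pi / 3 - 2 / 3 * arcsin (sqrt 3 * s)) - 1 / 2"

text \<open>The integral of \<open>P dy\<close> over the circle, without reference to a path:
  \<open>y = r * sin \<theta>\<close> with \<open>r = sqrt (2 * h)\<close> gives the factor
  \<open>r * cos \<theta>\<close>.\<close>

definition oval_int :: "real \<Rightarrow> real poly \<Rightarrow> real" where
  "oval_int h P = integral {0..2 * pi}
     (\<lambda>\<theta>. poly P (x_trig (sqrt (2 * h) * cos \<theta>)) * (sqrt (2 * h) * cos \<theta>))"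

lemma sqrt3_bound:
  assumes "\<bar>s\<bar> < sqrt (1/3)"
  shows "\<bar>sqrt 3 * s\<bar> < 1"
proof -
  have "sqrt 3 * \<bar>s\<bar> < sqrt 3 * sqrt (1/3)" using assms by (intro mult_strict_left_mono) auto
  then show ?thesis by (simp add: abs_mult real_sqrt_mult[symmetric])
qed

text \<open>With \<open>x = cos \<phi> - 1/2\<close> one has \<open>scoord x = cos (3\<phi>/2) / sqrt 3\<close>.\<close>

lemma scoord_x_trig:
  assumes "\<bar>s\<bar> < sqrt (1/3)"
  shows "x_trig s > -1" "scoord (x_trig s) = s"
proof -
  define v where "v = arcsin (sqrt 3 * s)"
  have v: "-(pi/2) < v" "v < pi/2" "sin v = sqrt 3 * s"
    using arcsin_lt_bounded[of "sqrt 3 * s"] sqrt3_bound[OF assms] by (auto simp: v_def)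
  define \<phi> where "\<phi> = pi / 3 - 2 / 3 * v"
  have \<phi>: "0 < \<phi>" "\<phi> < 2 * pi / 3" using v by (auto simp: \<phi>_def field_simps)
  have X: "x_trig s = cos \<phi> - 1 / 2" by (simp add: x_trig_def \<phi>_def v_def)
  have "cos \<phi> > cos (2 * pi / 3)" using \<phi> by (intro cos_monotone_0_pi) auto
  then have c: "cos \<phi> > - (1 / 2)" by (simp add: cos_120)
  then show "x_trig s > -1" by (simp add: X)
  \<comment> \<open>In terms of the half angle, \<open>1 + 2 * x / 3 = 4 * d^2 / 3\<close>, so the
    root in \<open>scoord\<close> disappears; what remains, \<open>4 * d^3 - 3 * d\<close>, is the
    triple-angle polynomial of \<open>\<phi> / 2\<close>.\<close>
  define d where "d = cos (\<phi> / 2)"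
  have d: "d > 0" unfolding d_def using \<phi> by (intro cos_gt_zero) auto
  have cd: "cos \<phi> = 2 * d\<^sup>2 - 1"
    using cos_double_cos[of "\<phi> / 2"] by (simp add: d_def)
  have "1 + 2 * x_trig s / 3 = (2 * d / sqrt 3)\<^sup>2"
    unfolding X cd by (simp add: power_divide power_mult_distrib field_simps)
  then have sq: "sqrt (1 + 2 * x_trig s / 3) = 2 * d / sqrt 3" using d by simp
  have "cos (\<phi> + \<phi> / 2) = cos \<phi> * cos (\<phi> / 2) - sin \<phi> * sin (\<phi> / 2)" by (rule cos_add)
  also have "sin \<phi> = 2 * sin (\<phi> / 2) * cos (\<phi> / 2)" using sin_double[of "\<phi> / 2"] by simp
  also have "cos \<phi> * cos (\<phi> / 2) - 2 * sin (\<phi> / 2) * cos (\<phi> / 2) * sin (\<phi> / 2)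
      = (cos \<phi> - 2 * (sin (\<phi> / 2))\<^sup>2) * d" by (simp add: d_def power2_eq_square algebra_simps)
  also have "(sin (\<phi> / 2))\<^sup>2 = 1 - d\<^sup>2" unfolding d_def by (rule sin_squared_eq)
  finally have "cos (\<phi> + \<phi> / 2) = (4 * d\<^sup>2 - 3) * d" by (simp add: cd)
  moreover have "\<phi> + \<phi> / 2 = pi / 2 - v" by (simp add: \<phi>_def field_simps)
  ultimately have s: "sqrt 3 * s = (4 * d\<^sup>2 - 3) * d" using v(3) by (simp add: cos_sin_eq)
  have "scoord (x_trig s) = (2 * d\<^sup>2 - 3 / 2) * (2 * d / sqrt 3)"
    unfolding scoord_def sq by (simp add: X cd)
  also have "\<dots> = (sqrt 3 * s) / sqrt 3" unfolding s by (simp add: field_simps)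
  also have "\<dots> = s" by simp
  finally show "scoord (x_trig s) = s" .
qed

lemma x_trig_scoord: "x > -1 \<Longrightarrow> \<bar>scoord x\<bar> < sqrt (1/3) \<Longrightarrow> x_trig (scoord x) = x"
  using scoord_x_trig[of "scoord x"] scoord_inj[of "x_trig (scoord x)" x] by auto

section \<open>Transfer of the line integrals to the polar angle\<close>

lemma radius_bound:
  assumes "h \<in> L"
  shows "0 < sqrt (2 * h)" "sqrt (2 * h) < sqrt (1/3)" "\<bar>sqrt (2 * h) * cos \<theta>\<bar> < sqrt (1/3)"
proof -
  show 1: "0 < sqrt (2 * h)" "sqrt (2 * h) < sqrt (1/3)" using assms by (auto simp: L_def)
  have "sqrt (2 * h) * \<bar>cos \<theta>\<bar> \<le> sqrt (2 * h) * 1" using 1 by (intro mult_left_mono) auto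
  moreover have "\<bar>sqrt (2 * h) * cos \<theta>\<bar> = sqrt (2 * h) * \<bar>cos \<theta>\<bar>"
    unfolding abs_mult abs_of_pos[OF 1(1)] ..
  ultimately show "\<bar>sqrt (2 * h) * cos \<theta>\<bar> < sqrt (1/3)" using 1(2) by linarith
qed

lemma arcsin_cont:
  assumes "h \<in> L"
  shows "continuous_on S (\<lambda>\<theta>. arcsin (sqrt 3 * (sqrt (2 * h) * cos \<theta>)))"
  using sqrt3_bound[OF radius_bound(3)[OF assms]]
  by (intro continuous_on_arcsin continuous_intros) (auto simp: abs_less_iff intro: less_imp_le)

lemma x_trig_cont:
  assumes "h \<in> L"
  shows "continuous_on S (\<lambda>\<theta>. x_trig (sqrt (2 * h) * cos \<theta>))"
  unfolding x_trig_def by (intro continuous_intros arcsin_cont[OF assms])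

lemma oval_int_cont:
  assumes "h \<in> L"
  shows "continuous_on S (\<lambda>\<theta>. poly P (x_trig (sqrt (2 * h) * cos \<theta>)) * (sqrt (2 * h) * cos \<theta>))"
  by (intro continuous_intros x_trig_cont[OF assms])

text \<open>The integral over \<open>{x..x + p}\<close> has derivative
  \<open>f (x + p) - f x = 0\<close> in \<open>x\<close>. The lower limit \<open>m\<close> of the
  antiderivative lies strictly below both \<open>0\<close> and \<open>c\<close>, so that both are
  interior points.\<close>

lemma integral_periodic:
  fixes f :: "real \<Rightarrow> real"
  assumes f: "\<And>S. continuous_on S f" and p: "\<And>x. f (x + p) = f x" and "p > 0"
  shows "integral {c..c + p} f = integral {0..p} f"
proof -
  define m M where "m = min 0 c - 1" and "M = max 0 c + 1"
  define A where "A = (\<lambda>x. integral {m..x} f)"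
  have A: "(A has_real_derivative f x) (at x)" if "m < x" for x
  proof -
    have "(A has_real_derivative f x) (at x within {m..x + 1})"
      unfolding A_def by (rule integral_has_real_derivative) (use f that in auto)
    then show ?thesis using that by (subst (asm) at_within_interior) auto
  qed
  have comb: "A (x + p) - A x = integral {x..x + p} f" if "m \<le> x" for x
    unfolding A_def using Henstock_Kurzweil_Integration.integral_combine[of m x "x + p" f] that assms
    by (auto simp: integrable_continuous_real)
  have "A (c + p) - A c = A (0 + p) - A 0"
  proof (rule DERIV_isconst3[of m M c 0 "\<lambda>x. A (x + p) - A x"])
    fix x assume x: "x \<in> {m<..<M}"
    have "((\<lambda>x. A (x + p)) has_real_derivative f (x + p)) (at x)"
      by (rule DERIV_shift[THEN iffD1]) (use A x \<open>p > 0\<close> in auto)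
    then have "((\<lambda>x. A (x + p) - A x) has_real_derivative f (x + p) - f x) (at x)"
      using A x by (intro DERIV_diff) auto
    then show "((\<lambda>x. A (x + p) - A x) has_real_derivative 0) (at x)" by (simp add: p)
  qed (auto simp: m_def M_def)
  then show ?thesis using comb[of c] comb[of 0] by (auto simp: m_def)
qed

text \<open>\<open>scoord x\<close> is \<open>x\<close> times a positive factor, so the segment from
  \<open>w t\<close> to \<open>g t\<close> could meet \<open>0\<close> only if
  \<open>x = y = 0\<close>, a point that the oval avoids. The straight-line homotopy thus preserves
  the winding number while it carries the oval to a circle.\<close>

lemma winding_number_scoord:
  assumes h: "h \<in> L" and g: "ccw_oval h g"
    and w_def: "w = (\<lambda>t. Complex (scoord (Re (g t))) (Im (g t)))"
  shows "path w" "\<And>t. t \<in> {0..1} \<Longrightarrow> cmod (w t) = sqrt (2 * h)" "winding_number w 0 = 1"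
proof -
  have pg: "path g" using g by (auto simp: ccw_oval_def valid_path_imp_path)
  have ov: "Re (g t) > -1" "Ham (g t) = h" if "t \<in> {0..1}" for t
    using g that by (auto simp: ccw_oval_def oval_def path_image_def)
  have sc: "continuous_on {0..1} (\<lambda>t. scoord (Re (g t)))"
    unfolding scoord_def using pg by (auto simp: path_def intro!: continuous_intros)
  have im: "continuous_on {0..1} (\<lambda>t. Im (g t))"
    using pg by (auto simp: path_def intro!: continuous_intros)
  then show pw: "path w" unfolding path_def w_def Complex_eq
    by (intro continuous_on_add continuous_on_mult continuous_on_of_real continuous_on_const sc im)
  show cw: "cmod (w t) = sqrt (2 * h)" if "t \<in> {0..1}" for t
    using ov[OF that] by (simp add: w_def cmod_def scoord_square Ham_def)
  have "homotopic_loops (- {0}) w g"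
  proof (rule homotopic_loops_linear)
    show "pathfinish g = pathstart g" using g by (simp add: ccw_oval_def)
    then show "pathfinish w = pathstart w" by (simp add: w_def pathfinish_def pathstart_def)
    fix t :: real assume t: "t \<in> {0..1}"
    have "0 \<notin> closed_segment (w t) (g t)"
    proof
      assume "0 \<in> closed_segment (w t) (g t)"
      then obtain l where l: "0 \<le> l" "l \<le> 1" "0 = (1 - l) *\<^sub>R w t + l *\<^sub>R g t"
        by (auto simp: in_segment)
      define x q where "x = Re (g t)" and "q = sqrt (1 + 2 * x / 3)"
      have q: "q > 0" using ov[OF t] by (simp add: q_def x_def)
      have "0 = Im ((1 - l) *\<^sub>R w t + l *\<^sub>R g t)" using l(3) by simp
      then have y: "Im (g t) = 0" by (simp add: w_def algebra_simps)
      have "0 = Re ((1 - l) *\<^sub>R w t + l *\<^sub>R g t)" using l(3) by simp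
      then have "x * ((1 - l) * q + l) = 0"
        by (simp add: w_def x_def scoord_def q_def algebra_simps)
      moreover have "(1 - l) * q + l > 0" using l q by (cases "l = 1") (auto intro: add_pos_nonneg)
      ultimately have "x = 0" by auto
      then have "w t = 0" using y by (simp add: w_def x_def scoord_def complex_eq_iff)
      then show False using cw[OF t] h by (simp add: L_def)
    qed
    then show "closed_segment (w t) (g t) \<subseteq> - {0}" by blast
  qed (use pw pg in auto)
  then have "winding_number w 0 = winding_number g 0" by (rule winding_number_homotopic_loops)
  then show "winding_number w 0 = 1" using g by (simp add: ccw_oval_def)
qed

text \<open>A logarithm along the path comes only with continuity. Near \<open>t\<close> it differs
  from \<open>q t\<close> by less than \<open>pi\<close> in the imaginary part, so there it equals
  \<open>q t + Ln (w s / w t)\<close> with the principal branch and inherits the derivative of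
  \<open>w\<close>.\<close>

lemma continuous_log_deriv:
  fixes w q :: "real \<Rightarrow> complex"
  assumes S: "open S" "t \<in> S" and w: "\<And>s. s \<in> S \<Longrightarrow> w s = exp (q s)" and q: "isCont q t"
    and W: "(w has_vector_derivative W) (at t)"
  shows "(q has_vector_derivative W / w t) (at t)"
proof -
  have w0: "w t \<noteq> 0" using w S by simp
  have "\<forall>\<^sub>F s in nhds t. dist (q s) (q t) < pi"
    using q pi_gt_zero unfolding continuous_at_imp_continuous_at_within
    by (intro tendstoD) (auto simp: continuous_within tendsto_nhds_iff)
  moreover have "\<forall>\<^sub>F s in nhds t. s \<in> S" using S by (simp add: eventually_nhds_in_open)
  ultimately have "\<forall>\<^sub>F s in nhds t. q t + Ln (w s / w t) = q s"
  proof eventually_elim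
    case (elim s)
    have "\<bar>Im (q s - q t)\<bar> < pi" using abs_Im_le_cmod[of "q s - q t"] elim(1) by (simp add: dist_norm)
    then have "Ln (exp (q s - q t)) = q s - q t" by (intro Ln_exp) auto
    moreover have "w s / w t = exp (q s - q t)" using w elim(2) S(2) by (simp add: exp_diff)
    ultimately show ?case by simp
  qed
  then obtain e where e: "e > 0" "\<And>s. dist s t < e \<Longrightarrow> q t + Ln (w s / w t) = q s"
    unfolding eventually_nhds_metric by blast
  have "((\<lambda>s. w s / w t) has_vector_derivative W / w t) (at t)"
    by (rule has_vector_derivative_divide[OF W])
  moreover have "(Ln has_field_derivative inverse 1) (at (w t / w t) within range (\<lambda>s. w s / w t))"
    using has_field_derivative_Ln[of 1] w0 by (auto intro: has_field_derivative_at_within)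
  ultimately have "(Ln \<circ> (\<lambda>s. w s / w t) has_vector_derivative W / w t * inverse 1) (at t)"
    by (rule field_vector_diff_chain_within)
  then have "((\<lambda>s. q t + Ln (w s / w t)) has_vector_derivative W / w t) (at t)"
    using has_vector_derivative_add[OF has_vector_derivative_const[of "q t" "at t"]] by (fastforce simp: o_def)
  then show ?thesis
    by (rule has_vector_derivative_transform_within[OF _ e(1)]) (use e(2) in auto)
qed

lemma ccw_oval_deriv:
  assumes "ccw_oval h g"
  obtains S D where "finite S" "\<And>t. t \<in> {0<..<1} - S \<Longrightarrow> (g has_vector_derivative D t) (at t)"
    "\<And>t. t \<in> {0<..<1} - S \<Longrightarrow> vector_derivative g (at t within {0..1}) = D t"
proof -
  obtain S where S: "finite S" "g C1_differentiable_on ({0..1} - S)"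
    using assms by (auto simp: ccw_oval_def valid_path_def piecewise_C1_differentiable_on_def)
  then obtain D where D: "\<And>t. t \<in> {0..1} - S \<Longrightarrow> (g has_vector_derivative D t) (at t)"
    unfolding C1_differentiable_on_def by blast
  have "vector_derivative g (at t within {0..1}) = D t" if "t \<in> {0<..<1} - S" for t
    by (rule vector_derivative_at_within_ivl[of g "D t" t 0 1]) (use D that in auto)
  then show thesis using that[OF S(1), of D] D by auto
qed

text \<open>Substitution of the continuous polar angle \<open>\<theta>\<close> of the deformed path.
  The angle may move back and forth; only its end values count, and winding number \<open>1\<close>
  makes them differ by \<open>2 * pi\<close>. Periodicity then removes the starting angle.\<close>

lemma has_integral_dy:
  assumes h: "h \<in> L" and g: "ccw_oval h g"
  shows "((\<lambda>t. poly P (Re (g t)) * Im (vector_derivative g (at t within {0..1}))) has_integral oval_int h P) {0..1}"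
proof -
  define r where "r = sqrt (2 * h)"
  have r: "r > 0" using radius_bound[OF h] by (simp add: r_def)
  define w where "w = (\<lambda>t. Complex (scoord (Re (g t))) (Im (g t)))"
  note wn = winding_number_scoord[OF h g w_def, folded r_def]
  have ov: "Re (g t) > -1" if "t \<in> {0..1}" for t
    using g that by (auto simp: ccw_oval_def oval_def path_image_def)
  have "0 \<notin> path_image w" using wn(2) r by (force simp: path_image_def)
  then obtain q where q: "path q"
      "pathfinish q - pathstart q = 2 * of_real pi * \<i> * winding_number w 0"
      "\<And>t. t \<in> {0..1} \<Longrightarrow> w t = 0 + exp (q t)"
    using winding_number_as_continuous_log[OF wn(1)] by blast
  define \<theta> where "\<theta> = (\<lambda>t. Im (q t))"
  have polar: "scoord (Re (g t)) = r * cos (\<theta> t)" "Im (g t) = r * sin (\<theta> t)" if "t \<in> {0..1}" for t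
  proof -
    have "exp (Re (q t)) = r" using wn(2)[OF that] q(3)[OF that] by simp
    moreover have "Re (w t) = exp (Re (q t)) * cos (Im (q t))" "Im (w t) = exp (Re (q t)) * sin (Im (q t))"
      using q(3)[OF that] by (simp_all add: Re_exp Im_exp)
    ultimately show "scoord (Re (g t)) = r * cos (\<theta> t)" "Im (g t) = r * sin (\<theta> t)"
      by (simp_all add: w_def \<theta>_def)
  qed
  have x_trig: "x_trig (r * cos (\<theta> t)) = Re (g t)" if "t \<in> {0..1}" for t
    using x_trig_scoord[OF ov[OF that]] polar(1)[OF that] radius_bound(3)[OF h] by (simp add: r_def)
  have \<theta>1: "\<theta> 1 = \<theta> 0 + 2 * pi"
  proof -
    have "Im (q 1 - q 0) = Im (2 * of_real pi * \<i> * winding_number w 0)"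
      using q(2) by (simp add: pathfinish_def pathstart_def)
    then show ?thesis by (simp add: \<theta>_def wn(3))
  qed
  have \<theta>c: "continuous_on {0..1} \<theta>"
    unfolding \<theta>_def using q(1) by (auto simp: path_def intro!: continuous_intros)
  obtain S D where S: "finite S" "\<And>t. t \<in> {0<..<1} - S \<Longrightarrow> (g has_vector_derivative D t) (at t)"
    "\<And>t. t \<in> {0<..<1} - S \<Longrightarrow> vector_derivative g (at t within {0..1}) = D t"
    using ccw_oval_deriv[OF g] by blast
  have "\<exists>d. (\<theta> has_real_derivative d) (at t) \<and> r * cos (\<theta> t) * d = Im (D t)"
    if t: "t \<in> {0<..<1} - S" for t
  proof -
    have Dt: "((\<lambda>t. Re (g t)) has_vector_derivative Re (D t)) (at t)"
      "((\<lambda>t. Im (g t)) has_vector_derivative Im (D t)) (at t)"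
      using bounded_linear.has_vector_derivative[OF bounded_linear_Re S(2)[OF t]]
        bounded_linear.has_vector_derivative[OF bounded_linear_Im S(2)[OF t]] by auto
    obtain sd where sd: "(scoord has_real_derivative sd) (at (Re (g t)))"
      using scoord_deriv[of "Re (g t)"] ov[of t] t by auto
    have 1: "((\<lambda>t. scoord (Re (g t))) has_vector_derivative sd * Re (D t)) (at t)"
      unfolding has_real_derivative_iff_has_vector_derivative[symmetric]
      by (rule DERIV_chain2[of scoord _ "\<lambda>t. Re (g t)", OF sd])
        (use Dt in \<open>simp add: has_real_derivative_iff_has_vector_derivative\<close>)
    have weq: "w = (\<lambda>t. of_real (scoord (Re (g t))) + \<i> * of_real (Im (g t)))"
      by (simp add: w_def Complex_eq)
    have W: "(w has_vector_derivative of_real (sd * Re (D t)) + \<i> * of_real (Im (D t))) (at t)"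
      unfolding weq using 1 Dt(2)
      by (intro has_vector_derivative_add has_vector_derivative_mult_right has_vector_derivative_of_real)
         (auto simp: has_real_derivative_iff_has_vector_derivative)
    have "isCont q t"
      using q(1) t continuous_on_interior[of "{0..1}" q t] by (auto simp: path_def)
    then obtain Q where "(q has_vector_derivative Q) (at t)"
      using continuous_log_deriv[of "{0<..<1}" t w q, OF _ _ _ _ W] q(3) t by auto
    then have d: "(\<theta> has_real_derivative Im Q) (at t)"
      unfolding \<theta>_def has_real_derivative_iff_has_vector_derivative
      by (rule bounded_linear.has_vector_derivative[OF bounded_linear_Im])
    have "((\<lambda>s. r * sin (\<theta> s)) has_real_derivative r * (cos (\<theta> t) * Im Q)) (at t)"
      by (intro DERIV_cmult DERIV_chain2[OF DERIV_sin d])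
    \<comment> \<open>Comparing two derivatives of \<open>y = r * sin \<theta>\<close> yields
      \<open>dy\<close> without dividing by \<open>cos \<theta>\<close>, which vanishes somewhere on
      the path.\<close>
    then have "((\<lambda>s. Im (g s)) has_real_derivative r * (cos (\<theta> t) * Im Q)) (at t)"
      by (rule has_field_derivative_transform_within_open[of _ _ _ "{0<..<1}"]) (use t polar(2) in auto)
    then have "r * (cos (\<theta> t) * Im Q) = Im (D t)"
      using Dt(2) DERIV_unique by (auto simp: has_real_derivative_iff_has_vector_derivative[symmetric])
    then show ?thesis using d by (intro exI[of _ "Im Q"]) (auto simp: mult.assoc)
  qed
  then obtain d where d: "\<And>t. t \<in> {0<..<1} - S \<Longrightarrow> (\<theta> has_real_derivative d t) (at t)"
    "\<And>t. t \<in> {0<..<1} - S \<Longrightarrow> r * cos (\<theta> t) * d t = Im (D t)" by metis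
  define f where "f = (\<lambda>\<theta>. poly P (x_trig (r * cos \<theta>)) * (r * cos \<theta>))"
  have fc: "continuous_on T f" for T unfolding f_def r_def by (rule oval_int_cont[OF h])
  have "compact (\<theta> ` {0..1})" using \<theta>c by (intro compact_continuous_image) auto
  then have "bounded (\<theta> ` {0..1})" by (rule compact_imp_bounded)
  then obtain B where B: "\<forall>t\<in>{0..1}. \<bar>\<theta> t\<bar> \<le> B" by (auto simp: bounded_iff)
  have "((\<lambda>t. d t *\<^sub>R f (\<theta> t)) has_integral (integral {\<theta> 0..\<theta> 1} f)) {0..1}"
  proof (rule has_integral_substitution_strong[where s = "S \<union> {0, 1}" and c = "-B" and d = B])
    show "\<theta> ` {0..1} \<subseteq> {-B..B}" using B by (auto simp: abs_le_iff minus_le_iff)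
    show "(\<theta> has_real_derivative d t) (at t within {0..1})" if "t \<in> {0..1} - (S \<union> {0, 1})" for t
      by (rule has_field_derivative_at_within, rule d) (use that in auto)
  qed (use S(1) \<theta>1 \<theta>c fc in auto)
  moreover have "integral {\<theta> 0..\<theta> 1} f = oval_int h P"
    unfolding \<theta>1 oval_int_def f_def[unfolded r_def, symmetric]
    by (rule integral_periodic) (auto simp: fc, simp add: f_def)
  ultimately have "((\<lambda>t. d t *\<^sub>R f (\<theta> t)) has_integral oval_int h P) {0..1}" by simp
  then show ?thesis
  proof (rule has_integral_spike_finite[rotated 2])
    show "finite (S \<union> {0, 1})" using S(1) by simp
    fix t assume "t \<in> {0..1} - (S \<union> {0, 1})"
    then have t: "t \<in> {0<..<1} - S" "t \<in> {0..1}" by auto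
    show "poly P (Re (g t)) * Im (vector_derivative g (at t within {0..1})) = d t *\<^sub>R f (\<theta> t)"
      unfolding S(3)[OF t(1)] f_def x_trig[OF t(2)] d(2)[OF t(1), symmetric] by simp
  qed
qed

text \<open>Integration by parts: the differential of \<open>P(x) * y\<close> is
  \<open>P'(x) * y dx + P(x) dy\<close>, and its integral over a closed path vanishes.\<close>

lemma has_integral_dx:
  assumes h: "h \<in> L" and g: "ccw_oval h g"
  shows "((\<lambda>t. poly (pderiv P) (Re (g t)) * Im (g t) * Re (vector_derivative g (at t within {0..1})))
     has_integral - oval_int h P) {0..1}"
proof -
  obtain S D where S: "finite S" "\<And>t. t \<in> {0<..<1} - S \<Longrightarrow> (g has_vector_derivative D t) (at t)"
    "\<And>t. t \<in> {0<..<1} - S \<Longrightarrow> vector_derivative g (at t within {0..1}) = D t"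
    using ccw_oval_deriv[OF g] by blast
  define V where "V = (\<lambda>t. vector_derivative g (at t within {0..1}))"
  define G where "G = (\<lambda>t. poly P (Re (g t)) * Im (g t))"
  have pg: "path g" and cl: "g 1 = g 0"
    using g by (auto simp: ccw_oval_def valid_path_imp_path pathfinish_def pathstart_def)
  have "((\<lambda>t. poly (pderiv P) (Re (g t)) * Im (g t) * Re (V t) + poly P (Re (g t)) * Im (V t))
      has_integral (G 1 - G 0)) {0..1}"
  proof (rule fundamental_theorem_of_calculus_interior_strong[OF S(1)])
    show "continuous_on {0..1} G"
      unfolding G_def using pg by (auto simp: path_def intro!: continuous_intros)
    fix t assume t: "t \<in> {0<..<1} - S"
    have Dt: "((\<lambda>t. Re (g t)) has_real_derivative Re (D t)) (at t)"
      "((\<lambda>t. Im (g t)) has_real_derivative Im (D t)) (at t)"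
      using bounded_linear.has_vector_derivative[OF bounded_linear_Re S(2)[OF t]]
        bounded_linear.has_vector_derivative[OF bounded_linear_Im S(2)[OF t]]
      by (auto simp: has_real_derivative_iff_has_vector_derivative)
    have "(G has_real_derivative
        poly (pderiv P) (Re (g t)) * Re (D t) * Im (g t) + Im (D t) * poly P (Re (g t))) (at t)"
      unfolding G_def by (intro DERIV_mult DERIV_chain2[OF poly_DERIV] Dt)
    then show "(G has_vector_derivative
        poly (pderiv P) (Re (g t)) * Im (g t) * Re (V t) + poly P (Re (g t)) * Im (V t)) (at t)"
      unfolding V_def S(3)[OF t] has_real_derivative_iff_has_vector_derivative[symmetric]
      by (simp add: mult_ac)
  qed auto
  from has_integral_diff[OF this has_integral_dy[OF h g, of P, folded V_def]]
  show ?thesis by (simp add: G_def cl V_def)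
qed

lemma I_poly_eq: "h \<in> L \<Longrightarrow> ccw_oval h (\<gamma> h) \<Longrightarrow> I_poly \<gamma> P h = oval_int h P"
  unfolding I_poly_def integral_dy_def by (intro integral_unique has_integral_dy)

lemma integral_dx_eq:
  "h \<in> L \<Longrightarrow> ccw_oval h g \<Longrightarrow> integral_dx g (\<lambda>z. poly (pderiv P) (Re z) * Im z) = - oval_int h P"
  unfolding integral_dx_def by (intro integral_unique has_integral_dx)

subsection \<open>Power series of the Abelian integrals\<close>


definition cosint :: "nat \<Rightarrow> real" where
  "cosint k = integral {0..2 * pi} (\<lambda>\<theta>. cos \<theta> ^ k)"

text \<open>The coefficient of \<open>h^n\<close> in \<open>oval_sin a h\<close>. With
  \<open>z = sqrt 3 * r * cos \<theta>\<close>, the term \<open>z^(2n-1)\<close> times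
  \<open>r * cos \<theta>\<close> contributes
  \<open>3^n / sqrt 3 * r^(2n) * cos \<theta>^(2n)\<close>, and \<open>r^2 = 2 * h\<close> gives
  \<open>6^n / sqrt 3\<close>. There is no constant term.\<close>

definition oval_coeff :: "real \<Rightarrow> nat \<Rightarrow> real" where
  "oval_coeff a n = (if n = 0 then 0 else sin_asin_coeff a (2 * n - 1) * (6 ^ n * cosint (2 * n) / sqrt 3))"

text \<open>With \<open>a = 2 * m / 3\<close>, the part of the integral of
  \<open>cos (m * \<phi>) dy\<close> that is multiplied by \<open>sin (m * pi / 3)\<close>.\<close>

definition oval_sin :: "real \<Rightarrow> real \<Rightarrow> real" where
  "oval_sin a h = integral {0..2 * pi}
     (\<lambda>\<theta>. sin (a * arcsin (sqrt 3 * (sqrt (2 * h) * cos \<theta>))) * (sqrt (2 * h) * cos \<theta>))"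

lemma cosint_pos: "cosint (2 * n) > 0"
proof -
  have c: "continuous_on {0..2 * pi} (\<lambda>\<theta>. cos \<theta> ^ (2 * n) :: real)" by (intro continuous_intros)
  have "cosint (2 * n) \<ge> 0"
    unfolding cosint_def by (intro integral_nonneg integrable_continuous_real c) (simp add: power_mult)
  moreover have "cosint (2 * n) \<noteq> 0"
  proof
    assume "cosint (2 * n) = 0"
    then have "\<forall>\<theta>\<in>{0..2 * pi}. cos \<theta> ^ (2 * n) = 0"
      unfolding cosint_def using integral_eq_0_iff[OF c] pi_gt_zero by (simp add: power_mult)
    then show False by (auto dest!: bspec[of _ _ 0])
  qed
  ultimately show ?thesis by simp
qed

lemma cosint_bound: "\<bar>cosint k\<bar> \<le> 2 * pi"
proof -
  have "norm (integral {0..2 * pi} (\<lambda>\<theta>. cos \<theta> ^ k :: real)) \<le> integral {0..2 * pi} (\<lambda>\<theta>. 1)"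
    by (intro integral_norm_bound_integral integrable_continuous_real continuous_intros)
      (auto simp: power_abs intro!: power_le_one)
  then show ?thesis by (simp add: cosint_def)
qed

text \<open>The arcsine coefficients and the cosine integrals are bounded, so only the growth
  \<open>6^n\<close> matters; the resulting radius is exactly the right end of
  \<open>L\<close>.\<close>

lemma pconv_oval_coeff: "pconv (1 / 6) (oval_coeff a)"
proof -
  obtain B where B: "\<And>n. \<bar>sin_asin_coeff a n\<bar> \<le> B" using sin_asin_coeff_bounded by blast
  have B0: "B \<ge> 0" using B[of 0] by simp
  show ?thesis
  proof (rule pconv_bounded)
    fix n
    have "\<bar>sin_asin_coeff a (2 * n - 1)\<bar> * \<bar>6 ^ n * cosint (2 * n) / sqrt 3\<bar> \<le> B * (6 ^ n * (2 * pi))"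
    proof (intro mult_mono B)
      have "\<bar>6 ^ n * cosint (2 * n) / sqrt 3\<bar> \<le> 6 ^ n * (2 * pi) / 1"
        unfolding abs_divide abs_mult
        by (intro frac_le mult_mono cosint_bound) auto
      then show "\<bar>6 ^ n * cosint (2 * n) / sqrt 3\<bar> \<le> 6 ^ n * (2 * pi)" by simp
    qed (use B0 in auto)
    then have "\<bar>sin_asin_coeff a (2 * n - 1) * (6 ^ n * cosint (2 * n) / sqrt 3)\<bar> \<le> (B * (2 * pi)) * 6 ^ n"
      unfolding abs_mult[of "sin_asin_coeff a (2 * n - 1)"] by (simp add: mult_ac)
    then show "\<bar>oval_coeff a n\<bar> \<le> (B * (2 * pi)) * 6 ^ n" using B0 by (simp add: oval_coeff_def)
  qed simp
qed

text \<open>Termwise integration of the arcsine series. For \<open>h\<close> in \<open>L\<close> its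
  argument stays below \<open>\<rho> < 1\<close> in absolute value on the whole circle, so the
  Weierstrass test applies.\<close>

lemma oval_sin_series:
  assumes h: "h \<in> L" and a: "a \<noteq> 0"
  shows "oval_sin a h = pser (oval_coeff a) h"
proof -
  define r where "r = sqrt (2 * h)"
  define \<rho> where "\<rho> = sqrt 3 * r"
  have r: "0 < r" "r\<^sup>2 = 2 * h" "r < sqrt (1/3)"
    using radius_bound[OF h] h by (auto simp: r_def L_def)
  have \<rho>: "0 < \<rho>" "\<rho> < 1" using r sqrt3_bound[of r] by (auto simp: \<rho>_def)
  obtain B where B: "\<And>n. \<bar>sin_asin_coeff a n\<bar> \<le> B" using sin_asin_coeff_bounded by blast
  have B0: "B \<ge> 0" using B[of 0] by simp
  define F where "F = (\<lambda>n \<theta>. sin_asin_coeff a n * (\<rho> * cos \<theta>) ^ n * (r * cos \<theta>))"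
  have "uniform_limit {0..2 * pi} (\<lambda>n \<theta>. \<Sum>i<n. F i \<theta>) (\<lambda>\<theta>. \<Sum>i. F i \<theta>) sequentially"
  proof (rule Weierstrass_m_test[where M = "\<lambda>n. B * \<rho> ^ n * r"])
    show "summable (\<lambda>n. B * \<rho> ^ n * r)"
      using \<rho> by (intro summable_mult summable_mult2 summable_geometric) simp
    fix n \<theta>
    have "\<bar>\<rho> * cos \<theta>\<bar> ^ n \<le> \<rho> ^ n"
    proof (rule power_mono)
      have "\<rho> * \<bar>cos \<theta>\<bar> \<le> \<rho> * 1" using \<rho> by (intro mult_left_mono) auto
      then show "\<bar>\<rho> * cos \<theta>\<bar> \<le> \<rho>" using \<rho> by (simp add: abs_mult)
    qed auto
    moreover have "\<bar>r * cos \<theta>\<bar> \<le> r"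
    proof -
      have "r * \<bar>cos \<theta>\<bar> \<le> r * 1" using r by (intro mult_left_mono) auto
      then show ?thesis using r by (simp add: abs_mult)
    qed
    ultimately have "\<bar>sin_asin_coeff a n\<bar> * \<bar>\<rho> * cos \<theta>\<bar> ^ n * \<bar>r * cos \<theta>\<bar> \<le> B * \<rho> ^ n * r"
      using B B0 \<rho> by (intro mult_mono) auto
    then show "norm (F n \<theta>) \<le> B * \<rho> ^ n * r" by (simp add: F_def abs_mult power_abs)
  qed
  then obtain I J where IJ: "\<And>n. ((\<lambda>\<theta>. \<Sum>i<n. F i \<theta>) has_integral I n) {0..2 * pi}"
    "((\<lambda>\<theta>. \<Sum>i. F i \<theta>) has_integral J) {0..2 * pi}" "I \<longlonglongrightarrow> J"
    by (rule uniform_limit_integral) (auto simp: F_def intro!: continuous_intros)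
  have Fs: "(\<Sum>i. F i \<theta>) = sin (a * arcsin (sqrt 3 * (r * cos \<theta>))) * (r * cos \<theta>)" for \<theta>
  proof -
    have z: "\<bar>\<rho> * cos \<theta>\<bar> < 1"
      using sqrt3_bound[OF radius_bound(3)[OF h, of \<theta>]] by (simp add: \<rho>_def r_def mult.assoc)
    have "(\<lambda>i. F i \<theta>) sums (pser (sin_asin_coeff a) (\<rho> * cos \<theta>) * (r * cos \<theta>))"
      unfolding F_def by (intro sums_mult2 pser_sums[OF pconv_sin_asin_coeff z])
    then show ?thesis by (simp add: sums_iff pser_sin_asin_coeff[OF a z]) (simp add: \<rho>_def mult.assoc)
  qed
  have J: "J = oval_sin a h" unfolding oval_sin_def using IJ(2) by (simp add: Fs r_def[symmetric] integral_unique)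
  have "I n = (\<Sum>i<n. sin_asin_coeff a i * \<rho> ^ i * r * cosint (Suc i))" for n
  proof -
    have "((\<lambda>\<theta>. F i \<theta>) has_integral sin_asin_coeff a i * \<rho> ^ i * r * cosint (Suc i)) {0..2 * pi}" for i
    proof -
      have "((\<lambda>\<theta>. cos \<theta> ^ Suc i) has_integral cosint (Suc i)) {0..2 * pi}"
        unfolding cosint_def
        by (intro integrable_integral integrable_continuous_real continuous_intros)
      from has_integral_mult_right[OF this, of "sin_asin_coeff a i * \<rho> ^ i * r"]
      show ?thesis by (simp add: F_def power_mult_distrib mult_ac)
    qed
    then have "((\<lambda>\<theta>. \<Sum>i<n. F i \<theta>) has_integral (\<Sum>i<n. sin_asin_coeff a i * \<rho> ^ i * r * cosint (Suc i))) {0..2 * pi}"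
      by (intro has_integral_sum) auto
    from has_integral_unique[OF IJ(1) this] show ?thesis .
  qed
  then have "I = (\<lambda>n. \<Sum>i<n. sin_asin_coeff a i * \<rho> ^ i * r * cosint (Suc i))" by (rule ext)
  then have s: "(\<lambda>i. sin_asin_coeff a i * \<rho> ^ i * r * cosint (Suc i)) sums oval_sin a h"
    using IJ(3) unfolding J sums_def by (simp only:)
  \<comment> \<open>Only odd powers of the argument occur; together with the factor from
    \<open>dy\<close> they give even powers of \<open>r\<close>, hence integer powers of
    \<open>h\<close>.\<close>
  have ev: "sin_asin_coeff a (2 * k) = 0" for k
    by (induction k) auto
  have sm: "strict_mono (\<lambda>l. 2 * l + 1 :: nat)" by (auto simp: strict_mono_def)
  have "(\<lambda>l. sin_asin_coeff a (2 * l + 1) * \<rho> ^ (2 * l + 1) * r * cosint (Suc (2 * l + 1))) sums oval_sin a h"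
  proof (subst sums_mono_reindex[OF sm, where f = "\<lambda>i. sin_asin_coeff a i * \<rho> ^ i * r * cosint (Suc i)"])
    fix n assume "n \<notin> range (\<lambda>l. 2 * l + 1 :: nat)"
    then have "even n" by (metis oddE rangeI)
    then show "sin_asin_coeff a n * \<rho> ^ n * r * cosint (Suc n) = 0" using ev by (auto elim!: evenE)
  qed (rule s)
  moreover have "sin_asin_coeff a (2 * l + 1) * \<rho> ^ (2 * l + 1) * r * cosint (Suc (2 * l + 1)) = oval_coeff a (Suc l) * h ^ Suc l" for l
  proof -
    have "\<rho>\<^sup>2 = 6 * h" by (simp add: \<rho>_def power_mult_distrib r)
    then have "\<rho> ^ (2 * l + 1) * r = (6 * h) ^ l * (\<rho> * r)" by (simp add: power_mult)
    also have "\<rho> * r = sqrt 3 * (2 * h)" by (simp add: \<rho>_def r(2)[symmetric] power2_eq_square)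
    also have "\<dots> = (6 * h) / sqrt 3" by (simp add: field_simps)
    also have "(6 * h) ^ l * ((6 * h) / sqrt 3) = 6 ^ Suc l * h ^ Suc l / sqrt 3"
      by (simp add: power_mult_distrib)
    finally have "\<rho> ^ (2 * l + 1) * r = 6 ^ Suc l * h ^ Suc l / sqrt 3" .
    moreover have "2 * Suc l - 1 = 2 * l + 1" "2 * Suc l = Suc (2 * l + 1)" by auto
    ultimately show ?thesis unfolding oval_coeff_def by (simp add: mult.assoc) 
  qed
  ultimately have "(\<lambda>l. oval_coeff a (Suc l) * h ^ Suc l) sums oval_sin a h" by simp
  then have "(\<lambda>l. oval_coeff a l * h ^ l) sums oval_sin a h" by (subst (asm) sums_Suc_iff) (simp add: oval_coeff_def)
  then show ?thesis by (rule pser_eqI[symmetric])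
qed

lemma integral_antiperiodic:
  fixes f :: "real \<Rightarrow> real"
  assumes f: "\<And>S. continuous_on S f" and p: "\<And>x. f (x + pi) = - f x"
  shows "integral {0..2 * pi} f = 0"
proof -
  have "integral {0..2 * pi} f = integral {0..pi} f + integral {pi..2 * pi} f"
    by (rule Henstock_Kurzweil_Integration.integral_combine[symmetric])
      (auto intro!: integrable_continuous_real f)
  also have "integral {pi..2 * pi} f = integral {0..pi} (f \<circ> (\<lambda>x. x + pi))"
    using integral_shift[of 0 pi pi f] f by simp
  also have "\<dots> = - integral {0..pi} f" by (simp add: o_def p)
  finally show ?thesis by simp
qed

text \<open>The addition theorem splits \<open>cos (m * (pi / 3 - 2 / 3 * v))\<close> into a part
  even in \<open>v\<close> and a part odd in \<open>v\<close>. The half turn changes the signs of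
  \<open>v\<close> and of \<open>dy\<close>, so the even part integrates to \<open>0\<close> and the
  odd part remains, with weight \<open>sin (m * pi / 3)\<close>.\<close>

lemma oval_int_trig:
  assumes h: "h \<in> L" and P: "\<And>\<phi>. poly P (cos \<phi> - 1 / 2) = (\<Sum>m\<le>d. c m * cos (real m * \<phi>))"
  shows "oval_int h P = (\<Sum>m\<le>d. c m * sin (real m * pi / 3) * oval_sin (2 * real m / 3) h)"
proof -
  define v where "v = (\<lambda>\<theta>. arcsin (sqrt 3 * (sqrt (2 * h) * cos \<theta>)))"
  define y where "y = (\<lambda>\<theta>. sqrt (2 * h) * cos \<theta>)"
  have vc: "continuous_on S v" for S unfolding v_def by (rule arcsin_cont[OF h])
  have yc: "continuous_on S y" for S unfolding y_def by (intro continuous_intros)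
  have "poly P (x_trig (y \<theta>)) * y \<theta> = (\<Sum>m\<le>d. c m * cos (real m * pi / 3) * (cos (2 * real m / 3 * v \<theta>) * y \<theta>)
      + c m * sin (real m * pi / 3) * (sin (2 * real m / 3 * v \<theta>) * y \<theta>))" for \<theta>
  proof -
    have "poly P (x_trig (y \<theta>)) = (\<Sum>m\<le>d. c m * cos (real m * (pi / 3 - 2 / 3 * v \<theta>)))"
      using P[of "pi / 3 - 2 / 3 * v \<theta>"] by (simp add: x_trig_def v_def y_def)
    moreover have "cos (real m * (pi / 3 - 2 / 3 * v \<theta>)) = cos (real m * pi / 3) * cos (2 * real m / 3 * v \<theta>)
        + sin (real m * pi / 3) * sin (2 * real m / 3 * v \<theta>)" for m
    proof -
      have "real m * (pi / 3 - 2 / 3 * v \<theta>) = real m * pi / 3 - 2 * real m / 3 * v \<theta>"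
        by (simp add: algebra_simps)
      then show ?thesis by (simp only: cos_diff)
    qed
    ultimately have "poly P (x_trig (y \<theta>)) * y \<theta> = (\<Sum>m\<le>d. c m * (cos (real m * pi / 3) * cos (2 * real m / 3 * v \<theta>)
        + sin (real m * pi / 3) * sin (2 * real m / 3 * v \<theta>)) * y \<theta>)"
      by (simp only: sum_distrib_right)
    also have "\<dots> = (\<Sum>m\<le>d. c m * cos (real m * pi / 3) * (cos (2 * real m / 3 * v \<theta>) * y \<theta>)
      + c m * sin (real m * pi / 3) * (sin (2 * real m / 3 * v \<theta>) * y \<theta>))"
      by (intro sum.cong refl) (simp only: distrib_right distrib_left mult.assoc)
    finally show ?thesis .
  qed
  then have "oval_int h P = integral {0..2 * pi} (\<lambda>\<theta>.
      \<Sum>m\<le>d. c m * cos (real m * pi / 3) * (cos (2 * real m / 3 * v \<theta>) * y \<theta>)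
      + c m * sin (real m * pi / 3) * (sin (2 * real m / 3 * v \<theta>) * y \<theta>))"
    unfolding oval_int_def y_def by simp
  also have "\<dots> = (\<Sum>m\<le>d. c m * sin (real m * pi / 3) * oval_sin (2 * real m / 3) h)"
  proof (rule integral_unique, rule has_integral_sum)
    fix m
    define a where "a = 2 * real m / 3"
    have ca: "continuous_on S (\<lambda>\<theta>. cos (a * v \<theta>) * y \<theta>)" "continuous_on S (\<lambda>\<theta>. sin (a * v \<theta>) * y \<theta>)" for S
      by (intro continuous_intros vc yc)+
    have "integral {0..2 * pi} (\<lambda>\<theta>. cos (a * v \<theta>) * y \<theta>) = 0"
    proof (rule integral_antiperiodic[OF ca(1)])
      fix x
      have "\<bar>sqrt 3 * (sqrt (2 * h) * cos x)\<bar> < 1" by (intro sqrt3_bound radius_bound h)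
      then have "v (x + pi) = - v x" by (simp add: v_def arcsin_minus)
      then show "cos (a * v (x + pi)) * y (x + pi) = - (cos (a * v x) * y x)" by (simp add: y_def)
    qed
    then have "((\<lambda>\<theta>. cos (a * v \<theta>) * y \<theta>) has_integral 0) {0..2 * pi}"
      using integrable_integral[OF integrable_continuous_real[OF ca(1)]] by metis
    moreover have "((\<lambda>\<theta>. sin (a * v \<theta>) * y \<theta>) has_integral oval_sin a h) {0..2 * pi}"
      unfolding oval_sin_def using integrable_integral[OF integrable_continuous_real[OF ca(2)]]
      by (simp add: v_def y_def)
    ultimately have "((\<lambda>\<theta>. c m * cos (real m * pi / 3) * (cos (a * v \<theta>) * y \<theta>)
      + c m * sin (real m * pi / 3) * (sin (a * v \<theta>) * y \<theta>)) has_integral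
      c m * cos (real m * pi / 3) * 0 + c m * sin (real m * pi / 3) * oval_sin a h) {0..2 * pi}"
      by (intro has_integral_add has_integral_mult_right)
    then show "((\<lambda>\<theta>. c m * cos (real m * pi / 3) * (cos (2 * real m / 3 * v \<theta>) * y \<theta>)
      + c m * sin (real m * pi / 3) * (sin (2 * real m / 3 * v \<theta>) * y \<theta>)) has_integral
      c m * sin (real m * pi / 3) * oval_sin (2 * real m / 3) h) {0..2 * pi}" by (simp add: a_def)
  qed auto
  finally show ?thesis .
qed

section \<open>Linearity in the polynomial, and polynomials whose integral vanishes\<close>

lemma oval_int_add: "h \<in> L \<Longrightarrow> oval_int h (P + Q) = oval_int h P + oval_int h Q"
  unfolding oval_int_def poly_add distrib_right
  by (intro integral_add integrable_continuous_real oval_int_cont)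

lemma oval_int_smult: "oval_int h (smult a P) = a * oval_int h P"
  unfolding oval_int_def poly_smult mult.assoc by (rule integral_mult_right)

lemma oval_int_sum:
  assumes "h \<in> L" "finite A"
  shows "oval_int h (\<Sum>i\<in>A. P i) = (\<Sum>i\<in>A. oval_int h (P i))"
  using assms(2)
proof (induction A rule: finite_induct)
  case empty show ?case by (simp add: oval_int_def)
next
  case (insert i A) then show ?case by (simp add: oval_int_add[OF assms(1)])
qed

lemma oval_int_monom: "oval_int h (monom c i) = c * oval_int h (monom 1 i)"
  using oval_int_smult[of h c "monom 1 i"] by (simp add: smult_monom)

lemma oval_int_coeffs:
  assumes "h \<in> L" "degree P \<le> d"
  shows "oval_int h P = (\<Sum>i\<le>d. coeff P i * oval_int h (monom 1 i))"
proof -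
  have "oval_int h P = oval_int h (\<Sum>i\<le>d. monom (coeff P i) i)"
    using assms(2) by (simp add: poly_as_sum_of_monoms')
  also have "\<dots> = (\<Sum>i\<le>d. coeff P i * oval_int h (monom 1 i))"
    by (subst oval_int_sum) (auto simp: assms oval_int_monom[of h "coeff P _"])
  finally show ?thesis .
qed

text \<open>The potential in \<open>Ham\<close>. Its powers supply, in every degree divisible by 3,
  a polynomial with vanishing integral.\<close>

definition U_poly :: "real poly" where
  "U_poly = [:0, 0, 1/2, 1/3:]"

lemma degree_U_power: "degree (U_poly ^ k) = 3 * k" "coeff (U_poly ^ k) (3 * k) = (1/3) ^ k"
proof -
  have d: "degree U_poly = 3" by (simp add: U_poly_def)
  then show "degree (U_poly ^ k) = 3 * k" by (subst degree_power_eq) (auto simp: U_poly_def)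
  then have "coeff (U_poly ^ k) (3 * k) = lead_coeff (U_poly ^ k)" by simp
  also have "\<dots> = lead_coeff U_poly ^ k" by (rule lead_coeff_power)
  also have "lead_coeff U_poly = 1/3" by (simp add: U_poly_def)
  finally show "coeff (U_poly ^ k) (3 * k) = (1/3) ^ k" .
qed

text \<open>On the oval \<open>U_poly\<close> equals \<open>s^2 / 2\<close>, so its powers are
  invariant under the half turn, whereas the factor from \<open>dy\<close> changes sign.\<close>

lemma oval_int_U_power:
  assumes h: "h \<in> L"
  shows "oval_int h (U_poly ^ k) = 0"
  unfolding oval_int_def
proof (rule integral_antiperiodic[OF oval_int_cont[OF h]])
  have U: "poly U_poly (x_trig s) = s\<^sup>2 / 2" if "\<bar>s\<bar> < sqrt (1/3)" for s
    using scoord_x_trig[OF that] scoord_square[of "x_trig s"]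
    by (simp add: U_poly_def power2_eq_square power3_eq_cube field_simps)
  fix x
  have 1: "\<bar>sqrt (2 * h) * cos x\<bar> < sqrt (1/3)" "\<bar>sqrt (2 * h) * cos (x + pi)\<bar> < sqrt (1/3)"
    by (rule radius_bound(3)[OF h])+
  show "poly (U_poly ^ k) (x_trig (sqrt (2 * h) * cos (x + pi))) * (sqrt (2 * h) * cos (x + pi)) =
      - (poly (U_poly ^ k) (x_trig (sqrt (2 * h) * cos x)) * (sqrt (2 * h) * cos x))"
    unfolding poly_power U[OF 1(1)] U[OF 1(2)] by simp
qed

section \<open>From powers of \<open>cos \<phi> - 1/2\<close> to cosines of multiples\<close>

definition cos_span :: "nat \<Rightarrow> (real \<Rightarrow> real) \<Rightarrow> bool" where
  "cos_span d f \<longleftrightarrow> (\<exists>c. \<forall>\<phi>. f \<phi> = (\<Sum>m\<le>d. c m * cos (real m * \<phi>)))"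

lemma cos_span_add:
  assumes "cos_span d f" "cos_span d g"
  shows "cos_span d (\<lambda>x. f x + g x)"
proof -
  obtain c c' where "\<And>x. f x = (\<Sum>m\<le>d. c m * cos (real m * x))" "\<And>x. g x = (\<Sum>m\<le>d. c' m * cos (real m * x))"
    using assms unfolding cos_span_def by blast
  then show ?thesis unfolding cos_span_def
    by (intro exI[of _ "\<lambda>m. c m + c' m"]) (simp add: distrib_right sum.distrib)
qed

lemma cos_span_cmult:
  assumes "cos_span d f"
  shows "cos_span d (\<lambda>x. b * f x)"
proof -
  obtain c where "\<And>x. f x = (\<Sum>m\<le>d. c m * cos (real m * x))"
    using assms unfolding cos_span_def by blast
  then show ?thesis unfolding cos_span_def
    by (intro exI[of _ "\<lambda>m. b * c m"]) (simp add: sum_distrib_left mult.assoc)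
qed

lemma cos_span_cos: "m \<le> d \<Longrightarrow> cos_span d (\<lambda>x. cos (real m * x))"
  unfolding cos_span_def
  by (intro exI[of _ "\<lambda>k. if k = m then 1 else 0"]) (simp add: if_distrib[of "\<lambda>x. x * _"] sum.delta cong: if_cong)

lemma cos_span_sum:
  assumes "finite A" "\<And>i. i \<in> A \<Longrightarrow> cos_span d (f i)"
  shows "cos_span d (\<lambda>x. \<Sum>i\<in>A. f i x)"
  using assms
proof (induction A rule: finite_induct)
  case empty
  show ?case unfolding cos_span_def by (intro exI[of _ "\<lambda>_. 0"]) simp
next
  case (insert i A)
  then show ?case by (auto intro: cos_span_add)
qed

lemma cos_span_mono: "cos_span d f \<Longrightarrow> d \<le> d' \<Longrightarrow> cos_span d' f"
  unfolding cos_span_def[of d]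
  by (auto simp: fun_eq_iff[symmetric] intro!: cos_span_sum cos_span_cmult cos_span_cos)

lemma cos_span_mult_cos:
  assumes "cos_span d f"
  shows "cos_span (Suc d) (\<lambda>x. cos x * f x)"
proof -
  obtain c where c: "\<And>x. f x = (\<Sum>m\<le>d. c m * cos (real m * x))"
    using assms unfolding cos_span_def by blast
  have k: "cos_span (Suc d) (\<lambda>x. cos x * cos (real m * x))" if "m \<le> d" for m
  proof (cases m)
    case 0 then show ?thesis using cos_span_cos[of 1 "Suc d"] by simp
  next
    case (Suc k)
    have "cos_span (Suc d) (\<lambda>x. 1 / 2 * cos (real (Suc m) * x) + 1 / 2 * cos (real k * x))"
      using that Suc by (intro cos_span_add cos_span_cmult cos_span_cos) auto
    moreover have "cos x * cos (real m * x) = 1 / 2 * cos (real (Suc m) * x) + 1 / 2 * cos (real k * x)" for x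
    proof -
      have "real m * x + x = real (Suc m) * x" "real m * x - x = real k * x"
        by (simp_all add: Suc algebra_simps)
      then show ?thesis using cos_times_cos[of "real m * x" x] by (simp add: mult.commute)
    qed
    ultimately show ?thesis by simp
  qed
  have "cos_span (Suc d) (\<lambda>x. \<Sum>m\<le>d. c m * (cos x * cos (real m * x)))"
    by (intro cos_span_sum cos_span_cmult k) auto
  then show ?thesis by (simp add: c sum_distrib_left mult_ac)
qed

text \<open>Only the leading coefficient is tracked: it is nonzero, so the passage from powers to
  cosines is triangular with nonzero diagonal. The rest \<open>g\<close> is needed only as a span,
  since it is absorbed by lower multiples.\<close>

lemma cos_power_expansion:
  "\<exists>g. cos_span i g \<and> (\<forall>\<phi>. (cos \<phi> - 1 / 2) ^ Suc i = (1 / 2) ^ i * cos (real (Suc i) * \<phi>) + g \<phi>)"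
proof (induction i)
  case 0
  have "cos_span 0 (\<lambda>x. - 1 / 2 * cos (real 0 * x))" by (intro cos_span_cmult cos_span_cos) simp
  then show ?case by (intro exI[of _ "\<lambda>_. - 1 / 2"]) simp
next
  case (Suc i)
  then obtain g where g: "cos_span i g"
    "\<And>\<phi>. (cos \<phi> - 1 / 2) ^ Suc i = (1 / 2) ^ i * cos (real (Suc i) * \<phi>) + g \<phi>" by blast
  define g' where "g' = (\<lambda>x. (1 / 2) ^ Suc i * cos (real i * x) + ((- (1 / 2)) ^ 1 * (1 / 2) ^ i * cos (real (Suc i) * x)
     + (cos x * g x + (- 1 / 2) * g x)))"
  have "cos_span (Suc i) g'" unfolding g'_def
    by (intro cos_span_add cos_span_cmult cos_span_cos cos_span_mult_cos g cos_span_mono[OF g(1)]) auto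
  moreover have "(cos x - 1 / 2) ^ Suc (Suc i) = (1 / 2) ^ Suc i * cos (real (Suc (Suc i)) * x) + g' x" for x
  proof -
    have "real (Suc i) * x + x = real (Suc (Suc i)) * x" "real (Suc i) * x - x = real i * x"
      by (simp_all add: algebra_simps)
    then have "cos x * cos (real (Suc i) * x) = 1 / 2 * cos (real (Suc (Suc i)) * x) + 1 / 2 * cos (real i * x)"
      using cos_times_cos[of "real (Suc i) * x" x] by (simp add: mult.commute)
    moreover have "(cos x - 1 / 2) ^ Suc (Suc i)
        = (1 / 2) ^ i * (cos x * cos (real (Suc i) * x)) - 1 / 2 * (1 / 2) ^ i * cos (real (Suc i) * x)
          + (cos x * g x - 1 / 2 * g x)"
      unfolding power_Suc[of "cos x - 1 / 2" "Suc i"] g(2) by (simp add: algebra_simps)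
    ultimately show ?thesis by (simp add: g'_def algebra_simps)
  qed
  ultimately show ?case by blast
qed

lemma cos_power_coeffs:
  obtains C :: "nat \<Rightarrow> nat \<Rightarrow> real"
  where "\<And>i. C (Suc i) (Suc i) \<noteq> 0" "\<And>i m. m > i \<Longrightarrow> C i m = 0"
    "\<And>i d \<phi>. Suc i \<le> d \<Longrightarrow> (cos \<phi> - 1 / 2) ^ Suc i = (\<Sum>m\<le>d. C (Suc i) m * cos (real m * \<phi>))"
proof -
  have "\<exists>c. \<forall>\<phi>. (cos \<phi> - 1 / 2) ^ Suc i = (1 / 2) ^ i * cos (real (Suc i) * \<phi>) +
      (\<Sum>m\<le>i. c m * cos (real m * \<phi>))" for i
    using cos_power_expansion[of i] unfolding cos_span_def by metis
  then obtain c where c: "\<And>i \<phi>. (cos \<phi> - 1 / 2) ^ Suc i = (1 / 2) ^ i * cos (real (Suc i) * \<phi>) +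
      (\<Sum>m\<le>i. c i m * cos (real m * \<phi>))" by metis
  define C where "C = (\<lambda>i m. if m > i then 0 else if m = i then (1 / 2) ^ (i - 1) else c (i - 1) m)"
  show thesis
  proof (rule that[of C])
    fix i d \<phi> assume "Suc i \<le> d"
    then have "(\<Sum>m\<le>d. C (Suc i) m * cos (real m * \<phi>)) = (\<Sum>m\<le>Suc i. C (Suc i) m * cos (real m * \<phi>))"
      by (intro sum.mono_neutral_right) (auto simp: C_def)
    also have "\<dots> = (\<Sum>m\<le>i. C (Suc i) m * cos (real m * \<phi>)) + (1 / 2) ^ i * cos (real (Suc i) * \<phi>)"
      by (simp add: C_def)
    also have "(\<Sum>m\<le>i. C (Suc i) m * cos (real m * \<phi>)) = (\<Sum>m\<le>i. c i m * cos (real m * \<phi>))"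
      by (intro sum.cong) (auto simp: C_def)
    finally show "(cos \<phi> - 1 / 2) ^ Suc i = (\<Sum>m\<le>d. C (Suc i) m * cos (real m * \<phi>))"
      unfolding c by simp
  qed (auto simp: C_def)
qed

lemma sin_third_pi: "sin (real m * pi / 3) = 0 \<longleftrightarrow> 3 dvd m"
proof
  assume "sin (real m * pi / 3) = 0"
  then obtain i :: int where "real m * pi / 3 = of_int i * pi" by (auto simp: sin_zero_iff_int2)
  then have "real m = 3 * of_int i" by (simp add: field_simps)
  then have "int m = 3 * i" by linarith
  then show "3 dvd m" by presburger
next
  assume "3 dvd m"
  then obtain k where "m = 3 * k" by auto
  then have "real m * pi / 3 = real k * pi" by simp
  then show "sin (real m * pi / 3) = 0" by (simp only: sin_npi)
qed

section \<open>Combinations of the integrals near \<open>h = 0\<close>\<close>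

lemma finite_idx: "finite (idx n)"
  by (rule finite_subset[of _ "{..n}"]) (auto simp: idx_def)

text \<open>Apart from the factors \<open>2 * m / 3\<close>, which depend on \<open>m\<close> alone,
  and factors depending on \<open>l\<close> alone, the matrix of coefficients is the Newton matrix
  at the nodes \<open>\<tau> m\<close>, the squares of these factors. All the extra factors are
  nonzero because \<open>0 \<notin> M\<close>, so the duality survives the rescaling
  \<open>W\<close>.\<close>

lemma oval_coeff_dual:
  assumes "finite M" "0 \<notin> M" "m \<in> M"
  shows "\<exists>w. \<forall>m'\<in>M. (\<Sum>l\<in>{1..card M}. w l * oval_coeff (2 * real m' / 3) l) = (if m' = m then 1 else 0)"
proof -
  define \<tau> where "\<tau> = (\<lambda>m. (2 * real m / 3)\<^sup>2)"
  have "inj_on \<tau> M" by (auto simp: inj_on_def \<tau>_def)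
  from newton_dual[OF assms(1) this assms(3)]
  obtain w where w: "\<And>m'. m' \<in> M \<Longrightarrow> (\<Sum>l<card M. w l * newton l (\<tau> m')) = (if m' = m then 1 else 0)"
    by blast
  define \<kappa> where "\<kappa> = (\<lambda>l. 6 ^ l * cosint (2 * l) / sqrt 3)"
  have \<kappa>: "\<kappa> l \<noteq> 0" for l using cosint_pos[of l] by (simp add: \<kappa>_def)
  have q: "oval_coeff (2 * real k / 3) (Suc l) = (2 * real k / 3) * newton l (\<tau> k) / fact (2 * l + 1) * \<kappa> (Suc l)" for k l
  proof -
    have "2 * Suc l - 1 = 2 * l + 1" by simp
    then show ?thesis unfolding oval_coeff_def \<kappa>_def \<tau>_def by (simp only: sin_asin_coeff_odd) simp
  qed
  define W where "W = (\<lambda>l. w (l - 1) * fact (2 * l - 1) / \<kappa> l / (2 * real m / 3))"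
  have "(\<Sum>l\<in>{1..card M}. W l * oval_coeff (2 * real m' / 3) l) = (if m' = m then 1 else 0)" if "m' \<in> M" for m'
  proof -
    have "(\<Sum>l\<in>{1..card M}. W l * oval_coeff (2 * real m' / 3) l)
        = (\<Sum>l<card M. W (Suc l) * oval_coeff (2 * real m' / 3) (Suc l))"
      by (simp add: sum.atLeast1_atMost_eq)
    also have "\<dots> = (\<Sum>l<card M. real m' / real m * (w l * newton l (\<tau> m')))"
    proof (rule sum.cong[OF refl])
      fix l
      have "m \<noteq> 0" using assms by metis
      moreover have "2 * Suc l - 1 = 2 * l + 1" by simp
      ultimately show "W (Suc l) * oval_coeff (2 * real m' / 3) (Suc l) = real m' / real m * (w l * newton l (\<tau> m'))"
        unfolding W_def q using \<kappa>[of "Suc l"] by (simp add: field_simps del: fact_Suc)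
    qed
    also have "\<dots> = real m' / real m * (if m' = m then 1 else 0)"
      by (simp only: sum_distrib_left[symmetric] w[OF that])
    also have "\<dots> = (if m' = m then 1 else 0)" using assms(2,3) by (cases "m = 0") auto
    finally show ?thesis .
  qed
  then show ?thesis by blast
qed

lemma I_mono_eq:
  assumes "h \<in> L" "ccw_oval h (\<gamma> h)"
  shows "I_mono \<gamma> j h = - oval_int h (monom 1 (Suc j)) / real (Suc j)"
proof -
  have "pderiv (monom (1 / real (Suc j)) (Suc j)) = monom 1 j"
    by (simp add: pderiv_monom del: of_nat_Suc)
  then have "I_mono \<gamma> j h = - oval_int h (monom (1 / real (Suc j)) (Suc j))"
    using integral_dx_eq[OF assms, of "monom (1 / real (Suc j)) (Suc j)"]
    by (simp add: I_mono_def poly_monom)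
  then show ?thesis unfolding oval_int_monom[of h "1 / real (Suc j)"] by simp
qed

text \<open>The multiples \<open>m \<le> n + 1\<close> not divisible by 3 are exactly the successors
  of \<open>idx n\<close>, so there are as many series as integrals and the transition matrix is
  square and triangular. One \<open>C\<close> serves all \<open>n\<close>.\<close>

lemma oval_int_monom_series:
  obtains C :: "nat \<Rightarrow> nat \<Rightarrow> real"
  where "\<And>i. C (Suc i) (Suc i) \<noteq> 0" "\<And>i m. m > i \<Longrightarrow> C i m = 0"
    "\<And>h n j. h \<in> L \<Longrightarrow> j \<in> idx n \<Longrightarrow> oval_int h (monom 1 (Suc j)) =
      (\<Sum>m\<in>Suc ` idx n. C (Suc j) m * sin (real m * pi / 3) * pser (oval_coeff (2 * real m / 3)) h)"
proof -
  obtain C :: "nat \<Rightarrow> nat \<Rightarrow> real" where C: "\<And>i. C (Suc i) (Suc i) \<noteq> 0" "\<And>i m. m > i \<Longrightarrow> C i m = 0"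
    "\<And>i d \<phi>. Suc i \<le> d \<Longrightarrow> (cos \<phi> - 1 / 2) ^ Suc i = (\<Sum>m\<le>d. C (Suc i) m * cos (real m * \<phi>))"
    using cos_power_coeffs by blast
  have "oval_int h (monom 1 (Suc j)) =
      (\<Sum>m\<in>Suc ` idx n. C (Suc j) m * sin (real m * pi / 3) * pser (oval_coeff (2 * real m / 3)) h)"
    if h: "h \<in> L" and j: "j \<in> idx n" for h n j
  proof -
    have "oval_int h (monom 1 (Suc j)) =
        (\<Sum>m\<le>Suc n. C (Suc j) m * sin (real m * pi / 3) * oval_sin (2 * real m / 3) h)"
      by (rule oval_int_trig[OF h]) (use C(3)[of j "Suc n"] j in \<open>simp add: poly_monom idx_def\<close>)
    also have "\<dots> = (\<Sum>m\<in>Suc ` idx n. C (Suc j) m * sin (real m * pi / 3) * oval_sin (2 * real m / 3) h)"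
    proof (rule sum.mono_neutral_right)
      show "\<forall>m\<in>{..Suc n} - Suc ` idx n. C (Suc j) m * sin (real m * pi / 3) * oval_sin (2 * real m / 3) h = 0"
      proof
        fix m assume m: "m \<in> {..Suc n} - Suc ` idx n"
        have "3 dvd m"
        proof (cases m)
          case (Suc k)
          then have "k \<notin> idx n" "k \<le> n" using m by auto
          then have "k mod 3 = 2" by (simp add: idx_def)
          then show ?thesis using Suc by presburger
        qed simp
        then show "C (Suc j) m * sin (real m * pi / 3) * oval_sin (2 * real m / 3) h = 0"
          using sin_third_pi by simp
      qed
    qed (auto simp: idx_def)
    also have "\<dots> = (\<Sum>m\<in>Suc ` idx n. C (Suc j) m * sin (real m * pi / 3) * pser (oval_coeff (2 * real m / 3)) h)"
      by (intro sum.cong refl) (auto simp: oval_sin_series[OF h])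
    finally show ?thesis .
  qed
  then show thesis using that[of C, OF C(1,2)] by blast
qed

lemma I_combination_near_0:
  assumes \<gamma>: "\<forall>h\<in>L. ccw_oval h (\<gamma> h)"
  obtains \<delta> where "0 < \<delta>" "\<delta> \<le> 1 / 6"
    "\<And>a. \<exists>j\<in>idx n. a j \<noteq> 0 \<Longrightarrow> zeros_le (\<lambda>h. \<Sum>j\<in>idx n. a j * I_mono \<gamma> j h) {0<..<\<delta>} (N n)"
proof -
  define M where "M = Suc ` idx n"
  have M: "finite M" "0 \<notin> M" "card M - 1 = N n"
    by (auto simp: M_def finite_idx card_image N_def)
  obtain C :: "nat \<Rightarrow> nat \<Rightarrow> real" where C: "\<And>i. C (Suc i) (Suc i) \<noteq> 0" "\<And>i m. m > i \<Longrightarrow> C i m = 0"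
    "\<And>h n j. h \<in> L \<Longrightarrow> j \<in> idx n \<Longrightarrow> oval_int h (monom 1 (Suc j)) =
      (\<Sum>m\<in>Suc ` idx n. C (Suc j) m * sin (real m * pi / 3) * pser (oval_coeff (2 * real m / 3)) h)"
    using oval_int_monom_series by blast
  obtain \<delta> where \<delta>: "0 < \<delta>" "\<delta> \<le> 1 / 6"
    "\<And>b. \<exists>m\<in>M. b m \<noteq> 0 \<Longrightarrow>
      zeros_le (\<lambda>x. \<Sum>m\<in>M. b m * pser (oval_coeff (2 * real m / 3)) x) {0<..<\<delta>} (card M - 1)"
  proof (rule zeros_le_near_0[where M = M and R = "1/6" and q = "\<lambda>m. oval_coeff (2 * real m / 3)"])
    show "\<exists>w. \<forall>m'\<in>M. (\<Sum>l\<in>{1..card M}. w l * oval_coeff (2 * real m' / 3) l) = (if m' = m then 1 else 0)"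
      if "m \<in> M" for m using oval_coeff_dual[OF M(1,2) that] .
  qed (use M pconv_oval_coeff in \<open>auto simp: oval_coeff_def\<close>)
  have "zeros_le (\<lambda>h. \<Sum>j\<in>idx n. a j * I_mono \<gamma> j h) {0<..<\<delta>} (N n)" if a: "\<exists>j\<in>idx n. a j \<noteq> 0" for a
  proof -
    define b where "b = (\<lambda>m. \<Sum>j\<in>idx n. - a j / real (Suc j) * (C (Suc j) m * sin (real m * pi / 3)))"
    define A where "A = {j\<in>idx n. a j \<noteq> 0}"
    \<comment> \<open>At the largest index with \<open>a k \<noteq> 0\<close> triangularity leaves a
      single term in \<open>b (Suc k)\<close>: larger \<open>j\<close> have \<open>a j = 0\<close>,
      smaller ones have \<open>C (Suc j) (Suc k) = 0\<close>. So a nontrivial \<open>a\<close> gives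
      a nontrivial \<open>b\<close>.\<close>
    define k where "k = Max A"
    have A: "finite A" "A \<noteq> {}" using a finite_idx by (auto simp: A_def)
    then have k: "k \<in> A" "\<And>j. j \<in> A \<Longrightarrow> j \<le> k" by (auto simp: k_def)
    have kI: "k \<in> idx n" "a k \<noteq> 0" using k(1) by (auto simp: A_def)
    have "b (Suc k) = (\<Sum>j\<in>{k}. - a j / real (Suc j) * (C (Suc j) (Suc k) * sin (real (Suc k) * pi / 3)))"
      unfolding b_def
    proof (rule sum.mono_neutral_right)
      show "\<forall>j\<in>idx n - {k}. - a j / real (Suc j) * (C (Suc j) (Suc k) * sin (real (Suc k) * pi / 3)) = 0"
      proof
        fix j assume j: "j \<in> idx n - {k}"
        have "a j = 0 \<or> j < k"
          using k(2)[of j] j by (cases "a j = 0") (auto simp: A_def)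
        then show "- a j / real (Suc j) * (C (Suc j) (Suc k) * sin (real (Suc k) * pi / 3)) = 0"
          using C(2)[of "Suc j" "Suc k"] by auto
      qed
    qed (use kI finite_idx in auto)
    moreover have "sin (real (Suc k) * pi / 3) \<noteq> 0"
    proof -
      have "\<not> 3 dvd Suc k" using kI(1) unfolding idx_def by simp presburger
      then show ?thesis by (simp only: sin_third_pi) simp
    qed
    ultimately have "b (Suc k) \<noteq> 0" using C(1)[of k] kI(2) by simp
    then have z: "zeros_le (\<lambda>x. \<Sum>m\<in>M. b m * pser (oval_coeff (2 * real m / 3)) x) {0<..<\<delta>} (card M - 1)"
      using kI(1) by (intro \<delta>(3)) (auto simp: M_def)
    have e: "(\<Sum>m\<in>M. b m * pser (oval_coeff (2 * real m / 3)) h) = (\<Sum>j\<in>idx n. a j * I_mono \<gamma> j h)"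
      if "h \<in> {0<..<\<delta>}" for h
    proof -
      have h: "h \<in> L" using that \<delta>(2) by (auto simp: L_def)
      have "(\<Sum>j\<in>idx n. a j * I_mono \<gamma> j h) = (\<Sum>j\<in>idx n. - a j / real (Suc j) * oval_int h (monom 1 (Suc j)))"
        by (intro sum.cong refl) (use I_mono_eq[OF h] \<gamma> h in auto)
      also have "\<dots> = (\<Sum>j\<in>idx n. \<Sum>m\<in>M. - a j / real (Suc j) *
          (C (Suc j) m * sin (real m * pi / 3)) * pser (oval_coeff (2 * real m / 3)) h)"
        by (intro sum.cong refl) (simp only: C(3)[OF h] M_def sum_distrib_left mult.assoc)
      also have "\<dots> = (\<Sum>m\<in>M. b m * pser (oval_coeff (2 * real m / 3)) h)"
        unfolding b_def sum_distrib_right by (rule sum.swap)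
      finally show ?thesis by simp
    qed
    show ?thesis
      by (rule zeros_le_cong[OF _ order_refl e]) (use z M(3) in auto)
  qed
  then show thesis using that \<delta>(1,2) by blast
qed

subsection \<open>Global bounds for the first integrals\<close>


lemma sin_asin_coeff_step: "sin_asin_coeff a (2 * Suc l + 1) =
    ((2 * real l + 1)\<^sup>2 - a\<^sup>2) / ((2 * real l + 2) * (2 * real l + 3)) * sin_asin_coeff a (2 * l + 1)"
proof -
  have "2 * Suc l + 1 = Suc (Suc (2 * l + 1))" by simp
  then show ?thesis by (simp only: sin_asin_coeff.simps) (simp add: algebra_simps)
qed

text \<open>The steps for \<open>a = 4/3\<close> and \<open>a = 2/3\<close> have numerators
  \<open>(6l+7)(6l-1)\<close> and \<open>(6l+5)(6l+1)\<close>; their factors are shifted by 6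
  against each other, so the quotient of the two sequences telescopes to a rational function of
  \<open>l\<close>. For \<open>a = 8/3\<close> the numerator is \<open>(6l+11)(6l-5)\<close>, with
  the same effect.\<close>

lemma sin_asin_coeff_ratio_43: "(6 * real l - 1) * sin_asin_coeff (4/3) (2 * l + 1) = - 2 * (6 * real l + 1) * sin_asin_coeff (2/3) (2 * l + 1)"
proof (induction l)
  case (Suc l)
  define D where "D = 9 * ((2 * real l + 2) * (2 * real l + 3))"
  have D: "D > 0" unfolding D_def by (intro mult_pos_pos) auto
  have 1: "sin_asin_coeff (4/3) (2 * Suc l + 1) = (6 * real l + 7) * ((6 * real l - 1) * sin_asin_coeff (4/3) (2 * l + 1)) / D"
    unfolding sin_asin_coeff_step D_def by (simp add: power2_eq_square field_simps)
  have 2: "sin_asin_coeff (2/3) (2 * Suc l + 1) = (6 * real l + 1) * (6 * real l + 5) * sin_asin_coeff (2/3) (2 * l + 1) / D"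
    unfolding sin_asin_coeff_step D_def by (simp add: power2_eq_square field_simps)
  show ?case unfolding 1 2 Suc.IH using D by (simp add: field_simps)
qed simp

lemma sin_asin_coeff_ratio_83: "(6 * real l - 5) * sin_asin_coeff (8/3) (2 * l + 1) = - 4 * (6 * real l + 5) * sin_asin_coeff (2/3) (2 * l + 1)"
proof (induction l)
  case (Suc l)
  define D where "D = 9 * ((2 * real l + 2) * (2 * real l + 3))"
  have D: "D > 0" unfolding D_def by (intro mult_pos_pos) auto
  have 1: "sin_asin_coeff (8/3) (2 * Suc l + 1) = (6 * real l + 11) * ((6 * real l - 5) * sin_asin_coeff (8/3) (2 * l + 1)) / D"
    unfolding sin_asin_coeff_step D_def by (simp add: power2_eq_square field_simps)
  have 2: "sin_asin_coeff (2/3) (2 * Suc l + 1) = (6 * real l + 1) * (6 * real l + 5) * sin_asin_coeff (2/3) (2 * l + 1) / D"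
    unfolding sin_asin_coeff_step D_def by (simp add: power2_eq_square field_simps)
  show ?case unfolding 1 2 Suc.IH using D by (simp add: field_simps)
qed simp

lemma sin_asin_coeff_23_pos: "sin_asin_coeff (2/3) (2 * l + 1) > 0"
proof (induction l)
  case (Suc l)
  have "(2 * real l + 1)\<^sup>2 \<ge> 1" using power_mono[of 1 "2 * real l + 1" 2] by simp
  moreover have "(2/3)\<^sup>2 < (1 :: real)" by (simp add: power_divide)
  ultimately have "(2 * real l + 1)\<^sup>2 - (2/3)\<^sup>2 > 0" by linarith
  then show ?case unfolding sin_asin_coeff_step using Suc.IH by (intro mult_pos_pos divide_pos_pos) auto
qed simp

text \<open>The common weight of the three series. The divisor clears the denominators
  \<open>6l-1\<close> and \<open>6l-5\<close> of the telescoped quotients, written with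
  \<open>n = l + 1\<close>.\<close>

definition oval_oval_wt :: "nat \<Rightarrow> real" where
  "oval_oval_wt n = oval_coeff (2/3) n / ((6 * real n - 7) * (6 * real n - 11))"

lemma oval_oval_wt_0: "oval_oval_wt 0 = 0"
  by (simp add: oval_oval_wt_def oval_coeff_def)

text \<open>The two factors of the divisor are both negative at index \<open>1\<close> and both
  positive from index \<open>2\<close> on.\<close>

lemma oval_oval_wt_pos: "oval_oval_wt (Suc l) > 0"
proof -
  have 2: "2 * Suc l - 1 = 2 * l + 1" by simp
  have "oval_coeff (2/3) (Suc l) > 0"
    unfolding oval_coeff_def 2 using sin_asin_coeff_23_pos[of l] cosint_pos[of "Suc l"] by simp
  moreover have "(6 * real (Suc l) - 7) * (6 * real (Suc l) - 11) > 0"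
    by (cases l) (auto intro: mult_pos_pos)
  ultimately show ?thesis by (simp add: oval_oval_wt_def)
qed

lemma oval_oval_wt_nonneg: "oval_oval_wt n \<ge> 0"
  by (cases n) (use oval_oval_wt_0 oval_oval_wt_pos less_imp_le in auto)

lemma six_neq: "6 * real n - 7 \<noteq> 0" "6 * real n - 11 \<noteq> 0"
proof -
  have "real (6 * n) \<noteq> real 7" "real (6 * n) \<noteq> real 11" unfolding of_nat_eq_iff by presburger+
  then show "6 * real n - 7 \<noteq> 0" "6 * real n - 11 \<noteq> 0" by auto
qed

lemma oval_coeff_23: "oval_coeff (2/3) n = oval_oval_wt n * ((6 * real n - 7) * (6 * real n - 11))"
  using six_neq[of n] by (simp add: oval_oval_wt_def)

lemma oval_coeff_43: "oval_coeff (4/3) n = oval_oval_wt n * (- 2 * (6 * real n - 5) * (6 * real n - 11))"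
proof (cases n)
  case 0 then show ?thesis by (simp add: oval_oval_wt_0 oval_coeff_def)
next
  case (Suc l)
  have 2: "2 * Suc l - 1 = 2 * l + 1" by simp
  define K where "K = 6 ^ n * cosint (2 * n) / sqrt 3"
  have e: "6 * real n - 7 = 6 * real l - 1" "6 * real n - 5 = 6 * real l + 1" using Suc by auto
  have "(6 * real n - 7) * oval_coeff (4/3) n = (6 * real l - 1) * sin_asin_coeff (4/3) (2 * l + 1) * K"
    unfolding e using Suc 2 by (simp add: oval_coeff_def K_def)
  also have "\<dots> = - 2 * (6 * real n - 5) * oval_coeff (2/3) n"
    unfolding sin_asin_coeff_ratio_43 e using Suc 2 by (simp add: oval_coeff_def K_def)
  also have "\<dots> = (6 * real n - 7) * (oval_oval_wt n * (- 2 * (6 * real n - 5) * (6 * real n - 11)))"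
    unfolding oval_coeff_23 by (simp add: mult_ac)
  finally show ?thesis using six_neq(1)[of n] mult_left_cancel by blast
qed

lemma oval_coeff_83: "oval_coeff (8/3) n = oval_oval_wt n * (- 4 * (6 * real n - 1) * (6 * real n - 7))"
proof (cases n)
  case 0 then show ?thesis by (simp add: oval_oval_wt_0 oval_coeff_def)
next
  case (Suc l)
  have 2: "2 * Suc l - 1 = 2 * l + 1" by simp
  define K where "K = 6 ^ n * cosint (2 * n) / sqrt 3"
  have e: "6 * real n - 11 = 6 * real l - 5" "6 * real n - 1 = 6 * real l + 5" using Suc by auto
  have "(6 * real n - 11) * oval_coeff (8/3) n = (6 * real l - 5) * sin_asin_coeff (8/3) (2 * l + 1) * K"
    unfolding e using Suc 2 by (simp add: oval_coeff_def K_def)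
  also have "\<dots> = - 4 * (6 * real n - 1) * oval_coeff (2/3) n"
    unfolding sin_asin_coeff_ratio_83 e using Suc 2 by (simp add: oval_coeff_def K_def)
  also have "\<dots> = (6 * real n - 11) * (oval_oval_wt n * (- 4 * (6 * real n - 1) * (6 * real n - 7)))"
    unfolding oval_coeff_23 by (simp add: mult_ac)
  finally show ?thesis using six_neq(2)[of n] mult_left_cancel by blast
qed

text \<open>The divisor in the weight is a nonzero integer, so the weight is dominated by
  \<open>oval_coeff (2/3)\<close>.\<close>

lemma pconv_oval_wt: "pconv (1/6) oval_oval_wt"
  unfolding pconv_def
proof (intro allI impI)
  fix x :: real assume x: "\<bar>x\<bar> < 1/6"
  have "summable (\<lambda>n. \<bar>oval_coeff (2/3) n * x ^ n\<bar>)"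
    unfolding abs_mult power_abs
  proof -
    have "summable (\<lambda>n. oval_coeff (2/3) n * \<bar>x\<bar> ^ n)" using pconvD[OF pconv_oval_coeff, of "\<bar>x\<bar>"] x by simp
    moreover have "oval_coeff (2/3) n \<ge> 0" for n
      unfolding oval_coeff_23 using oval_oval_wt_nonneg[of n] oval_oval_wt_0
      by (cases "n = 0"; cases "n = 1") (auto intro!: mult_nonneg_nonneg)
    ultimately show "summable (\<lambda>n. \<bar>oval_coeff (2/3) n\<bar> * \<bar>x\<bar> ^ n)" by simp
  qed
  then show "summable (\<lambda>n. oval_oval_wt n * x ^ n)"
  proof (rule summable_comparison_test'[where N = 0])
    fix n
    have "1 \<le> \<bar>(6 * real n - 7) * (6 * real n - 11)\<bar>"
    proof -
      have "6 * int n \<noteq> 7" "6 * int n \<noteq> 11" by presburger+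
      then have "(6 * int n - 7) * (6 * int n - 11) \<noteq> 0" by simp
      then have "1 \<le> \<bar>(6 * int n - 7) * (6 * int n - 11)\<bar>" by linarith
      then have "real_of_int 1 \<le> real_of_int \<bar>(6 * int n - 7) * (6 * int n - 11)\<bar>"
        by (simp only: of_int_le_iff)
      then show ?thesis by simp
    qed
    then have "\<bar>oval_oval_wt n\<bar> * 1 \<le> \<bar>oval_oval_wt n\<bar> * \<bar>(6 * real n - 7) * (6 * real n - 11)\<bar>"
      by (intro mult_left_mono) auto
    then have "\<bar>oval_oval_wt n\<bar> \<le> \<bar>oval_coeff (2/3) n\<bar>" unfolding oval_coeff_23 abs_mult by simp
    then show "norm (oval_oval_wt n * x ^ n) \<le> \<bar>oval_coeff (2/3) n * x ^ n\<bar>"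
      by (simp add: abs_mult mult_right_mono)
  qed
qed

section \<open>The integrals with \<open>j = 0, 1, 3\<close> as series with a common weight\<close>

lemma sin_pi_thirds:
  "sin (real 1 * pi / 3) = sqrt 3 / 2" "sin (real 2 * pi / 3) = sqrt 3 / 2"
  "sin (real 3 * pi / 3) = 0" "sin (real 4 * pi / 3) = - sqrt 3 / 2"
proof -
  show "sin (real 1 * pi / 3) = sqrt 3 / 2" by (simp add: sin_60)
  show "sin (real 2 * pi / 3) = sqrt 3 / 2" using sin_120 by (simp add: mult.commute)
  show "sin (real 3 * pi / 3) = 0" by simp
  have "real 4 * pi / 3 = pi / 3 + pi" by simp
  then show "sin (real 4 * pi / 3) = - sqrt 3 / 2" by (simp only: sin_periodic_pi sin_60)
qed

text \<open>Powers \<open>1\<close>, \<open>2\<close>, \<open>4\<close> belong to the integrals with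
  \<open>j = 0, 1, 3\<close>. The lists in the proof are the cosine coefficients of
  \<open>(cos \<phi> - 1/2)\<close> to these powers; the multiple \<open>3\<close> drops out and the
  multiple \<open>4\<close> enters with the opposite sign of the sine.\<close>

lemma oval_int_low:
  assumes h: "h \<in> L"
  shows "oval_int h (monom 1 1) = sqrt 3 / 2 * pser (oval_coeff (2/3)) h"
    and "oval_int h (monom 1 2) = sqrt 3 / 2 * (1 / 2 * pser (oval_coeff (4/3)) h - pser (oval_coeff (2/3)) h)"
    and "oval_int h (monom 1 4) = sqrt 3 / 2 *
      (- 1 / 8 * pser (oval_coeff (8/3)) h + 5 / 4 * pser (oval_coeff (4/3)) h - 2 * pser (oval_coeff (2/3)) h)"
proof -
  define G where "G = (\<lambda>m. sin (real m * pi / 3) * oval_sin (2 * real m / 3) h)"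
  have G: "G 0 = 0" "G (Suc 0) = sqrt 3 / 2 * pser (oval_coeff (2/3)) h" "G 2 = sqrt 3 / 2 * pser (oval_coeff (4/3)) h"
    "G 3 = 0" "G 4 = - sqrt 3 / 2 * pser (oval_coeff (8/3)) h"
    unfolding G_def One_nat_def[symmetric] sin_pi_thirds by (simp_all add: oval_sin_series[OF h])
  have c2: "cos (2 * \<phi>) = 2 * (cos \<phi>)\<^sup>2 - 1" for \<phi> :: real by (rule cos_double_cos)
  have c3: "cos (3 * \<phi>) = 4 * cos \<phi> ^ 3 - 3 * cos \<phi>" for \<phi> :: real by (rule cos_treble_cos)
  have c4: "cos (4 * \<phi>) = 8 * cos \<phi> ^ 4 - 8 * (cos \<phi>)\<^sup>2 + 1" for \<phi> :: real
    using c2[of "2 * \<phi>"] unfolding c2[of \<phi>] by (simp add: power2_eq_square power4_eq_xxxx algebra_simps)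
  have "oval_int h (monom 1 1) = (\<Sum>m\<le>1. [- 1 / 2, 1] ! m * sin (real m * pi / 3) * oval_sin (2 * real m / 3) h)"
    by (rule oval_int_trig[OF h]) (simp add: poly_monom)
  also have "\<dots> = (\<Sum>m\<in>{0,1}. [- 1 / 2, 1] ! m * G m)"
    unfolding G_def mult.assoc by (rule sum.cong) auto
  finally show "oval_int h (monom 1 1) = sqrt 3 / 2 * pser (oval_coeff (2/3)) h"
    using G by simp
  have "oval_int h (monom 1 2) = (\<Sum>m\<le>2. [3 / 4, - 1, 1 / 2] ! m * sin (real m * pi / 3) * oval_sin (2 * real m / 3) h)"
  proof (rule oval_int_trig[OF h])
    fix \<phi> :: real
    have "(cos \<phi> - 1 / 2)\<^sup>2 = 3 / 4 - cos \<phi> + 1 / 2 * cos (2 * \<phi>)"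
      unfolding c2 by (simp add: power2_eq_square algebra_simps)
    moreover have "{..2} = {0, 1, 2::nat}" by auto
    ultimately show "poly (monom 1 2) (cos \<phi> - 1 / 2) = (\<Sum>m\<le>2. [3 / 4, - 1, 1 / 2] ! m * cos (real m * \<phi>))"
      by (simp add: poly_monom)
  qed
  also have "\<dots> = (\<Sum>m\<in>{0,1,2}. [3 / 4, - 1, 1 / 2] ! m * G m)"
    unfolding G_def mult.assoc by (rule sum.cong) auto
  finally show "oval_int h (monom 1 2) = sqrt 3 / 2 * (1 / 2 * pser (oval_coeff (4/3)) h - pser (oval_coeff (2/3)) h)"
    using G by (simp add: algebra_simps)
  have I4: "{..4} = {0, 1, 2, 3, 4::nat}" by auto
  have "oval_int h (monom 1 4) = (\<Sum>m\<le>4. [19 / 16, - 2, 5 / 4, - 1 / 2, 1 / 8] ! m * sin (real m * pi / 3) * oval_sin (2 * real m / 3) h)"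
  proof (rule oval_int_trig[OF h])
    fix \<phi> :: real
    have "(cos \<phi> - 1 / 2) ^ 4 = 19 / 16 - 2 * cos \<phi> + 5 / 4 * cos (2 * \<phi>) - 1 / 2 * cos (3 * \<phi>) + 1 / 8 * cos (4 * \<phi>)"
      unfolding c2 c3 c4 by (simp add: power2_eq_square power3_eq_cube power4_eq_xxxx field_simps)
    then show "poly (monom 1 4) (cos \<phi> - 1 / 2) = (\<Sum>m\<le>4. [19 / 16, - 2, 5 / 4, - 1 / 2, 1 / 8] ! m * cos (real m * \<phi>))"
      unfolding I4 by (simp add: poly_monom)
  qed
  also have "\<dots> = (\<Sum>m\<in>{0,1,2,3,4}. [19 / 16, - 2, 5 / 4, - 1 / 2, 1 / 8] ! m * G m)"
    unfolding G_def mult.assoc I4 ..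
  finally show "oval_int h (monom 1 4) = sqrt 3 / 2 *
      (- 1 / 8 * pser (oval_coeff (8/3)) h + 5 / 4 * pser (oval_coeff (4/3)) h - 2 * pser (oval_coeff (2/3)) h)"
    using G by (simp add: algebra_simps)
qed

lemma pser_lin3:
  assumes "pconv R c" "pconv R d" "pconv R e" "\<bar>x\<bar> < R"
  shows "a * pser c x + b * pser d x + g * pser e x = pser (\<lambda>n. a * c n + b * d n + g * e n) x"
proof -
  note p = pconv_cmult[OF assms(1), of a] pconv_cmult[OF assms(2), of b] pconv_cmult[OF assms(3), of g]
  show ?thesis
    unfolding pser_add[OF pconv_add[OF p(1,2)] p(3) assms(4)] pser_add[OF p(1,2) assms(4)]
      pser_cmult[OF assms(1,4)] pser_cmult[OF assms(2,4)] pser_cmult[OF assms(3,4)] ..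
qed

text \<open>The factored form is what matters later: the polynomials for \<open>j = 3\<close> and
  \<open>j = 1\<close> share the factor \<open>n - 1\<close>, which is nonnegative at positive
  indices, while those for \<open>j = 1\<close> and \<open>j = 0\<close> share
  \<open>6 * n - 11\<close>, which is negative at \<open>n = 1\<close> only.\<close>

lemma I_low_combination:
  assumes h: "h \<in> L" "ccw_oval h (\<gamma> h)"
  shows "a * I_mono \<gamma> 0 h + b * I_mono \<gamma> 1 h + c * I_mono \<gamma> 3 h = pser (\<lambda>n. oval_oval_wt n * (sqrt 3 / 2 *
     (- a * ((6 * real n - 7) * (6 * real n - 11)) + 6 * b * ((real n - 1) * (6 * real n - 11)) +
      36 * c * ((real n - 1) * (real n - 2))))) h"
proof -
  have x: "\<bar>h\<bar> < 1/6" using h by (auto simp: L_def)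
  have "Suc 0 = 1" "Suc 1 = 2" "Suc 3 = 4" by auto
  note I = I_mono_eq[where \<gamma> = \<gamma> and j = 0, OF h] I_mono_eq[where \<gamma> = \<gamma> and j = 1, OF h]
    I_mono_eq[where \<gamma> = \<gamma> and j = 3, OF h]
  have "a * I_mono \<gamma> 0 h + b * I_mono \<gamma> 1 h + c * I_mono \<gamma> 3 h =
     (sqrt 3 / 2 * (- a + b / 2 + c / 2)) * pser (oval_coeff (2/3)) h +
     (sqrt 3 / 2 * (- b / 4 - 5 * c / 16)) * pser (oval_coeff (4/3)) h +
     (sqrt 3 / 2 * (c / 32)) * pser (oval_coeff (8/3)) h"
    unfolding I \<open>Suc 0 = 1\<close> \<open>Suc 1 = 2\<close> \<open>Suc 3 = 4\<close> oval_int_low[OF h(1)] by (simp add: field_simps)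
  also have "\<dots> = pser (\<lambda>n. (sqrt 3 / 2 * (- a + b / 2 + c / 2)) * oval_coeff (2/3) n +
     (sqrt 3 / 2 * (- b / 4 - 5 * c / 16)) * oval_coeff (4/3) n + (sqrt 3 / 2 * (c / 32)) * oval_coeff (8/3) n) h"
    by (rule pser_lin3[OF pconv_oval_coeff pconv_oval_coeff pconv_oval_coeff x])
  also have "(\<lambda>n. (sqrt 3 / 2 * (- a + b / 2 + c / 2)) * oval_coeff (2/3) n +
     (sqrt 3 / 2 * (- b / 4 - 5 * c / 16)) * oval_coeff (4/3) n + (sqrt 3 / 2 * (c / 32)) * oval_coeff (8/3) n)
    = (\<lambda>n. oval_oval_wt n * (sqrt 3 / 2 *
     (- a * ((6 * real n - 7) * (6 * real n - 11)) + 6 * b * ((real n - 1) * (6 * real n - 11)) +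
      36 * c * ((real n - 1) * (real n - 2)))))"
  proof
    fix n
    define t x s where "t = oval_oval_wt n" and "x = real n" and "s = sqrt 3 / 2"
    show "(sqrt 3 / 2 * (- a + b / 2 + c / 2)) * oval_coeff (2/3) n +
     (sqrt 3 / 2 * (- b / 4 - 5 * c / 16)) * oval_coeff (4/3) n + (sqrt 3 / 2 * (c / 32)) * oval_coeff (8/3) n
      = oval_oval_wt n * (sqrt 3 / 2 *
     (- a * ((6 * real n - 7) * (6 * real n - 11)) + 6 * b * ((real n - 1) * (6 * real n - 11)) +
      36 * c * ((real n - 1) * (real n - 2))))"
      unfolding oval_coeff_23 oval_coeff_43 oval_coeff_83 t_def[symmetric] x_def[symmetric] s_def[symmetric]
      by algebra
  qed
  finally show ?thesis .
qed

text \<open>A factor \<open>u\<close> that is nonnegative at the positive integers can be moved into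
  the weight, so only the degree of the cofactor \<open>p\<close> counts. Since \<open>u\<close> has
  finitely many roots, infinitely many weights stay positive.\<close>

lemma zeros_le_weighted:
  assumes "\<And>x. x \<in> {0<..<1/6} \<Longrightarrow> f x = pser (\<lambda>n. oval_oval_wt n * poly (u * p) (real n)) x"
    and u: "\<And>n. n > 0 \<Longrightarrow> poly u (real n) \<ge> 0" "u \<noteq> 0" and p: "p \<noteq> 0" "degree p \<le> k"
  shows "zeros_le f {0<..<1/6} k"
proof -
  define w where "w = (\<lambda>n. oval_oval_wt n * poly u (real n))"
  have "zeros_le (pser (\<lambda>n. w n * poly p (real n))) {0<..<1/6} (degree p)"
  proof (rule zeros_le_pser_poly[OF p(1)])
    show "w n \<ge> 0" for n unfolding w_def
      using u(1)[of n] oval_oval_wt_nonneg[of n] oval_oval_wt_0 by (cases "n = 0") auto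
    show "pconv (1/6) w" unfolding w_def by (rule pconv_poly[OF pconv_oval_wt])
    have "finite {x. poly u x = 0}" by (rule poly_roots_finite[OF u(2)])
    then have "finite (real -` {x. poly u x = 0})" by (rule finite_vimageI) (auto simp: inj_on_def)
    then have "finite (insert 0 (real -` {x. poly u x = 0}))" by simp
    then have "infinite (- insert 0 (real -` {x. poly u x = 0}))" by (simp add: infinite_UNIV_nat finite_compl)
    moreover have "- insert 0 (real -` {x. poly u x = 0}) \<subseteq> {n. w n > 0}"
    proof
      fix n assume n: "n \<in> - insert 0 (real -` {x. poly u x = 0})"
      then obtain l where l: "n = Suc l" by (cases n) auto
      have "poly u (real n) \<ge> 0" by (rule u(1)) (simp add: l)
      moreover have "poly u (real n) \<noteq> 0" using n by simp
      ultimately have "poly u (real n) > 0" by linarith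
      then show "n \<in> {n. w n > 0}" using oval_oval_wt_pos[of l] l by (simp add: w_def)
    qed
    ultimately show "infinite {n. w n > 0}" using finite_subset by blast
  qed
  then have "zeros_le (pser (\<lambda>n. oval_oval_wt n * poly (u * p) (real n))) {0<..<1/6} k"
    using p(2) zeros_le_mono by (fastforce simp: w_def mult.assoc)
  with open_greaterThanLessThan order_refl assms(1)[symmetric] show ?thesis by (rule zeros_le_cong)
qed

lemma L_eq: "L = {0<..<1/6}" "open L"
  by (simp_all add: L_def)

text \<open>The common factors \<open>(n - 1) * (n - 2)\<close>, \<open>n - 1\<close> and
  \<open>1\<close> of the successive subfamilies go into the weight and leave cofactors of degree at
  most \<open>0\<close>, \<open>1\<close> and \<open>2\<close>, the bounds required of an ECT system
  in this order.\<close>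

lemma zeros_le_I310:
  assumes \<gamma>: "\<forall>h\<in>L. ccw_oval h (\<gamma> h)"
  shows "a \<noteq> 0 \<Longrightarrow> zeros_le (\<lambda>h. a * I_mono \<gamma> 3 h) L 0"
    and "a \<noteq> 0 \<or> b \<noteq> 0 \<Longrightarrow> zeros_le (\<lambda>h. a * I_mono \<gamma> 3 h + b * I_mono \<gamma> 1 h) L 1"
    and "a \<noteq> 0 \<or> b \<noteq> 0 \<or> c \<noteq> 0 \<Longrightarrow>
      zeros_le (\<lambda>h. a * I_mono \<gamma> 3 h + b * I_mono \<gamma> 1 h + c * I_mono \<gamma> 0 h) L 2"
proof -
  have e: "a * I_mono \<gamma> 3 h + b * I_mono \<gamma> 1 h + c * I_mono \<gamma> 0 h = pser (\<lambda>n. oval_oval_wt n * (sqrt 3 / 2 *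
     (- c * ((6 * real n - 7) * (6 * real n - 11)) + 6 * b * ((real n - 1) * (6 * real n - 11)) +
      36 * a * ((real n - 1) * (real n - 2))))) h" if "h \<in> L" for a b c h
    using I_low_combination[of h \<gamma> c b a] that \<gamma> by (simp add: algebra_simps)
  show "zeros_le (\<lambda>h. a * I_mono \<gamma> 3 h) L 0" if "a \<noteq> 0"
    unfolding L_eq
  proof (rule zeros_le_weighted[where u = "[:-1, 1:] * [:-2, 1:]" and p = "[:sqrt 3 / 2 * 36 * a:]"])
    fix x :: real assume "x \<in> {0<..<1/6}"
    then show "a * I_mono \<gamma> 3 x = pser (\<lambda>n. oval_oval_wt n * poly ([:-1, 1:] * [:-2, 1:] * [:sqrt 3 / 2 * 36 * a:]) (real n)) x"
      using e[of x a 0 0] by (simp add: L_def algebra_simps)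
  next
    fix n :: nat assume "n > 0"
    then have "0 \<le> (real n - 1) * (real n - 2)"
      by (cases "n = 1") (auto intro!: mult_nonneg_nonneg)
    then show "0 \<le> poly ([:-1, 1:] * [:-2, 1:]) (real n)" by (simp add: algebra_simps)
  qed (use that in auto)
  show "zeros_le (\<lambda>h. a * I_mono \<gamma> 3 h + b * I_mono \<gamma> 1 h) L 1" if "a \<noteq> 0 \<or> b \<noteq> 0"
    unfolding L_eq
  proof (rule zeros_le_weighted[where u = "[:-1, 1:]" and
        p = "[:sqrt 3 / 2 * (- 66 * b - 72 * a), sqrt 3 / 2 * (36 * b + 36 * a):]"])
    fix x :: real assume "x \<in> {0<..<1/6}"
    then show "a * I_mono \<gamma> 3 x + b * I_mono \<gamma> 1 x = pser (\<lambda>n. oval_oval_wt n * poly ([:-1, 1:] *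
        [:sqrt 3 / 2 * (- 66 * b - 72 * a), sqrt 3 / 2 * (36 * b + 36 * a):]) (real n)) x"
      using e[of x a b 0] by (simp add: L_def algebra_simps)
  qed (use that in auto)
  show "zeros_le (\<lambda>h. a * I_mono \<gamma> 3 h + b * I_mono \<gamma> 1 h + c * I_mono \<gamma> 0 h) L 2"
    if nz: "a \<noteq> 0 \<or> b \<noteq> 0 \<or> c \<noteq> 0"
    unfolding L_eq
  proof (rule zeros_le_weighted[where u = 1 and p = "smult (sqrt 3 / 2) (smult (- c) ([:-7, 6:] * [:-11, 6:])
        + smult (6 * b) ([:-1, 1:] * [:-11, 6:]) + smult (36 * a) ([:-1, 1:] * [:-2, 1:]))"])
    fix x :: real assume "x \<in> {0<..<1/6}"
    then show "a * I_mono \<gamma> 3 x + b * I_mono \<gamma> 1 x + c * I_mono \<gamma> 0 x = pser (\<lambda>n. oval_oval_wt n * poly (1 *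
        smult (sqrt 3 / 2) (smult (- c) ([:-7, 6:] * [:-11, 6:])
        + smult (6 * b) ([:-1, 1:] * [:-11, 6:]) + smult (36 * a) ([:-1, 1:] * [:-2, 1:]))) (real n)) x"
      using e[of x a b c] by (simp add: L_def algebra_simps)
  next
    define q where "q = smult (- c) ([:-7, 6:] * [:-11, 6:])
        + smult (6 * b) ([:-1, 1:] * [:-11, 6:]) + smult (36 * a) ([:-1, 1:] * [:-2, 1:])"
    \<comment> \<open>At \<open>1\<close> only the term with \<open>c\<close> survives; then at
      \<open>2\<close> only the one with \<open>b\<close>; then \<open>3\<close> detects
      \<open>a\<close>.\<close>
    have "q \<noteq> 0"
    proof
      assume "q = 0"
      then have q: "poly q 1 = 0" "poly q 2 = 0" "poly q 3 = 0" by auto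
      have "c = 0" using q(1) by (simp add: q_def)
      moreover from this have "b = 0" using q(2) by (simp add: q_def)
      ultimately show False using q(3) nz by (simp add: q_def)
    qed
    then show "smult (sqrt 3 / 2) (smult (- c) ([:-7, 6:] * [:-11, 6:])
        + smult (6 * b) ([:-1, 1:] * [:-11, 6:]) + smult (36 * a) ([:-1, 1:] * [:-2, 1:])) \<noteq> 0"
      unfolding q_def[symmetric] by simp
    show "degree (smult (sqrt 3 / 2) (smult (- c) ([:-7, 6:] * [:-11, 6:])
        + smult (6 * b) ([:-1, 1:] * [:-11, 6:]) + smult (36 * a) ([:-1, 1:] * [:-2, 1:]))) \<le> 2"
      by (intro order.trans[OF degree_smult_le] degree_add_le) simp_all
  qed auto
qed

text \<open>The coefficients of this series have mixed signs, so positivity is read off from the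
  integrand: \<open>4/3\<close> times an arcsine stays within \<open>(- pi, pi)\<close>, hence its
  sine has the sign of \<open>y\<close>.\<close>

lemma oval_sin_43_nonneg:
  assumes h: "h \<in> L"
  shows "oval_sin (4/3) h \<ge> 0"
  unfolding oval_sin_def
proof (rule integral_nonneg)
  show "(\<lambda>\<theta>. sin (4 / 3 * arcsin (sqrt 3 * (sqrt (2 * h) * cos \<theta>))) * (sqrt (2 * h) * cos \<theta>))
      integrable_on {0..2 * pi}"
    by (intro integrable_continuous_real continuous_intros arcsin_cont[OF h])
  fix \<theta>
  define y where "y = sqrt (2 * h) * cos \<theta>"
  have b: "\<bar>sqrt 3 * y\<bar> < 1" unfolding y_def by (intro sqrt3_bound radius_bound h)
  then have v: "- (pi/2) < arcsin (sqrt 3 * y)" "arcsin (sqrt 3 * y) < pi / 2"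
    using arcsin_lt_bounded[of "sqrt 3 * y"] by (auto simp: abs_less_iff)
  show "0 \<le> sin (4 / 3 * arcsin (sqrt 3 * (sqrt (2 * h) * cos \<theta>))) * (sqrt (2 * h) * cos \<theta>)"
    unfolding y_def[symmetric]
  proof (cases "y \<ge> 0")
    case True
    then have "arcsin 0 \<le> arcsin (sqrt 3 * y)" using b by (intro arcsin_le_arcsin) auto
    then have "sin (4 / 3 * arcsin (sqrt 3 * y)) \<ge> 0" using v pi_gt_zero by (intro sin_ge_zero) auto
    then show "0 \<le> sin (4 / 3 * arcsin (sqrt 3 * y)) * y" using True by simp
  next
    case False
    then have "sqrt 3 * y < 0" by (simp add: mult_pos_neg)
    then have "arcsin (sqrt 3 * y) \<le> arcsin 0" using b by (intro arcsin_le_arcsin) auto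
    then have "sin (- (4 / 3 * arcsin (sqrt 3 * y))) \<ge> 0" using v pi_gt_zero by (intro sin_ge_zero) auto
    then show "0 \<le> sin (4 / 3 * arcsin (sqrt 3 * y)) * y" using False by (simp add: mult_nonpos_nonpos)
  qed
qed

lemma pser_oval_coeff_23_pos:
  assumes "h \<in> L"
  shows "pser (oval_coeff (2/3)) h > 0"
proof (rule pser_pos[where R = "1/6" and m = 1])
  show "oval_coeff (2/3) n \<ge> 0" for n
    unfolding oval_coeff_23 using oval_oval_wt_nonneg[of n] oval_oval_wt_0
    by (cases "n = 0"; cases "n = 1") (auto intro!: mult_nonneg_nonneg)
  show "oval_coeff (2/3) 1 > 0" unfolding oval_coeff_23 using oval_oval_wt_pos[of 0] by simp
qed (use assms pconv_oval_coeff in \<open>auto simp: L_def\<close>)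

text \<open>The operator \<open>h * f' - f\<close> multiplies the coefficient of \<open>h^n\<close>
  by \<open>n - 1\<close>. It thereby removes the only positive coefficient of the series for
  \<open>4/3\<close>, that of \<open>h\<close>, so the result is negative, while for
  \<open>2/3\<close> it is positive. Written with these two expressions, \<open>h\<close> times the
  Wronskian has a definite sign.\<close>

lemma Wronskian_neg:
  assumes h: "h \<in> L"
  shows "pser (oval_coeff (2/3)) h * deriv (pser (oval_coeff (4/3))) h - deriv (pser (oval_coeff (2/3))) h * pser (oval_coeff (4/3)) h < 0"
proof -
  define u v where "u = pser (oval_coeff (2/3))" and "v = pser (oval_coeff (4/3))"
  have x: "0 < h" "h < 1/6" "\<bar>h\<bar> < 1/6" using h by (auto simp: L_def)
  have u: "u h > 0" unfolding u_def by (rule pser_oval_coeff_23_pos[OF h])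
  have v: "v h \<ge> 0" using oval_sin_43_nonneg[OF h] oval_sin_series[OF h, of "4/3"] by (simp add: v_def)
  have "pser (\<lambda>n. oval_coeff (2/3) n * (real n - 1)) h > 0"
  proof (rule pser_pos[where R = "1/6" and m = 2])
    show "pconv (1/6) (\<lambda>n. oval_coeff (2/3) n * (real n - 1))"
      using pconv_poly[OF pconv_oval_coeff, of "2/3" "[:-1, 1:]"] by simp
    show "oval_coeff (2/3) n * (real n - 1) \<ge> 0" for n
      unfolding oval_coeff_23 using oval_oval_wt_nonneg[of n] oval_oval_wt_0
      by (cases "n = 0"; cases "n = 1") (auto intro!: mult_nonneg_nonneg)
    show "oval_coeff (2/3) 2 * (real 2 - 1) > 0"
      unfolding oval_coeff_23 using oval_oval_wt_pos[of 1] by (simp add: numeral_2_eq_2)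
  qed (use x in auto)
  then have 1: "h * deriv u h - u h > 0" using pser_Euler[OF pconv_oval_coeff x(3), of "2/3" 1] by (simp add: u_def)
  have cq: "pconv (1/6) (\<lambda>n. oval_coeff (4/3) n * (real n - 1))"
    using pconv_poly[OF pconv_oval_coeff, of "4/3" "[:-1, 1:]"] by simp
  have "pser (\<lambda>n. (- 1) * (oval_coeff (4/3) n * (real n - 1))) h > 0"
  proof (rule pser_pos[where R = "1/6" and m = 2])
    show "pconv (1/6) (\<lambda>n. (- 1) * (oval_coeff (4/3) n * (real n - 1)))" by (rule pconv_cmult[OF cq])
    have e: "(- 1) * (oval_coeff (4/3) n * (real n - 1)) = oval_oval_wt n * (2 * (real n - 1) * (6 * real n - 5) * (6 * real n - 11))" for n
      unfolding oval_coeff_43 by (simp add: algebra_simps)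
    show "(- 1) * (oval_coeff (4/3) n * (real n - 1)) \<ge> 0" for n
      unfolding e using oval_oval_wt_nonneg[of n] oval_oval_wt_0
      by (cases "n = 0"; cases "n = 1") (auto intro!: mult_nonneg_nonneg)
    show "(- 1) * (oval_coeff (4/3) 2 * (real 2 - 1)) > 0"
      unfolding e using oval_oval_wt_pos[of 1] by (simp add: numeral_2_eq_2)
  qed (use x in auto)
  then have 2: "h * deriv v h - v h < 0"
    using pser_Euler[OF pconv_oval_coeff x(3), of "4/3" 1] pser_cmult[OF cq x(3), of "- 1"] by (simp add: v_def)
  have "h * (u h * deriv v h - deriv u h * v h) = u h * (h * deriv v h - v h) - (h * deriv u h - u h) * v h"
    by (simp add: algebra_simps)
  also have "\<dots> < 0"
    using mult_pos_neg[OF u 2] mult_nonneg_nonneg[OF less_imp_le[OF 1] v] by linarith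
  finally show ?thesis using x(1) by (simp add: u_def v_def mult_less_0_iff)
qed

text \<open>The common factor \<open>6 * n - 11\<close> of these two integrals changes sign at the
  integers and cannot be moved into the weight; Descartes' rule would allow one zero too many. The
  sign of the Wronskian gives the sharp bound.\<close>

lemma zeros_le_I01:
  assumes \<gamma>: "\<forall>h\<in>L. ccw_oval h (\<gamma> h)"
  shows "a \<noteq> 0 \<Longrightarrow> zeros_le (\<lambda>h. a * I_mono \<gamma> 0 h) L 0"
    and "a \<noteq> 0 \<or> b \<noteq> 0 \<Longrightarrow> zeros_le (\<lambda>h. a * I_mono \<gamma> 0 h + b * I_mono \<gamma> 1 h) L 1"
proof -
  define u v where "u = pser (oval_coeff (2/3))" and "v = pser (oval_coeff (4/3))"
  have e: "a * I_mono \<gamma> 0 h + b * I_mono \<gamma> 1 h = sqrt 3 / 2 * (- a + b / 2) * u h + sqrt 3 / 2 * (- b / 4) * v h"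
    if "h \<in> L" for h a b
  proof -
    have g: "ccw_oval h (\<gamma> h)" using \<gamma> that by auto
    have "Suc 0 = 1" "Suc 1 = 2" by auto
    note I = I_mono_eq[where \<gamma> = \<gamma> and j = 0, OF that g] I_mono_eq[where \<gamma> = \<gamma> and j = 1, OF that g]
    show ?thesis
      unfolding I \<open>Suc 0 = 1\<close> \<open>Suc 1 = 2\<close> oval_int_low[OF that] u_def v_def by (simp add: field_simps)
  qed
  have upos: "u h > 0" if "h \<in> L" for h unfolding u_def by (rule pser_oval_coeff_23_pos[OF that])
  show z0: "zeros_le (\<lambda>h. a * I_mono \<gamma> 0 h) L 0" if "a \<noteq> 0" for a
    by (rule zeros_le_0I) (use e[of _ a 0] upos that in force)
  show "zeros_le (\<lambda>h. a * I_mono \<gamma> 0 h + b * I_mono \<gamma> 1 h) L 1" if nz: "a \<noteq> 0 \<or> b \<noteq> 0"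
  proof (cases "b = 0")
    case True
    then show ?thesis using z0[of a] nz zeros_le_mono[of _ L 0 1 L] by simp
  next
    case False
    define A B where "A = sqrt 3 / 2 * (- a + b / 2)" and "B = sqrt 3 / 2 * (- b / 4)"
    define f where "f = (\<lambda>h. A * u h + B * v h)"
    have B: "B \<noteq> 0" using False by (simp add: B_def)
    have sm: "smooth_on {0<..<1/6} u" "smooth_on {0<..<1/6} v"
      unfolding u_def v_def by (rule smooth_on_subset[OF smooth_on_pser[OF pconv_oval_coeff]]; auto)+
    have smf: "smooth_on {0<..<1/6} f"
      unfolding f_def by (intro smooth_on_add smooth_on_mult sm) auto
    have "zeros_le f {0<..<1/6} (Suc 0)"
    proof (rule zeros_le_Wronskian[OF smf sm(1)])
      show "u x \<noteq> 0" if "x \<in> {0<..<1/6}" for x using upos[of x] that by (simp add: L_def)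
      show "zeros_le (\<lambda>x. u x * deriv f x - deriv u x * f x) {0<..<1/6} 0"
      proof (rule zeros_le_0I)
        fix x :: real assume x: "x \<in> {0<..<1/6}"
        have "deriv f x = A * deriv u x + B * deriv v x"
          unfolding f_def by (intro DERIV_imp_deriv DERIV_add DERIV_cmult smooth_on_DERIV[OF sm(1) x] smooth_on_DERIV[OF sm(2) x])
        then have "u x * deriv f x - deriv u x * f x = B * (u x * deriv v x - deriv u x * v x)"
          by (simp add: f_def algebra_simps)
        moreover have "u x * deriv v x - deriv u x * v x < 0"
          unfolding u_def v_def by (rule Wronskian_neg) (use x in \<open>simp add: L_def\<close>)
        ultimately show "u x * deriv f x - deriv u x * f x \<noteq> 0" using B by simp
      qed
    qed
    then have zf: "zeros_le f L 1" by (simp add: L_eq)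
    have fe: "f h = a * I_mono \<gamma> 0 h + b * I_mono \<gamma> 1 h" if "h \<in> L" for h
      unfolding e[OF that] f_def A_def B_def ..
    show ?thesis by (rule zeros_le_cong[OF L_eq(2) order_refl fe zf])
  qed
qed

subsection \<open>Reduction of polynomials and the main theorem\<close>


lemma idx_0: "idx 0 = {0}"
  by (auto simp: idx_def)

lemma idx_Suc: "idx (Suc n) = (if Suc n mod 3 = 2 then idx n else insert (Suc n) (idx n))"
  unfolding idx_def by (auto simp: le_Suc_eq)

lemma card_idx: "card (idx n) = n + 1 - (n + 1) div 3"
proof (induction n)
  case (Suc n)
  have "Suc n \<notin> idx n" by (simp add: idx_def)
  then have "card (idx (Suc n)) = (if Suc n mod 3 = 2 then card (idx n) else Suc (card (idx n)))"
    by (simp add: idx_Suc finite_idx)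
  moreover have "(Suc n + 1) div 3 = (if Suc n mod 3 = 2 then Suc ((n + 1) div 3) else (n + 1) div 3)"
    by (simp add: div_Suc mod_Suc)
  moreover have "(n + 1) div 3 \<le> n + 1" by (rule div_le_dividend)
  ultimately show ?case unfolding Suc by (auto simp: Suc_diff_le)
qed (simp add: idx_0)

lemma N_eq: "N n = n - (n + 1) div 3"
  unfolding N_def card_idx by simp

lemma card_idx_N: "card (idx n) = Suc (N n)"
proof -
  have "(n + 1) div 3 \<le> n" by (simp add: div_le_dividend less_mult_imp_div_less less_Suc_eq_le[symmetric])
  then show ?thesis unfolding N_eq card_idx by simp
qed

lemma sorted_idx_Suc:
  assumes "Suc n \<in> idx (Suc n)"
  shows "sorted_list_of_set (idx (Suc n)) = sorted_list_of_set (idx n) @ [Suc n]"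
proof (rule strict_sorted_equal)
  show "sorted_wrt (<) (sorted_list_of_set (idx n) @ [Suc n])"
    using finite_idx[of n] by (auto simp: sorted_wrt_append idx_def less_Suc_eq_le)
  have "idx (Suc n) = insert (Suc n) (idx n)"
    using assms idx_Suc[of n] by (auto simp: idx_def)
  then show "set (sorted_list_of_set (idx (Suc n))) = set (sorted_list_of_set (idx n) @ [Suc n])"
    by (simp only: set_append set_sorted_list_of_set finite_idx finite_insert) simp
qed simp

text \<open>The ECT condition runs over the initial segments of the ordered family. Each segment is
  again a full index set \<open>idx n'\<close>, and its bound \<open>N n'\<close> is exactly the
  \<open>k\<close> that is asked for.\<close>

lemma take_sorted_idx:
  assumes "k \<le> N n"
  shows "\<exists>n'\<le>n. set (take (Suc k) (sorted_list_of_set (idx n))) = idx n' \<and> N n' = k"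
  using assms
proof (induction n arbitrary: k)
  case 0
  then have "k = 0" by (simp add: N_eq)
  then show ?case by (simp add: idx_0 N_eq)
next
  case (Suc n)
  define xs where "xs = sorted_list_of_set (idx n)"
  have len: "length xs = Suc (N n)" by (simp add: xs_def card_idx_N)
  show ?case
  proof (cases "k = N (Suc n)")
    case True
    have "length (sorted_list_of_set (idx (Suc n))) = Suc k" by (simp add: card_idx_N True)
    then show ?thesis using True by (intro exI[of _ "Suc n"]) (simp add: finite_idx)
  next
    case False
    show ?thesis
    proof (cases "Suc n mod 3 = 2")
      case True
      then have "idx (Suc n) = idx n" by (simp add: idx_Suc)
      then show ?thesis using Suc by (metis N_def le_SucI)
    next
      case m: False
      then have "Suc n \<in> idx (Suc n)" by (simp add: idx_def)
      note s = sorted_idx_Suc[OF this]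
      have "card (idx (Suc n)) = Suc (card (idx n))"
        using m finite_idx[of n] by (simp add: idx_Suc) (simp add: idx_def)
      then have "k \<le> N n" using False Suc.prems card_idx_N[of n] card_idx_N[of "Suc n"] by linarith
      from Suc.IH[OF this] show ?thesis
        using len \<open>k \<le> N n\<close> unfolding s xs_def by (auto intro: le_SucI)
    qed
  qed
qed

lemma ECT_systemI:
  assumes "\<And>u. u \<in> set us \<Longrightarrow> smooth_on J u"
    and "\<And>k a. k < length us \<Longrightarrow> \<exists>i\<le>k. a i \<noteq> 0 \<Longrightarrow> zeros_le (\<lambda>t. \<Sum>i\<le>k. a i * (us ! i) t) J k"
  shows "ECT_system us J"
  unfolding ECT_system_def Let_def
proof (intro conjI allI impI)
  show "\<forall>u\<in>set us. \<forall>t\<in>J. smooth_at u t" using assms(1) by (auto simp: smooth_on_def)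
  fix k a assume "k < length us" "\<exists>i\<le>k. a i \<noteq> (0 :: real)"
  then show "count_mult (\<lambda>t. \<Sum>i\<le>k. a i * (us ! i) t)
      (isolated_zeros (\<lambda>t. \<Sum>i\<le>k. a i * (us ! i) t) J) \<le> enat k"
    by (intro count_mult_le[OF assms(2)]) (auto simp: isolated_zeros_def)
qed

lemma smooth_I_mono:
  assumes \<gamma>: "\<forall>h\<in>L. ccw_oval h (\<gamma> h)"
  shows "smooth_on L (I_mono \<gamma> j)"
proof -
  obtain c where c: "\<And>\<phi>. (cos \<phi> - 1 / 2) ^ Suc j = (\<Sum>m\<le>Suc j. c m * cos (real m * \<phi>))"
    using cos_power_coeffs by (metis order_refl)
  define b where "b = (\<lambda>m. - c m * sin (real m * pi / 3) / real (Suc j))"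
  \<comment> \<open>The index \<open>0\<close> is left out because the series is available only for
    \<open>a \<noteq> 0\<close>; its sine weight is \<open>0\<close>.\<close>
  define M where "M = {1..Suc j}"
  have e: "pser (\<lambda>k. \<Sum>m\<in>M. b m * oval_coeff (2 * real m / 3) k) h = I_mono \<gamma> j h" if h: "h \<in> L" for h
  proof -
    have "I_mono \<gamma> j h = - oval_int h (monom 1 (Suc j)) / real (Suc j)"
      using \<gamma> h by (intro I_mono_eq) auto
    also have "oval_int h (monom 1 (Suc j)) = (\<Sum>m\<le>Suc j. c m * sin (real m * pi / 3) * oval_sin (2 * real m / 3) h)"
      by (rule oval_int_trig[OF h]) (simp only: poly_monom c mult_1)
    also have "\<dots> = (\<Sum>m\<in>M. c m * sin (real m * pi / 3) * oval_sin (2 * real m / 3) h)"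
    proof (rule sum.mono_neutral_right)
      show "\<forall>m\<in>{..Suc j} - M. c m * sin (real m * pi / 3) * oval_sin (2 * real m / 3) h = 0"
      proof
        fix m assume "m \<in> {..Suc j} - M"
        then have "m = 0" by (auto simp: M_def)
        then show "c m * sin (real m * pi / 3) * oval_sin (2 * real m / 3) h = 0" by simp
      qed
    qed (auto simp: M_def)
    also have "\<dots> = (\<Sum>m\<in>M. c m * sin (real m * pi / 3) * pser (oval_coeff (2 * real m / 3)) h)"
      by (intro sum.cong refl) (auto simp: oval_sin_series[OF h] M_def)
    also have "- (\<Sum>m\<in>M. c m * sin (real m * pi / 3) * pser (oval_coeff (2 * real m / 3)) h) / real (Suc j)
        = (\<Sum>m\<in>M. b m * pser (oval_coeff (2 * real m / 3)) h)"
      unfolding b_def sum_negf[symmetric] sum_divide_distrib by (intro sum.cong refl) simp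
    also have "\<dots> = pser (\<lambda>k. \<Sum>m\<in>M. b m * oval_coeff (2 * real m / 3) k) h"
      by (rule pser_sum(2)[where R = "1/6", symmetric]) (use h pconv_oval_coeff in \<open>auto simp: L_def M_def\<close>)
    finally show ?thesis ..
  qed
  have "pconv (1/6) (\<lambda>k. \<Sum>m\<in>M. b m * oval_coeff (2 * real m / 3) k)"
    by (rule pser_sum(1)) (auto simp: M_def pconv_oval_coeff)
  then have "smooth_on L (pser (\<lambda>k. \<Sum>m\<in>M. b m * oval_coeff (2 * real m / 3) k))"
    by (rule smooth_on_subset[OF smooth_on_pser]) (auto simp: L_def)
  then show ?thesis by (rule smooth_on_cong[OF L_eq(2), rotated]) (rule e)
qed

lemma ECT_idx:
  assumes \<gamma>: "\<forall>h\<in>L. ccw_oval h (\<gamma> h)" and J: "J \<subseteq> L"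
    and z: "\<And>n' a. n' \<le> n \<Longrightarrow> \<exists>j\<in>idx n'. a j \<noteq> 0 \<Longrightarrow>
      zeros_le (\<lambda>h. \<Sum>j\<in>idx n'. a j * I_mono \<gamma> j h) J (N n')"
  shows "ECT_system (map (I_mono \<gamma>) (sorted_list_of_set (idx n))) J"
proof (rule ECT_systemI)
  fix u assume "u \<in> set (map (I_mono \<gamma>) (sorted_list_of_set (idx n)))"
  then show "smooth_on J u" using smooth_I_mono[OF \<gamma>] J by (auto intro: smooth_on_subset)
next
  define xs where "xs = sorted_list_of_set (idx n)"
  have xs: "distinct xs" "length xs = Suc (N n)" by (simp_all add: xs_def card_idx_N)
  fix k and a :: "nat \<Rightarrow> real"
  assume "k < length (map (I_mono \<gamma>) (sorted_list_of_set (idx n)))" and a: "\<exists>i\<le>k. a i \<noteq> 0"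
  then have k: "k < length xs" by (simp add: xs_def)
  then have "k \<le> N n" using xs by simp
  then obtain n' where n': "n' \<le> n" "set (take (Suc k) xs) = idx n'" "N n' = k"
    using take_sorted_idx[of k n] by (auto simp: xs_def)
  have inj: "inj_on ((!) xs) {..k}" using xs(1) k by (auto simp: inj_on_def nth_eq_iff_index_eq)
  have im: "(!) xs ` {..k} = idx n'"
    unfolding n'(2)[symmetric] using k nth_image[of "Suc k" xs] by (simp add: lessThan_Suc_atMost atLeast0LessThan)
  have bij: "bij_betw ((!) xs) {..k} (idx n')" using inj im by (simp add: bij_betw_def)
  \<comment> \<open>Coefficients given by position in the list are carried over to the indices
    \<open>j\<close>.\<close>
  define b where "b = (\<lambda>j. a (inv_into {..k} ((!) xs) j))"
  have b: "b (xs ! i) = a i" if "i \<le> k" for i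
    unfolding b_def using inv_into_f_f[OF inj] that by simp
  have "\<exists>j\<in>idx n'. b j \<noteq> 0" using a b im by force
  then have z': "zeros_le (\<lambda>h. \<Sum>j\<in>idx n'. b j * I_mono \<gamma> j h) J k" using z[OF n'(1)] n'(3) by simp
  have "(\<Sum>j\<in>idx n'. b j * I_mono \<gamma> j t) = (\<Sum>i\<le>k. a i * (map (I_mono \<gamma>) xs ! i) t)" for t
  proof -
    have "(\<Sum>j\<in>idx n'. b j * I_mono \<gamma> j t) = (\<Sum>i\<le>k. b (xs ! i) * I_mono \<gamma> (xs ! i) t)"
      by (rule sum.reindex_bij_betw[OF bij, symmetric])
    also have "\<dots> = (\<Sum>i\<le>k. a i * (map (I_mono \<gamma>) xs ! i) t)"
      by (intro sum.cong refl) (use k in \<open>simp add: b\<close>)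
    finally show ?thesis .
  qed
  then show "zeros_le (\<lambda>t. \<Sum>i\<le>k. a i * (map (I_mono \<gamma>) (sorted_list_of_set (idx n)) ! i) t) J k"
    using z' by (simp add: xs_def)
qed

text \<open>The leading term is removed degree by degree: by a monomial, which is kept in the sum,
  or, when the degree is divisible by 3, by a multiple of a power of \<open>U_poly\<close>, which
  costs nothing because its integral vanishes.\<close>

lemma oval_int_reduce:
  assumes "degree P \<le> d"
  shows "\<exists>a. \<forall>h\<in>L. oval_int h P = (\<Sum>j | j < d \<and> j mod 3 \<noteq> 2. a j * oval_int h (monom 1 (Suc j)))"
  using assms
proof (induction d arbitrary: P)
  case 0
  then obtain c where "P = [:c:]" by (metis degree_eq_zeroE le_zero_eq)
  then have "P = smult c (U_poly ^ 0)" by simp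
  then have "oval_int h P = 0" if "h \<in> L" for h
    using oval_int_U_power[OF that, of 0] by (simp only: oval_int_smult)
  then show ?case by simp
next
  case (Suc d)
  define c where "c = coeff P (Suc d)"
  have low: "\<exists>a. \<forall>h\<in>L. oval_int h (P - Q) = (\<Sum>j | j < d \<and> j mod 3 \<noteq> 2. a j * oval_int h (monom 1 (Suc j)))"
    if Q: "degree Q \<le> Suc d" "coeff Q (Suc d) = c" for Q
  proof (rule Suc.IH, rule degree_le, intro allI impI)
    fix i assume "i > d"
    then show "coeff (P - Q) i = 0"
      using Q Suc.prems by (cases "i = Suc d") (auto simp: c_def coeff_eq_0)
  qed
  have split: "oval_int h P = oval_int h (P - Q) + oval_int h Q" if "h \<in> L" for h Q
    using oval_int_add[OF that, of "P - Q" Q] by simp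
  show ?case
  proof (cases "d mod 3 = 2")
    case True
    then have "3 dvd Suc d" by presburger
    then obtain k where k: "Suc d = 3 * k" by (elim dvdE)
    \<comment> \<open>The factor \<open>3 ^ k\<close> cancels the leading coefficient
      \<open>(1/3) ^ k\<close> of \<open>U_poly ^ k\<close>.\<close>
    define Q where "Q = smult (c * 3 ^ k) (U_poly ^ k)"
    have "degree Q \<le> Suc d" unfolding Q_def k by (rule order.trans[OF degree_smult_le]) (simp add: degree_U_power)
    moreover have "coeff Q (Suc d) = c" unfolding Q_def k by (simp add: degree_U_power power_divide)
    ultimately obtain a where "\<forall>h\<in>L. oval_int h (P - Q) = (\<Sum>j | j < d \<and> j mod 3 \<noteq> 2. a j * oval_int h (monom 1 (Suc j)))"
      using low by blast
    moreover have "oval_int h Q = 0" if "h \<in> L" for h by (simp add: Q_def oval_int_smult oval_int_U_power[OF that])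
    moreover have "{j. j < Suc d \<and> j mod 3 \<noteq> 2} = {j. j < d \<and> j mod 3 \<noteq> 2}"
      using True by (auto simp: less_Suc_eq)
    ultimately show ?thesis using split[of _ Q] by (intro exI[of _ a]) simp
  next
    case False
    define Q where "Q = monom c (Suc d)"
    have "degree Q \<le> Suc d" "coeff Q (Suc d) = c" unfolding Q_def by (simp_all add: degree_monom_le)
    then obtain a where a: "\<forall>h\<in>L. oval_int h (P - Q) = (\<Sum>j | j < d \<and> j mod 3 \<noteq> 2. a j * oval_int h (monom 1 (Suc j)))"
      using low by blast
    have e: "{j. j < Suc d \<and> j mod 3 \<noteq> 2} = insert d {j. j < d \<and> j mod 3 \<noteq> 2}"
      using False by (auto simp: less_Suc_eq)
    have "oval_int h P = (\<Sum>j | j < Suc d \<and> j mod 3 \<noteq> 2. (a(d := c)) j * oval_int h (monom 1 (Suc j)))"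
      if h: "h \<in> L" for h
    proof -
      have "(\<Sum>j | j < Suc d \<and> j mod 3 \<noteq> 2. (a(d := c)) j * oval_int h (monom 1 (Suc j)))
          = c * oval_int h (monom 1 (Suc d)) + (\<Sum>j | j < d \<and> j mod 3 \<noteq> 2. (a(d := c)) j * oval_int h (monom 1 (Suc j)))"
        unfolding e by (subst sum.insert) auto
      also have "(\<Sum>j | j < d \<and> j mod 3 \<noteq> 2. (a(d := c)) j * oval_int h (monom 1 (Suc j)))
          = (\<Sum>j | j < d \<and> j mod 3 \<noteq> 2. a j * oval_int h (monom 1 (Suc j)))"
        by (intro sum.cong) auto
      finally show ?thesis using split[OF h, of Q] a h by (simp add: Q_def oval_int_monom[of h c])
    qed
    then show ?thesis by blast
  qed
qed

lemma I_poly_reduce: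
  assumes \<gamma>: "\<forall>h\<in>L. ccw_oval h (\<gamma> h)" and "degree P \<le> n + 1"
  shows "\<exists>a. \<forall>h\<in>L. I_poly \<gamma> P h = (\<Sum>j\<in>idx n. a j * I_mono \<gamma> j h)"
proof -
  obtain a where a: "\<And>h. h \<in> L \<Longrightarrow>
      oval_int h P = (\<Sum>j | j < n + 1 \<and> j mod 3 \<noteq> 2. a j * oval_int h (monom 1 (Suc j)))"
    using oval_int_reduce[OF assms(2)] by blast
  have i: "{j. j < n + 1 \<and> j mod 3 \<noteq> 2} = idx n" by (auto simp: idx_def)
  have "I_poly \<gamma> P h = (\<Sum>j\<in>idx n. (- a j * real (Suc j)) * I_mono \<gamma> j h)" if h: "h \<in> L" for h
  proof -
    have g: "ccw_oval h (\<gamma> h)" using \<gamma> h by auto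
    have "I_poly \<gamma> P h = oval_int h P" by (rule I_poly_eq[where \<gamma> = \<gamma>, OF h g])
    also have "\<dots> = (\<Sum>j\<in>idx n. (- a j * real (Suc j)) * I_mono \<gamma> j h)"
      unfolding a[OF h] i
      by (intro sum.cong refl) (simp add: I_mono_eq[where \<gamma> = \<gamma>, OF h g] del: of_nat_Suc)
    finally show ?thesis .
  qed
  then show ?thesis by (intro exI[of _ "\<lambda>j. - a j * real (Suc j)"]) auto
qed

text \<open>If \<open>n \<notin> idx n\<close>, then \<open>n + 1 = 3 * k\<close>, and adding
  \<open>U_poly ^ k\<close> raises the degree to exactly \<open>n + 1\<close> without changing the
  integral.\<close>

lemma I_poly_free:
  assumes \<gamma>: "\<forall>h\<in>L. ccw_oval h (\<gamma> h)"
  shows "\<exists>P. degree P \<le> n + 1 \<and> (n \<notin> idx n \<or> a n \<noteq> 0 \<longrightarrow> degree P = n + 1) \<and>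
     (\<forall>h\<in>L. I_poly \<gamma> P h = (\<Sum>j\<in>idx n. a j * I_mono \<gamma> j h))"
proof -
  define Q where "Q = (\<Sum>j\<in>idx n. monom (- a j / real (Suc j)) (Suc j))"
  define k where "k = (n + 1) div 3"
  define V where "V = (if n \<in> idx n then 0 else U_poly ^ k)"
  have k: "3 * k = n + 1" if "n \<notin> idx n"
  proof -
    have "n mod 3 = 2" using that by (simp add: idx_def)
    then show ?thesis unfolding k_def by presburger
  qed
  have dQ: "degree Q \<le> n + 1"
    unfolding Q_def by (intro degree_sum_le finite_idx order.trans[OF degree_monom_le]) (auto simp: idx_def)
  have dV: "degree V \<le> n + 1" using k by (auto simp: V_def degree_U_power)
  have deg: "degree (Q + V) \<le> n + 1" using dQ dV by (rule degree_add_le)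
  have cQ: "coeff Q (n + 1) = (if n \<in> idx n then - a n / real (Suc n) else 0)"
    unfolding Q_def coeff_sum coeff_monom using finite_idx[of n] by (simp add: sum.delta)
  have "coeff (Q + V) (n + 1) \<noteq> 0" if "n \<notin> idx n \<or> a n \<noteq> 0"
  proof (cases "n \<in> idx n")
    case True
    then show ?thesis using that cQ by (simp add: V_def del: of_nat_Suc)
  next
    case False
    have "coeff V (n + 1) = (1/3) ^ k" using False degree_U_power(2)[of k] k[OF False] by (simp add: V_def)
    then show ?thesis using False cQ by simp
  qed
  then have "degree (Q + V) = n + 1" if "n \<notin> idx n \<or> a n \<noteq> 0"
    using that deg le_degree[of "Q + V" "n + 1"] by simp
  moreover have "I_poly \<gamma> (Q + V) h = (\<Sum>j\<in>idx n. a j * I_mono \<gamma> j h)" if h: "h \<in> L" for h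
  proof -
    have g: "ccw_oval h (\<gamma> h)" using \<gamma> h by auto
    have "I_poly \<gamma> (Q + V) h = oval_int h Q + oval_int h V" by (simp add: I_poly_eq[where \<gamma> = \<gamma>, OF h g] oval_int_add[OF h])
    also have "oval_int h V = 0" using oval_int_U_power[OF h, of k] by (simp add: V_def) (simp add: oval_int_def)
    also have "oval_int h Q = (\<Sum>j\<in>idx n. - a j / real (Suc j) * oval_int h (monom 1 (Suc j)))"
      unfolding Q_def by (subst oval_int_sum[OF h finite_idx]) (intro sum.cong refl oval_int_monom)
    also have "\<dots> = (\<Sum>j\<in>idx n. a j * I_mono \<gamma> j h)"
      by (intro sum.cong refl) (simp add: I_mono_eq[where \<gamma> = \<gamma>, OF h g])
    finally show ?thesis by simp
  qed
  ultimately show ?thesis using deg by blast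
qed

lemma I_poly_expand:
  assumes \<gamma>: "\<forall>h\<in>L. ccw_oval h (\<gamma> h)" and h: "h \<in> L" and P: "degree P \<le> n + 1"
  shows "I_poly \<gamma> P h = - integral_dx (\<gamma> h) (\<lambda>z. poly (pderiv P) (Re z) * Im z)"
    and "I_poly \<gamma> P h = (\<Sum>j\<le>n. - coeff (pderiv P) j * I_mono \<gamma> j h)"
proof -
  have g: "ccw_oval h (\<gamma> h)" using \<gamma> h by auto
  note I = I_poly_eq[where \<gamma> = \<gamma>, OF h g]
  show "I_poly \<gamma> P h = - integral_dx (\<gamma> h) (\<lambda>z. poly (pderiv P) (Re z) * Im z)"
    unfolding I integral_dx_eq[OF h g] by simp
  have "oval_int h P = (\<Sum>i\<le>Suc n. coeff P i * oval_int h (monom 1 i))" using oval_int_coeffs[OF h, of P "Suc n"] P by simp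
  also have "\<dots> = coeff P 0 * oval_int h (monom 1 0) + (\<Sum>j\<le>n. coeff P (Suc j) * oval_int h (monom 1 (Suc j)))"
    by (rule sum.atMost_Suc_shift)
  also have "oval_int h (monom 1 0) = 0" using oval_int_U_power[OF h, of 0] by (simp add: monom_0 one_pCons)
  also have "(\<Sum>j\<le>n. coeff P (Suc j) * oval_int h (monom 1 (Suc j))) = (\<Sum>j\<le>n. - coeff (pderiv P) j * I_mono \<gamma> j h)"
    by (intro sum.cong refl) (simp add: I_mono_eq[where \<gamma> = \<gamma>, OF h g] coeff_pderiv del: of_nat_Suc)
  finally show "I_poly \<gamma> P h = (\<Sum>j\<le>n. - coeff (pderiv P) j * I_mono \<gamma> j h)" unfolding I by simp
qed

text \<open>Linear algebra prescribes \<open>N n\<close> zeros at arbitrary points of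
  \<open>J\<close>. The upper bound then does the rest: it forces the top coefficient to be nonzero
  when \<open>n\<close> is in \<open>idx n\<close>, hence degree \<open>n + 1\<close>, and it forces
  every prescribed zero to be simple.\<close>

lemma max_zeros_idx:
  assumes \<gamma>: "\<forall>h\<in>L. ccw_oval h (\<gamma> h)" and J: "open J" "J \<subseteq> L" "infinite J"
    and z: "\<And>n' a. n' \<le> n \<Longrightarrow> \<exists>j\<in>idx n'. a j \<noteq> 0 \<Longrightarrow>
      zeros_le (\<lambda>h. \<Sum>j\<in>idx n'. a j * I_mono \<gamma> j h) J (N n')"
  shows "max_zeros \<gamma> n J (N n)"
    and "\<exists>P a. degree P = n + 1 \<and>
        (\<forall>h\<in>L. I_poly \<gamma> P h = (\<Sum>j\<in>idx n. a j * I_mono \<gamma> j h)) \<and>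
        (\<exists>Z\<subseteq>L. finite Z \<and> card Z = N n \<and> (\<forall>h\<in>Z. simple_zero (I_poly \<gamma> P) h))"
proof -
  have upper: "count_mult (I_poly \<gamma> P) (zeros (I_poly \<gamma> P) J) \<le> enat (N n)"
    if P: "degree P \<le> n + 1" "\<exists>h\<in>J. I_poly \<gamma> P h \<noteq> 0" for P
  proof -
    obtain a where a: "\<And>h. h \<in> L \<Longrightarrow> I_poly \<gamma> P h = (\<Sum>j\<in>idx n. a j * I_mono \<gamma> j h)"
      using I_poly_reduce[OF \<gamma> P(1)] by blast
    have "\<exists>j\<in>idx n. a j \<noteq> 0"
    proof (rule ccontr)
      assume "\<not> (\<exists>j\<in>idx n. a j \<noteq> 0)"
      then have "I_poly \<gamma> P h = 0" if "h \<in> L" for h using a[OF that] by simp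
      then show False using P(2) J(2) by auto
    qed
    then have z': "zeros_le (\<lambda>h. \<Sum>j\<in>idx n. a j * I_mono \<gamma> j h) J (N n)" by (intro z) auto
    have "zeros_le (I_poly \<gamma> P) J (N n)"
      by (rule zeros_le_cong[OF L_eq(2) J(2) _ z']) (simp add: a)
    then show ?thesis by (rule count_mult_le) (auto simp: zeros_def)
  qed
  obtain T where T: "finite T" "card T = N n" "T \<subseteq> J"
    using infinite_arbitrarily_large[OF J(3)] by blast
  have "card T < card (idx n)" using T(2) card_idx_N[of n] by simp
  from exists_vanishing_combination[OF T(1) finite_idx this, of "I_mono \<gamma>"]
  obtain a where a: "\<exists>j\<in>idx n. a j \<noteq> 0" "\<And>t. t \<in> T \<Longrightarrow> (\<Sum>j\<in>idx n. a j * I_mono \<gamma> j t) = 0" by blast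
  have z': "zeros_le (\<lambda>h. \<Sum>j\<in>idx n. a j * I_mono \<gamma> j h) J (N n)" using a(1) by (intro z) auto
  \<comment> \<open>Otherwise the combination would live on \<open>idx m\<close> with
    \<open>n = Suc m\<close> and \<open>N n = N m + 1\<close>, and would have one zero more than
    allowed there.\<close>
  have top: "n \<notin> idx n \<or> a n \<noteq> 0"
  proof (rule ccontr)
    assume "\<not> (n \<notin> idx n \<or> a n \<noteq> 0)"
    then have n: "n \<in> idx n" "a n = 0" by auto
    then obtain m where m: "n = Suc m" using a(1) by (cases n) (auto simp: idx_0)
    have e: "idx n = insert n (idx m)" "n \<notin> idx m" using n(1) by (auto simp: m idx_def le_Suc_eq)
    have s: "(\<Sum>j\<in>idx n. a j * I_mono \<gamma> j h) = (\<Sum>j\<in>idx m. a j * I_mono \<gamma> j h)" for h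
      unfolding e(1) using e(2) n(2) finite_idx[of m] by simp
    have "\<exists>j\<in>idx m. a j \<noteq> 0" using a(1) n(2) e by auto
    then have zm: "zeros_le (\<lambda>h. \<Sum>j\<in>idx m. a j * I_mono \<gamma> j h) J (N m)" by (intro z) (auto simp: m)
    have "card T \<le> N m" by (rule zeros_le_card[OF zm T(1,3)]) (use a(2) s in auto)
    moreover have "card (idx n) = Suc (card (idx m))" unfolding e(1) using e(2) finite_idx by simp
    ultimately show False using T(2) card_idx_N[of n] card_idx_N[of m] by simp
  qed
  obtain P where P: "degree P = n + 1" "\<And>h. h \<in> L \<Longrightarrow> I_poly \<gamma> P h = (\<Sum>j\<in>idx n. a j * I_mono \<gamma> j h)"
    using I_poly_free[OF \<gamma>, of n a] top by blast
  have zP: "zeros_le (I_poly \<gamma> P) J (N n)"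
    by (rule zeros_le_cong[OF L_eq(2) J(2) _ z']) (simp add: P)
  have T0: "I_poly \<gamma> P t = 0" if "t \<in> T" for t using P(2) a(2) that T(3) J(2) by auto
  have nz: "\<exists>h\<in>J. I_poly \<gamma> P h \<noteq> 0"
  proof (rule ccontr)
    assume *: "\<not> (\<exists>h\<in>J. I_poly \<gamma> P h \<noteq> 0)"
    obtain F where F: "finite F" "card F = Suc (N n)" "F \<subseteq> J"
      using infinite_arbitrarily_large[OF J(3)] by blast
    have "card F \<le> N n" by (rule zeros_le_card[OF zP F(1,3)]) (use * F in auto)
    then show False using F(2) by simp
  qed
  have "enat (N n) \<le> count_mult (I_poly \<gamma> P) (zeros (I_poly \<gamma> P) J)"
    using count_mult_ge[OF T(1), of "zeros (I_poly \<gamma> P) J" "I_poly \<gamma> P"] T T0 by (auto simp: zeros_def)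
  then have "count_mult (I_poly \<gamma> P) (zeros (I_poly \<gamma> P) J) = enat (N n)"
    using upper[of P] P(1) nz by (intro antisym) auto
  then show "max_zeros \<gamma> n J (N n)"
    unfolding max_zeros_def using upper P(1) nz by blast
  have sm: "smooth_on L (I_poly \<gamma> P)"
  proof (rule smooth_on_cong[OF L_eq(2)])
    have *: "smooth_on L (\<lambda>h. \<Sum>j\<in>A. a j * I_mono \<gamma> j h)" if "finite A" for A
      using that by (induction A rule: finite_induct)
        (auto intro!: smooth_on_add smooth_on_mult smooth_I_mono \<gamma> L_eq(2))
    show "smooth_on L (\<lambda>h. \<Sum>j\<in>idx n. a j * I_mono \<gamma> j h)" by (rule *[OF finite_idx])
  qed (simp add: P)
  have "simple_zero (I_poly \<gamma> P) t" if t: "t \<in> T" for t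
  proof -
    have d: "(I_poly \<gamma> P has_real_derivative deriv (I_poly \<gamma> P) t) (at t)"
      using smooth_on_DERIV[OF sm, of t] t T(3) J(2) by auto
    \<comment> \<open>A double zero at \<open>t\<close> together with the other
      \<open>N n - 1\<close> prescribed zeros would exceed the bound \<open>N n\<close>.\<close>
    have "deriv (I_poly \<gamma> P) t \<noteq> 0"
    proof
      assume d0: "deriv (I_poly \<gamma> P) t = 0"
      have "sum (\<lambda>s. if s = t then 2 else 1) T \<le> N n"
      proof (rule zeros_leD[OF zP T(1,3)])
        fix s assume s: "s \<in> T"
        show "vanishes (if s = t then 2 else 1) (I_poly \<gamma> P) s"
          using T0[OF s] d0 by (auto simp: vanishes_Suc numeral_2_eq_2)
      qed
      moreover have "sum (\<lambda>s. if s = t then 2 else 1) T = (2 :: nat) + sum (\<lambda>s. 1) (T - {t})"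
        using T(1) t by (subst sum.remove[of _ t]) (auto intro!: sum.cong)
      moreover have "card (T - {t}) = card T - 1" "card T > 0"
        using T(1) t by (auto simp: card_gt_0_iff)
      ultimately show False using T(2) by simp
    qed
    then show ?thesis using d T0[OF t] by (auto simp: simple_zero_def)
  qed
  then show "\<exists>P a. degree P = n + 1 \<and>
        (\<forall>h\<in>L. I_poly \<gamma> P h = (\<Sum>j\<in>idx n. a j * I_mono \<gamma> j h)) \<and>
        (\<exists>Z\<subseteq>L. finite Z \<and> card Z = N n \<and> (\<forall>h\<in>Z. simple_zero (I_poly \<gamma> P) h))"
    using P T J(2) by blast
qed

text \<open>The interval found for one \<open>n\<close> gives only the bound \<open>N n\<close>, but
  initial segments of the family need the sharper bounds for smaller index sets. The minimum of
  finitely many radii serves all of them at once.\<close>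

lemma zeros_le_idx_near_0:
  assumes \<gamma>: "\<forall>h\<in>L. ccw_oval h (\<gamma> h)"
  obtains \<delta> where "0 < \<delta>" "\<delta> \<le> 1 / 6"
    "\<And>n a. n \<le> m \<Longrightarrow> \<exists>j\<in>idx n. a j \<noteq> 0 \<Longrightarrow>
      zeros_le (\<lambda>h. \<Sum>j\<in>idx n. a j * I_mono \<gamma> j h) {0<..<\<delta>} (N n)"
proof -
  have "\<exists>\<delta>. 0 < \<delta> \<and> \<delta> \<le> 1 / 6 \<and> (\<forall>a. (\<exists>j\<in>idx n. a j \<noteq> 0) \<longrightarrow>
      zeros_le (\<lambda>h. \<Sum>j\<in>idx n. a j * I_mono \<gamma> j h) {0<..<\<delta>} (N n))" for n
    using I_combination_near_0[OF \<gamma>, of n] by metis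
  then obtain d where d: "\<And>n. 0 < d n" "\<And>n. d n \<le> 1 / 6"
    "\<And>n a. \<exists>j\<in>idx n. a j \<noteq> 0 \<Longrightarrow>
      zeros_le (\<lambda>h. \<Sum>j\<in>idx n. a j * I_mono \<gamma> j h) {0<..<d n} (N n)" by metis
  define \<delta> where "\<delta> = Min (d ` {..m})"
  have le: "\<delta> \<le> d n" if "n \<le> m" for n unfolding \<delta>_def using that by (intro Min_le) auto
  have "0 < \<delta>" unfolding \<delta>_def using d(1) by (subst Min_gr_iff) auto
  moreover have "\<delta> \<le> 1 / 6" using le[of 0] d(2)[of 0] by simp
  moreover have "zeros_le (\<lambda>h. \<Sum>j\<in>idx n. a j * I_mono \<gamma> j h) {0<..<\<delta>} (N n)"
    if "n \<le> m" "\<exists>j\<in>idx n. a j \<noteq> 0" for n a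
    by (rule zeros_le_mono[OF d(3)[OF that(2)] order_refl]) (use le[OF that(1)] in auto)
  ultimately show thesis using that by blast
qed

lemma zeros_le_idx_L:
  assumes \<gamma>: "\<forall>h\<in>L. ccw_oval h (\<gamma> h)" and "n \<le> 3" and a: "\<exists>j\<in>idx n. a j \<noteq> 0"
  shows "zeros_le (\<lambda>h. \<Sum>j\<in>idx n. a j * I_mono \<gamma> j h) L (N n)"
proof -
  have i1: "idx 1 = {0, 1}" using idx_Suc[of 0] idx_0 by auto
  have i2: "idx 2 = {0, 1}" using idx_Suc[of 1] i1 unfolding Suc_1 by simp
  have i3: "idx 3 = {0, 1, 3}" using idx_Suc[of 2] i2 by auto
  note idx = i1 i2 i3
  have N: "N 0 = 0" "N 1 = 1" "N 2 = 1" "N 3 = 2" by (simp_all add: N_eq)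
  consider "n = 0" | "n = 1" | "n = 2" | "n = 3" using assms(2) by linarith
  then show ?thesis
  proof cases
    case 1
    then show ?thesis using zeros_le_I01(1)[OF \<gamma>, of "a 0"] a by (simp add: idx_0 N)
  next
    case 2
    then have "a 0 \<noteq> 0 \<or> a 1 \<noteq> 0" using a unfolding 2 idx by auto
    then show ?thesis using 2 zeros_le_I01(2)[OF \<gamma>, of "a 0" "a 1"] unfolding 2 idx N by simp
  next
    case 3
    then have "a 0 \<noteq> 0 \<or> a 1 \<noteq> 0" using a unfolding 3 idx by auto
    then show ?thesis using 3 zeros_le_I01(2)[OF \<gamma>, of "a 0" "a 1"] unfolding 3 idx N by simp
  next
    case 4
    then have "a 3 \<noteq> 0 \<or> a 1 \<noteq> 0 \<or> a 0 \<noteq> 0" using a unfolding 4 idx by auto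
    from zeros_le_I310(3)[OF \<gamma> this] show ?thesis unfolding 4 idx N by (simp add: add_ac)
  qed
qed

theorem theorem1p3:
  fixes \<gamma> :: "real \<Rightarrow> real \<Rightarrow> complex"
  assumes "\<forall>h\<in>L. ccw_oval h (\<gamma> h)"
  shows
    \<comment> \<open>representation of I; the second conjunct says that the coefficients a j are free\<close>
    "(\<forall>n P. degree P \<le> n + 1 \<longrightarrow>
        (\<forall>h\<in>L. I_poly \<gamma> P h
              = - integral_dx (\<gamma> h) (\<lambda>z. poly (pderiv P) (Re z) * Im z) \<and>
           I_poly \<gamma> P h = (\<Sum>j\<le>n. - coeff (pderiv P) j * I_mono \<gamma> j h)) \<and>
        (\<exists>a. \<forall>h\<in>L. I_poly \<gamma> P h = (\<Sum>j\<in>idx n. a j * I_mono \<gamma> j h))) \<and>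
     (\<forall>n (a :: nat \<Rightarrow> real). \<exists>P. degree P \<le> n + 1 \<and>
        (n \<notin> idx n \<or> a n \<noteq> 0 \<longrightarrow> degree P = n + 1) \<and>
        (\<forall>h\<in>L. I_poly \<gamma> P h = (\<Sum>j\<in>idx n. a j * I_mono \<gamma> j h))) \<and>
     \<comment> \<open>(i)\<close>
     (\<forall>n (a :: nat \<Rightarrow> real).
        (\<forall>h\<in>L. (\<Sum>j\<in>idx n. a j * I_mono \<gamma> j h) = 0) \<longrightarrow> (\<forall>j\<in>idx n. a j = 0)) \<and>
     (\<forall>n. N n = n - (n + 1) div 3) \<and>
     (\<forall>n. \<exists>P a. degree P = n + 1 \<and>
        (\<forall>h\<in>L. I_poly \<gamma> P h = (\<Sum>j\<in>idx n. a j * I_mono \<gamma> j h)) \<and>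
        (\<exists>Z\<subseteq>L. finite Z \<and> card Z = N n \<and> (\<forall>h\<in>Z. simple_zero (I_poly \<gamma> P) h))) \<and>
     \<comment> \<open>(ii)\<close>
     (\<exists>h1>0. h1 \<le> 1/6 \<and> (\<forall>n\<le>50.
        ECT_system (map (I_mono \<gamma>) (sorted_list_of_set (idx n))) {0<..<h1} \<and>
        max_zeros \<gamma> n {0<..<h1} (N n))) \<and>
     \<comment> \<open>(iii)\<close>
     ECT_system [I_mono \<gamma> 0, I_mono \<gamma> 1] L \<and>
     ECT_system [I_mono \<gamma> 3, I_mono \<gamma> 1, I_mono \<gamma> 0] L \<and>
     (\<forall>n\<le>3. max_zeros \<gamma> n L (N n))"
proof (intro conjI)
  note \<gamma> = assms
  have sub: "{0<..<\<delta>} \<subseteq> L" if "\<delta> \<le> 1 / 6" for \<delta> using that by (auto simp: L_def)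
  show "\<forall>n P. degree P \<le> n + 1 \<longrightarrow>
        (\<forall>h\<in>L. I_poly \<gamma> P h
              = - integral_dx (\<gamma> h) (\<lambda>z. poly (pderiv P) (Re z) * Im z) \<and>
           I_poly \<gamma> P h = (\<Sum>j\<le>n. - coeff (pderiv P) j * I_mono \<gamma> j h)) \<and>
        (\<exists>a. \<forall>h\<in>L. I_poly \<gamma> P h = (\<Sum>j\<in>idx n. a j * I_mono \<gamma> j h))"
    using I_poly_expand[OF \<gamma>] I_poly_reduce[OF \<gamma>] by blast
  show "\<forall>n (a :: nat \<Rightarrow> real). \<exists>P. degree P \<le> n + 1 \<and>
        (n \<notin> idx n \<or> a n \<noteq> 0 \<longrightarrow> degree P = n + 1) \<and>
        (\<forall>h\<in>L. I_poly \<gamma> P h = (\<Sum>j\<in>idx n. a j * I_mono \<gamma> j h))"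
    using I_poly_free[OF \<gamma>] by blast
  show "\<forall>n (a :: nat \<Rightarrow> real).
        (\<forall>h\<in>L. (\<Sum>j\<in>idx n. a j * I_mono \<gamma> j h) = 0) \<longrightarrow> (\<forall>j\<in>idx n. a j = 0)"
  proof (intro allI impI, rule ccontr)
    fix n and a :: "nat \<Rightarrow> real"
    assume 0: "\<forall>h\<in>L. (\<Sum>j\<in>idx n. a j * I_mono \<gamma> j h) = 0" and "\<not> (\<forall>j\<in>idx n. a j = 0)"
    then have a: "\<exists>j\<in>idx n. a j \<noteq> 0" by blast
    obtain \<delta> where \<delta>: "0 < \<delta>" "\<delta> \<le> 1 / 6"
      "\<And>a. \<exists>j\<in>idx n. a j \<noteq> 0 \<Longrightarrow> zeros_le (\<lambda>h. \<Sum>j\<in>idx n. a j * I_mono \<gamma> j h) {0<..<\<delta>} (N n)"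
      using I_combination_near_0[OF \<gamma>] by blast
    \<comment> \<open>A nontrivial combination that vanishes identically would have
      \<open>N n + 1\<close> zeros in this interval.\<close>
    have "infinite {0<..<\<delta>}" using \<delta>(1) by (rule infinite_Ioo)
    then obtain F where F: "finite F" "card F = Suc (N n)" "F \<subseteq> {0<..<\<delta>}"
      using infinite_arbitrarily_large by blast
    have "card F \<le> N n"
      by (rule zeros_le_card[OF \<delta>(3)[OF a] F(1,3)]) (use 0 F(3) sub[OF \<delta>(2)] in auto)
    then show False using F(2) by simp
  qed
  show "\<forall>n. N n = n - (n + 1) div 3" using N_eq by blast
  show "\<forall>n. \<exists>P a. degree P = n + 1 \<and>
        (\<forall>h\<in>L. I_poly \<gamma> P h = (\<Sum>j\<in>idx n. a j * I_mono \<gamma> j h)) \<and>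
        (\<exists>Z\<subseteq>L. finite Z \<and> card Z = N n \<and> (\<forall>h\<in>Z. simple_zero (I_poly \<gamma> P) h))"
  proof
    fix m
    obtain \<delta> where \<delta>: "0 < \<delta>" "\<delta> \<le> 1 / 6"
      "\<And>n a. n \<le> m \<Longrightarrow> \<exists>j\<in>idx n. a j \<noteq> 0 \<Longrightarrow>
        zeros_le (\<lambda>h. \<Sum>j\<in>idx n. a j * I_mono \<gamma> j h) {0<..<\<delta>} (N n)"
      using zeros_le_idx_near_0[OF \<gamma>] by blast
    show "\<exists>P a. degree P = m + 1 \<and>
        (\<forall>h\<in>L. I_poly \<gamma> P h = (\<Sum>j\<in>idx m. a j * I_mono \<gamma> j h)) \<and>
        (\<exists>Z\<subseteq>L. finite Z \<and> card Z = N m \<and> (\<forall>h\<in>Z. simple_zero (I_poly \<gamma> P) h))"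
      by (rule max_zeros_idx(2)[OF \<gamma> _ sub[OF \<delta>(2)] infinite_Ioo[OF \<delta>(1)] \<delta>(3)]) auto
  qed
  show "\<exists>h1>0. h1 \<le> 1/6 \<and> (\<forall>n\<le>50.
        ECT_system (map (I_mono \<gamma>) (sorted_list_of_set (idx n))) {0<..<h1} \<and>
        max_zeros \<gamma> n {0<..<h1} (N n))"
  proof -
    obtain \<delta> where \<delta>: "0 < \<delta>" "\<delta> \<le> 1 / 6"
      "\<And>n a. n \<le> 50 \<Longrightarrow> \<exists>j\<in>idx n. a j \<noteq> 0 \<Longrightarrow>
        zeros_le (\<lambda>h. \<Sum>j\<in>idx n. a j * I_mono \<gamma> j h) {0<..<\<delta>} (N n)"
      using zeros_le_idx_near_0[OF \<gamma>, of 50] by blast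
    have "ECT_system (map (I_mono \<gamma>) (sorted_list_of_set (idx n))) {0<..<\<delta>} \<and>
        max_zeros \<gamma> n {0<..<\<delta>} (N n)" if n: "n \<le> 50" for n
      by (intro conjI ECT_idx[OF \<gamma> sub[OF \<delta>(2)]]
          max_zeros_idx(1)[OF \<gamma> _ sub[OF \<delta>(2)] infinite_Ioo[OF \<delta>(1)]] \<delta>(3)) (use n in auto)
    then show ?thesis using \<delta>(1,2) by blast
  qed
  have "smooth_on L (I_mono \<gamma> j)" for j by (rule smooth_I_mono[OF \<gamma>])
  note sm = this
  show "ECT_system [I_mono \<gamma> 0, I_mono \<gamma> 1] L"
  proof (rule ECT_systemI)
    fix k and a :: "nat \<Rightarrow> real"
    assume k: "k < length [I_mono \<gamma> 0, I_mono \<gamma> 1]" and a: "\<exists>i\<le>k. a i \<noteq> 0"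
    from k consider "k = 0" | "k = 1" by fastforce
    then show "zeros_le (\<lambda>t. \<Sum>i\<le>k. a i * ([I_mono \<gamma> 0, I_mono \<gamma> 1] ! i) t) L k"
    proof cases
      case 1 then show ?thesis using zeros_le_I01(1)[OF \<gamma>, of "a 0"] a by simp
    next
      case 2
      then have "a 0 \<noteq> 0 \<or> a 1 \<noteq> 0" using a by (auto simp: le_Suc_eq)
      from zeros_le_I01(2)[OF \<gamma> this] show ?thesis unfolding 2 by simp
    qed
  qed (use sm in auto)
  show "ECT_system [I_mono \<gamma> 3, I_mono \<gamma> 1, I_mono \<gamma> 0] L"
  proof (rule ECT_systemI)
    fix k and a :: "nat \<Rightarrow> real"
    assume k: "k < length [I_mono \<gamma> 3, I_mono \<gamma> 1, I_mono \<gamma> 0]" and a: "\<exists>i\<le>k. a i \<noteq> 0"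
    from k consider "k = 0" | "k = 1" | "k = 2" by fastforce
    then show "zeros_le (\<lambda>t. \<Sum>i\<le>k. a i * ([I_mono \<gamma> 3, I_mono \<gamma> 1, I_mono \<gamma> 0] ! i) t) L k"
    proof cases
      case 1 then show ?thesis using zeros_le_I310(1)[OF \<gamma>, of "a 0"] a by simp
    next
      case 2
      then have "a 0 \<noteq> 0 \<or> a 1 \<noteq> 0" using a by (auto simp: le_Suc_eq)
      from zeros_le_I310(2)[OF \<gamma> this] show ?thesis unfolding 2 by simp
    next
      case 3
      then have "a 0 \<noteq> 0 \<or> a 1 \<noteq> 0 \<or> a 2 \<noteq> 0" using a by (auto simp: le_Suc_eq numeral_2_eq_2)
      from zeros_le_I310(3)[OF \<gamma> this] show ?thesis unfolding 3 by (simp add: numeral_2_eq_2)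
    qed
  qed (use sm in auto)
  show "\<forall>n\<le>3. max_zeros \<gamma> n L (N n)"
  proof (intro allI impI)
    fix n :: nat assume n: "n \<le> 3"
    have "infinite L" unfolding L_def by (rule infinite_Ioo) simp
    then show "max_zeros \<gamma> n L (N n)"
      by (intro max_zeros_idx(1)[OF \<gamma> L_eq(2) order_refl] zeros_le_idx_L[OF \<gamma>]) (use n in auto)
  qed
qed

end
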